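(* Let $i>1$ be an integer and let $F_{i,0}:\mathbb{T}^2\to\mathbb{T}^2$, $F_{i,0}(y,x)=(iy,x) \bmod 1$. There exist arbitrarily small smooth perturbations $F$, $F(y,x)=(g(y),f_y(x))$, of $F_{i,0}$ (that is, such an $F$ exists in every neighborhood of $F_{i,0}$ in the space of smooth skew product maps) that are robustly topologically mixing skew product maps, both when considered on $\mathbb{T}^2$ and when considered on $\mathcal{S}\times\mathbb{T}$. Moreover, $F$ can be taken such that \begin{enumerate} \item there are $k\in\mathbb{N}$, $k\geq 1$, and $\hat y\in\mathbb{T}$ with $g^k(\hat y)=\hat y$ such that $f^k_{\hat y}$ has a unique hyperbolic attracting fixed point and a unique hyperbolic repelling fixed point, and no other fixed points; \item for any $(\mathbf{y},x)\in\mathcal{S}\times\mathbb{T}$, the strong stable manifold $W^{ss}(\mathbf{y},x)$ and the strong unstable manifold $W^{uu}(\mathbf{y},x)$ are each dense in $\mathcal{S}\times\mathbb{T}$. \end{enumerate}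
   Context: $\mathbb{T}=\mathbb{R}/\mathbb{Z}$. A smooth skew product map on $\mathbb{T}^2$ is a smooth map $F(y,x)=(g(y),f_y(x))$ with $g:\mathbb{T}\to\mathbb{T}$ a smooth endomorphism and each $f_y$ a diffeomorphism of $\mathbb{T}$; the space of these maps carries the $C^r$ topology for a fixed $r\ge2$. For maps near $F_{i,0}$, $g$ is expanding ($g'>1$). Write $f^n_y=f_{g^{n-1}(y)}\circ\cdots\circ f_y$, so $F^n(y,x)=(g^n(y),f^n_y(x))$. The solenoid of $g$ is $\mathcal{S}=\{(\ldots,y_{-1},y_0)\in\mathbb{T}^{-\mathbb{N}} : y_{-j}=g(y_{-j-1})\text{ for all } j\geq 0\}$ with the product topology. The map $g$ extends to the homeomorphism $g(\ldots,y_{-1},y_0)=(\ldots,y_{-1},y_0,g(y_0))$ of $\mathcal{S}$, and $F$ extends to the homeomorphism $F(\mathbf{y},x)=(g(\mathbf{y}),f_{y_0}(x))$ of $\mathcal{S}\times\mathbb{T}$, where $\mathbf{y}=(\ldots,y_{-1},y_0)$. A map $F$ of a space $X$ is topologically mixing if for all nonempty open $U,V\subset X$, $F^n(U)\cap V\neq\emptyset$ for all large enough $n$. $F$ is robustly topologically mixing (on $\mathbb{T}^2$, respectively on $\mathcal{S}\times\mathbb{T}$) if every smooth skew product map sufficiently close to $F$ is topologically mixing on $\mathbb{T}^2$ (respectively, its extension to the product of the corresponding solenoid with $\mathbb{T}$ is topologically mixing). For $F$ close to $F_{i,0}$, $m=\max_{y,x} f_y'(x)<\min_y g'(y)$, and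 (embedding the solenoid as a hyperbolic attractor) $F$ on $\mathcal{S}\times\mathbb{T}$ is partially hyperbolic, with one-dimensional strong unstable direction, center direction the fibers $\{\mathbf{y}\}\times\mathbb{T}$, and the remaining directions strong stable. The strong stable and strong unstable manifolds are described intrinsically as follows. With $\pi(\mathbf{y},x)=(y_0,x)\in\mathbb{T}^2$, $W^{ss}(\mathbf{y},x)$ is the set of $(\mathbf{z},w)\in\mathcal{S}\times\mathbb{T}$ such that $\pi F^n(\mathbf{z},w)=\pi F^n(\mathbf{y},x)$ for some $n\ge0$ (the local strong stable manifold of $(\mathbf{y},x)$ is $\{\mathbf{z}\in\mathcal{S}: z_0=y_0\}\times\{x\}$). $W^{uu}(\mathbf{y},x)$ is the set of $(\mathbf{z},w)$ whose backward orbit approaches that of $(\mathbf{y},x)$ at a rate faster than the center direction allows, i.e. $\limsup_{n\to\infty}\frac1n\log d(\pi F^{-n}(\mathbf{z},w),\pi F^{-n}(\mathbf{y},x))<-\log m$, with $d$ the distance on $\mathbb{T}^2$. A fixed point $p$ of a circle diffeomorphism $h$ is hyperbolic attracting if $|h'(p)|<1$ and hyperbolic repelling if $|h'(p)|>1$. *)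

theory Defs
  imports "HOL-Analysis.Analysis"
begin

section \<open>The circle \<open>\<real>/\<int>\<close>\<close>

quotient_type circle = real / "\<lambda>x y :: real. x - y \<in> \<int>"
  morphisms rep_circle to_circle
proof (rule equivpI)
  show "reflp (\<lambda>x y :: real. x - y \<in> \<int>)"
    by (simp add: reflp_def)
  show "symp (\<lambda>x y :: real. x - y \<in> \<int>)"
    by (metis (mono_tags, lifting) Ints_minus minus_diff_eq sympI)
  show "transp (\<lambda>x y :: real. x - y \<in> \<int>)"
  proof (rule transpI)
    fix x y z :: real
    assume "x - y \<in> \<int>" "y - z \<in> \<int>"
    then have "(x - y) + (y - z) \<in> \<int>" by (rule Ints_add)
    then show "x - z \<in> \<int>" by simp
  qed
qed

lemma to_circle_eq_iff: "to_circle x = to_circle y \<longleftrightarrow> x - y \<in> \<int>"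
  by (rule circle.abs_eq_iff)

text \<open>The quotient metric is the distance of \<open>x - y\<close> to the nearest integer.\<close>

definition dist_int :: "real \<Rightarrow> real" where
  "dist_int t = \<bar>t - of_int (round t)\<bar>"

lemma dist_int_le: "dist_int t \<le> \<bar>t - of_int n\<bar>"
  unfolding dist_int_def by (rule round_diff_minimal)

lemma dist_int_add_of_int: "dist_int (t + of_int n) = dist_int t"
proof (rule antisym)
  have *: "dist_int (s + of_int k) \<le> dist_int s" for s k
    using dist_int_le[of "s + of_int k" "round s + k"] by (simp add: dist_int_def)
  show "dist_int (t + of_int n) \<le> dist_int t" by (rule *)
  show "dist_int t \<le> dist_int (t + of_int n)"
    using *[of "t + of_int n" "- n"] by simp
qed

lemma dist_int_minus: "dist_int (- t) = dist_int t"
proof (rule antisym)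
  have *: "dist_int (- s) \<le> dist_int s" for s
    using dist_int_le[of "- s" "- round s"] by (simp add: dist_int_def abs_minus_commute)
  show "dist_int (- t) \<le> dist_int t" by (rule *)
  show "dist_int t \<le> dist_int (- t)" using *[of "- t"] by simp
qed

lemma dist_int_triangle: "dist_int (s + t) \<le> dist_int s + dist_int t"
  using dist_int_le[of "s + t" "round s + round t"] by (simp add: dist_int_def)

lemma dist_int_eq_0_iff: "dist_int t = 0 \<longleftrightarrow> t \<in> \<int>"
proof
  assume "dist_int t = 0"
  then have "t = of_int (round t)" by (simp add: dist_int_def)
  then show "t \<in> \<int>" by (metis Ints_of_int)
qed (auto simp: dist_int_def elim: Ints_cases)

instantiation circle :: metric_space
begin

lift_definition dist_circle :: "circle \<Rightarrow> circle \<Rightarrow> real" is "\<lambda>x y. dist_int (x - y)"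
proof -
  fix x x' y y' :: real
  assume "x - x' \<in> \<int>" "y - y' \<in> \<int>"
  then obtain a b where "x - x' = of_int a" "y - y' = of_int b"
    by (auto elim!: Ints_cases)
  then have "x - y = (x' - y') + of_int (a - b)" by simp
  then show "dist_int (x - y) = dist_int (x' - y')"
    by (simp only: dist_int_add_of_int)
qed

definition uniformity_circle :: "(circle \<times> circle) filter" where
  "uniformity_circle = (INF e\<in>{0<..}. principal {(x, y). dist x y < e})"

definition open_circle :: "circle set \<Rightarrow> bool" where
  "open_circle U \<longleftrightarrow> (\<forall>x\<in>U. \<forall>\<^sub>F (x', y) in uniformity. x' = x \<longrightarrow> y \<in> U)"

instance
proof
  show "uniformity = (INF e\<in>{0<..}. principal {(x :: circle, y). dist x y < e})"
    by (rule uniformity_circle_def)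
  show "open U \<longleftrightarrow> (\<forall>x\<in>U. \<forall>\<^sub>F (x', y) in uniformity. x' = x \<longrightarrow> y \<in> U)" for U :: "circle set"
    by (rule open_circle_def)
  show "dist x y = 0 \<longleftrightarrow> x = y" for x y :: circle
    by transfer (rule dist_int_eq_0_iff)
  show "dist x y \<le> dist x z + dist y z" for x y z :: circle
  proof transfer
    fix x y z :: real
    show "dist_int (x - y) \<le> dist_int (x - z) + dist_int (y - z)"
      using dist_int_triangle[of "x - z" "z - y"] dist_int_minus[of "y - z"] by simp
  qed
qed

end

type_synonym torus = "circle \<times> circle"

definition to_torus :: "real \<times> real \<Rightarrow> torus" where
  "to_torus = map_prod to_circle to_circle"


section \<open>Smooth maps of the circle and of the torus\<close>

text \<open>Differentiability of all iterated partial derivatives makes them continuous, so \<open>smooth\<close>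
  is \<open>C\<^sup>\<infinity>\<close>.\<close>

primrec partials :: "'a list \<Rightarrow> ('a \<Rightarrow> 'b) \<Rightarrow> 'a::euclidean_space \<Rightarrow> 'b::real_normed_vector" where
  "partials [] \<Phi> = \<Phi>"
| "partials (b # bs) \<Phi> = (\<lambda>v. frechet_derivative (partials bs \<Phi>) (at v) b)"

definition smooth :: "('a::euclidean_space \<Rightarrow> 'b::real_normed_vector) \<Rightarrow> bool" where
  "smooth \<Phi> \<longleftrightarrow> (\<forall>bs\<in>lists Basis. \<forall>v. partials bs \<Phi> differentiable (at v))"

text \<open>A map of \<open>\<real>/\<int>\<close> or \<open>\<real>\<^sup>2/\<int>\<^sup>2\<close> is smooth iff it has a smooth lift through the universal
  covering \<open>pr\<close>, which is \<open>to_circle\<close> or \<open>to_torus\<close>.\<close>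

definition smooth_lift :: "('a::euclidean_space \<Rightarrow> 'm) \<Rightarrow> ('m \<Rightarrow> 'm) \<Rightarrow> ('a \<Rightarrow> 'a) \<Rightarrow> bool" where
  "smooth_lift pr h \<Phi> \<longleftrightarrow> smooth \<Phi> \<and> (\<forall>v. h (pr v) = pr (\<Phi> v))"

definition smooth_circle :: "(circle \<Rightarrow> circle) \<Rightarrow> bool" where
  "smooth_circle h \<longleftrightarrow> (\<exists>H. smooth_lift to_circle h H)"

definition smooth_torus :: "(torus \<Rightarrow> torus) \<Rightarrow> bool" where
  "smooth_torus F \<longleftrightarrow> (\<exists>\<Phi>. smooth_lift to_torus F \<Phi>)"

definition circle_diffeo :: "(circle \<Rightarrow> circle) \<Rightarrow> bool" where
  "circle_diffeo h \<longleftrightarrow> bij h \<and> smooth_circle h \<and> smooth_circle (inv h)"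

text \<open>The derivative of a smooth circle map; it does not depend on the choice of the lift \<open>H\<close>
  nor of the representative \<open>t\<close>.\<close>

definition circle_deriv :: "(circle \<Rightarrow> circle) \<Rightarrow> circle \<Rightarrow> real" where
  "circle_deriv h x =
     (THE d. \<exists>H t. smooth_lift to_circle h H \<and> to_circle t = x \<and> (H has_real_derivative d) (at t))"

text \<open>The basic neighbourhoods of the \<open>C\<^sup>r\<close> topology on smooth torus maps. Two lifts of the
  same map differ by a constant, so the derivatives do not depend on the chosen lifts.\<close>

definition Cr_close :: "nat \<Rightarrow> real \<Rightarrow> (torus \<Rightarrow> torus) \<Rightarrow> (torus \<Rightarrow> torus) \<Rightarrow> bool" where
  "Cr_close r \<epsilon> F F' \<longleftrightarrow>
     (\<forall>p. dist (F p) (F' p) < \<epsilon>) \<and>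
     (\<exists>\<Phi> \<Phi>'. smooth_lift to_torus F \<Phi> \<and> smooth_lift to_torus F' \<Phi>' \<and>
        (\<forall>bs\<in>lists Basis. 1 \<le> length bs \<and> length bs \<le> r \<longrightarrow>
           (\<forall>v. norm (partials bs \<Phi> v - partials bs \<Phi>' v) < \<epsilon>)))"


section \<open>Skew products and their solenoidal extensions\<close>

definition skew_map :: "(circle \<Rightarrow> circle) \<Rightarrow> (circle \<Rightarrow> circle \<Rightarrow> circle) \<Rightarrow> torus \<Rightarrow> torus" where
  "skew_map g f = (\<lambda>(y, x). (g y, f y x))"

definition smooth_skew_product :: "(circle \<Rightarrow> circle) \<Rightarrow> (circle \<Rightarrow> circle \<Rightarrow> circle) \<Rightarrow> bool" where
  "smooth_skew_product g f \<longleftrightarrow>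
     smooth_circle g \<and> smooth_torus (skew_map g f) \<and> (\<forall>y. circle_diffeo (f y))"

lift_definition circle_mult :: "int \<Rightarrow> circle \<Rightarrow> circle" is "\<lambda>i x. of_int i * x"
proof -
  fix i :: int and x y :: real
  assume "x - y \<in> \<int>"
  then have "of_int i * (x - y) \<in> \<int>" by (intro Ints_mult Ints_of_int)
  then show "of_int i * x - of_int i * y \<in> \<int>" by (simp add: right_diff_distrib)
qed

definition F0 :: "int \<Rightarrow> torus \<Rightarrow> torus" where
  "F0 i = skew_map (circle_mult i) (\<lambda>y x. x)"

primrec fiber_iter ::
    "(circle \<Rightarrow> circle) \<Rightarrow> (circle \<Rightarrow> circle \<Rightarrow> circle) \<Rightarrow> nat \<Rightarrow> circle \<Rightarrow> circle \<Rightarrow> circle" where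
  "fiber_iter g f 0 y = id"
| "fiber_iter g f (Suc n) y = f ((g ^^ n) y) \<circ> fiber_iter g f n y"

text \<open>A point \<open>(\<dots>, y\<^sub>-\<^sub>1, y\<^sub>0)\<close> of the solenoid is the sequence \<open>ys\<close> with \<open>ys j = y\<^sub>-\<^sub>j\<close>. The type
  \<open>nat \<Rightarrow> circle\<close> carries the product topology.\<close>

definition solenoid :: "(circle \<Rightarrow> circle) \<Rightarrow> (nat \<Rightarrow> circle) set" where
  "solenoid g = {ys. \<forall>j. ys j = g (ys (Suc j))}"

definition solenoid_space :: "(circle \<Rightarrow> circle) \<Rightarrow> ((nat \<Rightarrow> circle) \<times> circle) topology" where
  "solenoid_space g = top_of_set (solenoid g \<times> UNIV)"

definition solenoid_shift :: "(circle \<Rightarrow> circle) \<Rightarrow> (nat \<Rightarrow> circle) \<Rightarrow> nat \<Rightarrow> circle" where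
  "solenoid_shift g ys = case_nat (g (ys 0)) ys"

definition skew_ext :: "(circle \<Rightarrow> circle) \<Rightarrow> (circle \<Rightarrow> circle \<Rightarrow> circle) \<Rightarrow>
    (nat \<Rightarrow> circle) \<times> circle \<Rightarrow> (nat \<Rightarrow> circle) \<times> circle" where
  "skew_ext g f = (\<lambda>(ys, x). (solenoid_shift g ys, f (ys 0) x))"

definition skew_ext_inv :: "(circle \<Rightarrow> circle) \<Rightarrow> (circle \<Rightarrow> circle \<Rightarrow> circle) \<Rightarrow>
    (nat \<Rightarrow> circle) \<times> circle \<Rightarrow> (nat \<Rightarrow> circle) \<times> circle" where
  "skew_ext_inv g f = inv_into (solenoid g \<times> UNIV) (skew_ext g f)"

definition solenoid_proj :: "(nat \<Rightarrow> circle) \<times> circle \<Rightarrow> torus" where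
  "solenoid_proj = (\<lambda>(ys, x). (ys 0, x))"


section \<open>Robust topological mixing\<close>

definition topologically_mixing :: "'a topology \<Rightarrow> ('a \<Rightarrow> 'a) \<Rightarrow> bool" where
  "topologically_mixing X T \<longleftrightarrow>
     (\<forall>U V. openin X U \<and> U \<noteq> {} \<and> openin X V \<and> V \<noteq> {} \<longrightarrow>
        (\<exists>N. \<forall>n\<ge>N. (T ^^ n) ` U \<inter> V \<noteq> {}))"

definition robustly_mixing_torus ::
    "nat \<Rightarrow> (circle \<Rightarrow> circle) \<Rightarrow> (circle \<Rightarrow> circle \<Rightarrow> circle) \<Rightarrow> bool" where
  "robustly_mixing_torus r g f \<longleftrightarrow>
     (\<exists>\<delta>>0. \<forall>g' f'. smooth_skew_product g' f' \<and> Cr_close r \<delta> (skew_map g f) (skew_map g' f') \<longrightarrow>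
        topologically_mixing euclidean (skew_map g' f'))"

definition robustly_mixing_solenoid ::
    "nat \<Rightarrow> (circle \<Rightarrow> circle) \<Rightarrow> (circle \<Rightarrow> circle \<Rightarrow> circle) \<Rightarrow> bool" where
  "robustly_mixing_solenoid r g f \<longleftrightarrow>
     (\<exists>\<delta>>0. \<forall>g' f'. smooth_skew_product g' f' \<and> Cr_close r \<delta> (skew_map g f) (skew_map g' f') \<longrightarrow>
        topologically_mixing (solenoid_space g') (skew_ext g' f'))"


section \<open>Hyperbolic fixed points and strong manifolds\<close>

definition attracting_fixpoint :: "(circle \<Rightarrow> circle) \<Rightarrow> circle \<Rightarrow> bool" where
  "attracting_fixpoint h p \<longleftrightarrow> h p = p \<and> \<bar>circle_deriv h p\<bar> < 1"

definition repelling_fixpoint :: "(circle \<Rightarrow> circle) \<Rightarrow> circle \<Rightarrow> bool" where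
  "repelling_fixpoint h p \<longleftrightarrow> h p = p \<and> \<bar>circle_deriv h p\<bar> > 1"

text \<open>\<open>m = max f\<^sub>y'(x)\<close>; the maximum exists because the torus is compact.\<close>

definition max_fiber_deriv :: "(circle \<Rightarrow> circle \<Rightarrow> circle) \<Rightarrow> real" where
  "max_fiber_deriv f = (SUP (y, x). circle_deriv (f y) x)"

text \<open>The logarithm with \<open>log 0 = -\<infinity>\<close> (whereas \<open>ln 0 = 0\<close>), as needed when the two backward
  orbits coincide.\<close>

definition elog :: "real \<Rightarrow> ereal" where
  "elog t = (if t = 0 then -\<infinity> else ereal (ln t))"

definition Wss :: "(circle \<Rightarrow> circle) \<Rightarrow> (circle \<Rightarrow> circle \<Rightarrow> circle) \<Rightarrow>
    (nat \<Rightarrow> circle) \<times> circle \<Rightarrow> ((nat \<Rightarrow> circle) \<times> circle) set" where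
  "Wss g f p = {q \<in> solenoid g \<times> UNIV.
     \<exists>n. solenoid_proj ((skew_ext g f ^^ n) q) = solenoid_proj ((skew_ext g f ^^ n) p)}"

definition Wuu :: "(circle \<Rightarrow> circle) \<Rightarrow> (circle \<Rightarrow> circle \<Rightarrow> circle) \<Rightarrow>
    (nat \<Rightarrow> circle) \<times> circle \<Rightarrow> ((nat \<Rightarrow> circle) \<times> circle) set" where
  "Wuu g f p = {q \<in> solenoid g \<times> UNIV.
     limsup (\<lambda>n. elog (dist (solenoid_proj ((skew_ext_inv g f ^^ n) q))
                            (solenoid_proj ((skew_ext_inv g f ^^ n) p))) / ereal (real n))
       < ereal (- ln (max_fiber_deriv f))}"

end

theory Submission
  imports Defs
begin

text \<open>
  The map is \<open>F (y, x) = (i y, x + a (sin 2\<pi>x + b y (1 - sin 2\<pi>x)))\<close> with a small irrational \<open>a > 0\<close>. The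
  profile \<open>b\<close> vanishes at \<open>0\<close> and equals \<open>1\<close> at the two points \<open>\<plusminus>1/(i+1)\<close>, which \<open>y \<mapsto> i y\<close> interchanges. Over the
  fixed point \<open>0\<close> the fibre map is therefore the north-south map \<open>x + a sin 2\<pi>x\<close>, which repels from \<open>0\<close> and
  attracts to \<open>1/2\<close>; over the orbit of period two it is the rigid rotation by \<open>a\<close>.

  On the universal cover the base expands much more strongly than the fibres move, so that the images of
  horizontal lines stay nearly horizontal. Hence along such a line any future of the base point can be
  prescribed, and the motion in the fibre is known up to \<open>O(a)\<close>. Following \<open>\<plusminus>1/(i+1)\<close> for many steps rotates the
  fibre; the derivative along the fibre changes only by a factor \<open>1 + O(a)\<close>, uniformly in the number of steps,
  because \<open>b - 1\<close> is summable along the orbit. Following \<open>0\<close> for \<open>K\<close> steps with \<open>x\<close> near \<open>0\<close> expands the fibre by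
  more than \<open>1 + K a\<close>. So rotating until \<open>x\<close> is near \<open>0\<close> and then staying there \<open>K\<close> steps, for a large constant \<open>K\<close>,
  stretches the fibre direction by a definite factor, and repeating this, every open set grows until it contains a
  box of fixed size (\<open>stage\<close>, \<open>growth\<close>). These are finitely many steps with definite gains, so everything holds for
  all maps that are \<open>C\<^sup>1\<close> close to \<open>F\<close>. A box of fixed size covers the torus in boundedly many steps of \<open>F\<close>: rotate
  to \<open>0\<close>, stay there, rotate to the target (\<open>covering_at_scale\<close>). Boundedly many steps survive a small perturbation.
  Consequently, for every skew product near \<open>F\<close>, each open set is eventually mapped onto the whole torus
  (\<open>robustly_eventually_onto\<close>).

  Mixing on the torus is immediate from this. An open set of the solenoidal extension contains an iterate
  of the full preimage of an open set of the torus (\<open>open_contains_image\<close>), and this transfers mixing to the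
  solenoid and shows that the strong stable manifolds are dense.

  The projection of a strong unstable manifold is a nearly horizontal curve through the whole base. Every such curve
  can be steered through \<open>(0, 1/2 + small)\<close> at one common time, because \<open>1/2\<close> attracts in the fibre over
  \<open>0\<close>. This makes its height over \<open>1/(i+1)\<close> a little later nearly independent of the curve; since the
  rotation there is irrational, a common number of further steps brings all the curves close to any given point
  (\<open>curves_hit\<close>). As strong unstable manifolds are mapped to each other, all of them are dense (\<open>Wuu_dense\<close>).
\<close>


section \<open>Lifts to the plane: basic estimates\<close>

lemma sin_2pi_lipschitz: "\<bar>sin (2*pi*x) - sin (2*pi*y)\<bar> \<le> 8 * \<bar>x - y\<bar>" for x y :: real
proof -
  have *: "sin (2*pi*x) - sin (2*pi*y) = 2 * sin (pi*(x-y)) * cos (pi*(x+y))"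
  proof -
    have "(2*pi*x - 2*pi*y) / 2 = pi*(x-y)" "(2*pi*x + 2*pi*y) / 2 = pi*(x+y)"
      by (simp_all add: field_simps)
    then show ?thesis using sin_diff_sin[of "2*pi*x" "2*pi*y"] by simp
  qed
  have "\<bar>sin (2*pi*x) - sin (2*pi*y)\<bar> = 2 * \<bar>sin (pi*(x-y))\<bar> * \<bar>cos (pi*(x+y))\<bar>"
    unfolding * by (simp add: abs_mult)
  also have "\<dots> \<le> 2 * \<bar>pi*(x-y)\<bar> * 1"
    by (intro mult_mono abs_sin_x_le_abs_x) auto
  also have "\<dots> = 2 * pi * \<bar>x-y\<bar>" by (simp add: abs_mult)
  also have "\<dots> \<le> 8 * \<bar>x-y\<bar>"
    using pi_less_4 by (intro mult_right_mono) auto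
  finally show ?thesis .
qed

lemma sin_2pi_add_int: "sin (2*pi*(x + of_int n)) = sin (2*pi*x)"
  using sin_add[of "2*pi*x" "2*pi * of_int n"] sin_int_2pin[of n] cos_int_2pin[of n]
  by (simp add: algebra_simps)

lemma sin_2pi_expanding_aux:
  assumes "\<bar>x\<bar> \<le> 1/6" "\<bar>y\<bar> \<le> 1/6" "y \<le> (x::real)"
  shows "sin (2*pi*x) - sin (2*pi*y) \<ge> 2 * (x - y)"
proof (cases "x = y")
  case False
  then have "y < x" using assms by simp
  then obtain z where z: "y < z" "z < x" "sin (2*pi*x) - sin (2*pi*y) = (x - y) * (cos (2*pi*z) * (2*pi))"
    using MVT2[of y x "\<lambda>z. sin (2*pi*z)" "\<lambda>z. cos (2*pi*z) * (2*pi)"]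
    by (force intro!: derivative_eq_intros)
  have "cos \<bar>2*pi*z\<bar> \<ge> cos (pi/3)"
    using z assms by (intro cos_monotone_0_pi_le) (auto simp: abs_mult)
  then have "cos (2*pi*z) \<ge> 1/2" using cos_60 by simp
  then have "cos (2*pi*z) * (2*pi) \<ge> 1/2 * (2*2)"
    using pi_ge_two by (intro mult_mono) auto
  then show ?thesis using z mult_left_mono[of 2 "cos (2*pi*z) * (2*pi)" "x-y"] by simp
qed simp

text \<open>Near the integers the cosine is at least \<open>1/2\<close>, so the fibre over an integer expands there.\<close>

lemma sin_2pi_expanding:
  fixes x y :: real and n :: int
  assumes "\<bar>x - n\<bar> \<le> 1/6" "\<bar>y - n\<bar> \<le> 1/6" "y \<le> x"
  shows "sin (2*pi*x) - sin (2*pi*y) \<ge> 2 * (x - y)"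
  using sin_2pi_expanding_aux[of "x-n" "y-n"] assms sin_2pi_add_int[of "x-n" n] sin_2pi_add_int[of "y-n" n]
  by simp

lemma one_plus_ge_exp:
  fixes t :: real assumes "\<bar>t\<bar> \<le> 1/2"
  shows "1 + t \<ge> exp (t - 2*t\<^sup>2)"
proof -
  have "t - 2*t\<^sup>2 \<le> ln (1 + t)"
  proof (cases "t \<ge> 0")
    case True
    then show ?thesis using ln_one_plus_pos_lower_bound[of t] assms zero_le_power2[of t] by linarith
  next
    case False
    then show ?thesis using ln_one_minus_pos_lower_bound[of "-t"] assms by simp
  qed
  moreover have "1 + t > 0" using assms by auto
  ultimately show ?thesis by (simp add: ln_ge_iff)
qed

lemma half_le: "2 * a \<le> b \<Longrightarrow> a \<le> 1/2 * b" for a b :: real by simp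

lemma abs_of_perturbed_sum:
  fixes h :: real
  assumes "h = a + b + c + d" "\<bar>b\<bar> \<le> B" "\<bar>c\<bar> \<le> C" "\<bar>d\<bar> \<le> D"
  shows "\<bar>h\<bar> \<ge> \<bar>a\<bar> - B - C - D" "\<bar>h - a\<bar> \<le> B + C + D"
  using assms by linarith+

lemma sum_half_powers: "(\<Sum>j<T. 1/2^(T-j)) \<le> (1::real)"
proof -
  have "(\<Sum>j<T. 1/2^(T-j)) = 1 - (1/2::real)^T" for T :: nat
  proof (induction T)
    case (Suc T)
    have "(\<Sum>j<Suc T. 1/2^(Suc T-j)) = (\<Sum>j<T. (1/2) * (1/2^(T-j))) + (1/2::real)"
      by (simp add: Suc_diff_le)
    also have "\<dots> = 1/2 * (\<Sum>j<T. 1/2^(T-j)) + (1/2::real)" by (simp add: sum_distrib_left)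
    finally show ?case using Suc.IH by (simp add: field_simps)
  qed simp
  then show ?thesis by simp
qed

lemma sum_two_thirds_powers: "(\<Sum>j<T. (2/3)^(T-j)) \<le> (2::real)"
proof -
  have "(\<Sum>j<T. (2/3)^(T-j)) = 2 - 2*(2/3::real)^T" for T :: nat
  proof (induction T)
    case (Suc T)
    have "(\<Sum>j<Suc T. (2/3)^(Suc T-j)) = (\<Sum>j<T. (2/3) * (2/3)^(T-j)) + (2/3::real)"
      by (simp add: Suc_diff_le)
    also have "\<dots> = 2/3 * (\<Sum>j<T. (2/3)^(T-j)) + (2/3::real)" by (simp add: sum_distrib_left)
    finally show ?case using Suc.IH by (simp add: field_simps)
  qed simp
  then show ?thesis by simp
qed

text \<open>The estimates below run backward along pairs of orbits. The factors \<open>exp (\<Theta> j)\<close> may exceed \<open>1\<close> for many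
  steps, but their partial products stay bounded, so the inhomogeneous terms \<open>h\<close> enter only through their sum.\<close>

lemma backward_recursion:
  fixes d \<Theta> h :: "nat \<Rightarrow> real"
  assumes step: "\<And>j. j < M \<Longrightarrow> d j \<le> exp (\<Theta> j) * (d (Suc j) + h j)"
    and h: "\<And>j. 0 \<le> h j"
    and bd: "\<And>j. j \<le> M \<Longrightarrow> exp (\<Sum>l<j. \<Theta> l) \<le> 2"
  shows "d 0 \<le> exp (\<Sum>l<M. \<Theta> l) * d M + 2 * (\<Sum>l<M. h l)"
proof -
  have "j \<le> M \<Longrightarrow> d 0 \<le> exp (\<Sum>l<j. \<Theta> l) * d j + 2 * (\<Sum>l<j. h l)" for j
  proof (induction j)
    case (Suc j)
    have "exp (\<Sum>l<j. \<Theta> l) * d j \<le> exp (\<Sum>l<j. \<Theta> l) * (exp (\<Theta> j) * (d (Suc j) + h j))"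
      using step[of j] Suc.prems by (intro mult_left_mono) auto
    also have "\<dots> = exp (\<Sum>l<Suc j. \<Theta> l) * d (Suc j) + exp (\<Sum>l<Suc j. \<Theta> l) * h j"
      by (simp add: exp_add algebra_simps)
    also have "\<dots> \<le> exp (\<Sum>l<Suc j. \<Theta> l) * d (Suc j) + 2 * h j"
      using bd[of "Suc j"] Suc.prems h[of j] by (intro add_left_mono mult_right_mono) auto
    finally show ?case using Suc by (simp add: algebra_simps)
  qed simp
  then show ?thesis by simp
qed

text \<open>The lifts of \<open>\<plusminus>1/(i+1)\<close>, the orbit of period two over which the fibre maps will be rotations.\<close>

definition rot_point :: "int \<Rightarrow> real \<Rightarrow> bool" where
  "rot_point i R \<longleftrightarrow> (\<exists>n::int. R = n + 1/(of_int i+1) \<or> R = n - 1/(of_int i+1))"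

lemma rot_point_mult:
  assumes "i > 1" "rot_point i R" shows "rot_point i (i * R)"
proof -
  define u where "u = 1 / (real_of_int i + 1)"
  have 1: "i * u = 1 - u" using assms by (simp add: u_def field_simps)
  from assms obtain n :: int where "R = n + 1/(of_int i+1) \<or> R = n - 1/(of_int i+1)" by (auto simp: rot_point_def)
  then show ?thesis
  proof
    assume "R = n + 1/(of_int i+1)"
    then have "i * R = i * of_int n + i * u" by (simp add: u_def distrib_left)
    then have "i * R = of_int (i*n + 1) - u" using 1 by simp
    then show ?thesis unfolding u_def unfolding rot_point_def by blast
  next
    assume "R = n - 1/(of_int i+1)"
    then have "i * R = i * of_int n - i * u" by (simp add: u_def right_diff_distrib)
    then have "i * R = of_int (i*n - 1) + u" using 1 by simp
    then show ?thesis unfolding u_def unfolding rot_point_def by blast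
  qed
qed

lemma rot_point_power: "i > 1 \<Longrightarrow> rot_point i R \<Longrightarrow> rot_point i (i^j * R)"
  by (induction j) (auto dest: rot_point_mult simp: mult.assoc)

lemma rot_point_exists: "\<exists>R. rot_point i R \<and> Y \<le> R \<and> R \<le> Y + 1"
proof -
  let ?R = "of_int \<lceil>Y - 1/(of_int i+1)\<rceil> + 1/(real_of_int i+1)"
  have "rot_point i ?R" unfolding rot_point_def by auto
  moreover have "Y \<le> ?R" "?R \<le> Y + 1"
    using ceiling_correct[of "Y - 1/(of_int i+1)"] by linarith+
  ultimately show ?thesis by blast
qed

text \<open>Lifts to the plane of the maps under consideration. The functions \<open>e\<close> and \<open>E\<close> are an arbitrary perturbation of
  size \<open>err\<close>, both uniformly and in the Lipschitz sense; \<open>err = 0\<close> is the unperturbed map. The smallness of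
  \<open>amp * L\<close> is what makes all errors of one step negligible against the expansion of the base.\<close>

locale skew_lift =
  fixes i :: int and b :: "real \<Rightarrow> real" and L amp err :: real
    and e :: "real \<Rightarrow> real" and E :: "real \<Rightarrow> real \<Rightarrow> real"
  assumes i: "i > 1" and L: "1 \<le> L"
    and b_lip: "\<And>Y Y'. \<bar>b Y - b Y'\<bar> \<le> L * \<bar>Y - Y'\<bar>" and b_bd: "\<And>Y. \<bar>b Y\<bar> \<le> L"
    and b_int: "\<And>n. b (of_int n) = 0" and b_rot: "\<And>R. rot_point i R \<Longrightarrow> b R = 1"
    and amp: "0 < amp" "1000 * (amp * L) \<le> 1" and err: "0 \<le> err" "err \<le> amp"
    and e_bd: "\<And>Y. \<bar>e Y\<bar> \<le> err" and e_lip: "\<And>Y Y'. \<bar>e Y - e Y'\<bar> \<le> err * \<bar>Y - Y'\<bar>"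
    and E_bd: "\<And>Y X. \<bar>E Y X\<bar> \<le> err"
    and E_lip: "\<And>Y X Y' X'. \<bar>E Y X - E Y' X'\<bar> \<le> err * (\<bar>Y - Y'\<bar> + \<bar>X - X'\<bar>)"
begin

definition G :: "real \<Rightarrow> real" where "G Y = of_int i * Y + e Y"
definition H :: "real \<Rightarrow> real \<Rightarrow> real" where
  "H Y X = X + amp * (sin (2*pi*X) + b Y * (1 - sin (2*pi*X))) + E Y X"
definition orbit :: "(nat \<Rightarrow> real) \<Rightarrow> (nat \<Rightarrow> real) \<Rightarrow> bool" where
  "orbit Y X \<longleftrightarrow> (\<forall>j. Y (Suc j) = G (Y j) \<and> X (Suc j) = H (Y j) (X j))"

lemma orbitD: "orbit Y X \<Longrightarrow> Y (Suc j) = G (Y j)" "orbit Y X \<Longrightarrow> X (Suc j) = H (Y j) (X j)"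
  by (auto simp: orbit_def)

lemma orbit_shift: "orbit Y X \<Longrightarrow> orbit (\<lambda>j. Y (T + j)) (\<lambda>j. X (T + j))"
  by (simp add: orbit_def)

lemma amp_le: "amp \<le> amp * L" "amp \<le> 1/1000" "err \<le> amp * L" "amp * L > 0"
proof -
  show "amp \<le> amp * L" using L amp by (simp add: mult_le_cancel_left1)
  then show "amp \<le> 1/1000" "err \<le> amp * L" "amp * L > 0" using amp err by linarith+
qed

lemma G_expanding: "\<bar>Y - Y'\<bar> \<le> 2/3 * \<bar>G Y - G Y'\<bar>"
proof -
  have "real_of_int i * \<bar>Y - Y'\<bar> \<ge> 2 * \<bar>Y - Y'\<bar>"
    using i by (intro mult_right_mono) auto
  moreover have "real_of_int i * \<bar>Y - Y'\<bar> \<le> \<bar>G Y - G Y'\<bar> + \<bar>e Y - e Y'\<bar>"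
  proof -
    have "real_of_int i * \<bar>Y - Y'\<bar> = \<bar>i * (Y - Y')\<bar>" using i by (simp add: abs_mult)
    also have "i * (Y - Y') = (G Y - G Y') - (e Y - e Y')" by (simp add: G_def algebra_simps)
    finally show ?thesis using abs_triangle_ineq4[of "G Y - G Y'" "e Y - e Y'"] by simp
  qed
  moreover have "err * \<bar>Y - Y'\<bar> \<le> 1/2 * \<bar>Y - Y'\<bar>"
    using err amp_le by (intro mult_right_mono) auto
  ultimately show ?thesis using e_lip[of Y Y'] by linarith
qed

lemma base_backward:
  assumes "orbit Y X" "orbit Y' X'" "j \<le> T"
  shows "\<bar>Y j - Y' j\<bar> \<le> (2/3)^(T-j) * \<bar>Y T - Y' T\<bar>"
  using assms(3)
proof (induction j rule: inc_induct)
  case (step j)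
  have "\<bar>Y j - Y' j\<bar> \<le> 2/3 * \<bar>Y (Suc j) - Y' (Suc j)\<bar>"
    using G_expanding[of "Y j" "Y' j"] assms by (simp add: orbit_def)
  also have "\<dots> \<le> 2/3 * ((2/3)^(T - Suc j) * \<bar>Y T - Y' T\<bar>)" using step by simp
  also have "\<dots> = (2/3)^(T - j) * \<bar>Y T - Y' T\<bar>" 
    using step(2) Suc_diff_Suc[of j T] by (metis mult.assoc power_Suc)
  finally show ?case .
qed simp

text \<open>Backward orbits contract in the base, so the last point of an orbit determines how closely a reference orbit
  \<open>R\<close> of multiplication by \<open>i\<close> is followed. This is how itineraries are prescribed.\<close>

lemma shadow:
  assumes "orbit Y X" "\<And>j. R (Suc j) = of_int i * R j" "j \<le> T"
  shows "\<bar>Y j - R j\<bar> \<le> \<bar>Y T - R T\<bar> / 2^(T-j) + err"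
  using assms(3)
proof (induction j rule: inc_induct)
  case base then show ?case using err by simp
next
  case (step j)
  have "real_of_int i * \<bar>Y j - R j\<bar> \<ge> 2 * \<bar>Y j - R j\<bar>"
    using i by (intro mult_right_mono) auto
  moreover have "real_of_int i * \<bar>Y j - R j\<bar> \<le> \<bar>Y (Suc j) - R (Suc j)\<bar> + \<bar>e (Y j)\<bar>"
  proof -
    have "real_of_int i * \<bar>Y j - R j\<bar> = \<bar>i * (Y j - R j)\<bar>" using i by (simp add: abs_mult)
    also have "i * (Y j - R j) = (Y (Suc j) - R (Suc j)) - e (Y j)"
      using assms by (simp add: orbit_def G_def algebra_simps)
    finally show ?thesis using abs_triangle_ineq4[of "Y (Suc j) - R (Suc j)" "e (Y j)"] by simp
  qed
  ultimately have "2 * \<bar>Y j - R j\<bar> \<le> \<bar>Y (Suc j) - R (Suc j)\<bar> + \<bar>e (Y j)\<bar>"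
    by (rule order_trans)
  also have "\<dots> \<le> \<bar>Y (Suc j) - R (Suc j)\<bar> + err" by (intro add_left_mono e_bd)
  finally have "\<bar>Y j - R j\<bar> \<le> 1/2 * (\<bar>Y (Suc j) - R (Suc j)\<bar> + err)"
    by (rule half_le)
  also have "\<dots> \<le> 1/2 * ((\<bar>Y T - R T\<bar> / 2^(T-Suc j) + err) + err)"
    using step by (intro mult_left_mono add_right_mono) auto
  also have "\<dots> = \<bar>Y T - R T\<bar> / 2^Suc (T-Suc j) + err" by simp
  also have "Suc (T - Suc j) = T - j" using step(2) by simp
  finally show ?case .
qed

lemma shadow_sum:
  assumes "orbit Y X" "\<And>j. R (Suc j) = of_int i * R j" "\<bar>Y T - R T\<bar> \<le> c"
  shows "(\<Sum>j<T. \<bar>Y j - R j\<bar>) \<le> c + T * err"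
proof -
  have "(\<Sum>j<T. \<bar>Y j - R j\<bar>) \<le> (\<Sum>j<T. c * (1/2^(T-j)) + err)"
  proof (intro sum_mono)
    fix j assume "j \<in> {..<T}"
    then show "\<bar>Y j - R j\<bar> \<le> c * (1/2^(T-j)) + err"
      using shadow[of Y X R j T, OF assms(1,2)] divide_right_mono[OF assms(3), of "2^(T-j)"] by simp
  qed
  also have "\<dots> = c * (\<Sum>j<T. 1/2^(T-j)) + T * err" by (simp add: sum.distrib sum_distrib_left)
  also have "\<dots> \<le> c * 1 + T * err"
    using assms(3) by (intro add_right_mono mult_left_mono sum_half_powers) auto
  finally show ?thesis by simp
qed

lemma one_minus_sin: "\<bar>1 - sin x\<bar> \<le> (2::real)"
  using abs_sin_le_one[of x] by linarith

lemma rotation_step: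
  assumes "b R = 1"
  shows "\<bar>H Y X - X - amp\<bar> \<le> 2 * (amp * L) * \<bar>Y - R\<bar> + err"
proof -
  have "H Y X - X - amp = amp * ((b Y - b R) * (1 - sin (2*pi*X))) + E Y X"
    using assms by (simp add: H_def algebra_simps)
  moreover have "\<bar>amp * ((b Y - b R) * (1 - sin (2*pi*X)))\<bar> \<le> amp * ((L * \<bar>Y - R\<bar>) * 2)"
    unfolding abs_mult using amp b_lip[of Y R] one_minus_sin[of "2*pi*X"] L
    by (intro mult_mono) auto
  ultimately show ?thesis using E_bd[of Y X] by (simp add: algebra_simps)
qed

text \<open>Along the orbit of period two the fibre turns by \<open>amp\<close> in each step. The error does not grow with the number
  of steps, since the distances from the reference orbit form a geometric series.\<close>

lemma rotation_drift:
  assumes "orbit Y X" "\<And>j. R (Suc j) = of_int i * R j" "\<And>j. b (R j) = 1" "\<bar>Y T - R T\<bar> \<le> c"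
  shows "\<bar>X T - X 0 - T * amp\<bar> \<le> 2 * (amp * L) * c + 2 * T * err"
proof -
  have "X T - X 0 - T * amp = (\<Sum>j<T. X (Suc j) - X j - amp)" for T
    by (induction T) (auto simp: algebra_simps)
  then have "\<bar>X T - X 0 - T * amp\<bar> = \<bar>\<Sum>j<T. X (Suc j) - X j - amp\<bar>" by simp
  also have "\<dots> \<le> (\<Sum>j<T. \<bar>X (Suc j) - X j - amp\<bar>)" by (rule sum_abs)
  also have "\<dots> \<le> (\<Sum>j<T. 2 * (amp * L) * \<bar>Y j - R j\<bar> + err)"
    using rotation_step[OF assms(3)] assms(1) by (intro sum_mono) (simp add: orbit_def)
  also have "\<dots> = 2 * (amp * L) * (\<Sum>j<T. \<bar>Y j - R j\<bar>) + T * err"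
    by (simp add: sum.distrib sum_distrib_left)
  also have "\<dots> \<le> 2 * (amp * L) * (c + T * err) + T * err"
    using shadow_sum[OF assms(1,2,4)] amp L by (intro add_right_mono mult_left_mono) auto
  also have "\<dots> \<le> 2 * (amp * L) * c + 1 * (T * err) + T * err"
    using amp err mult_right_mono[of "2*(amp*L)" 1 "T*err"] by (simp add: algebra_simps)
  finally show ?thesis by (simp add: mult_ac)
qed

lemma H_step_small: "\<bar>H Y X - X\<bar> \<le> 4 * (amp * L)"
proof -
  have "\<bar>sin (2*pi*X) + b Y * (1 - sin (2*pi*X))\<bar> \<le> 1 + L * 2"
    using abs_sin_le_one[of "2*pi*X"] mult_mono[OF b_bd[of Y] one_minus_sin[of "2*pi*X"]] L
    by (intro order_trans[OF abs_triangle_ineq add_mono]) (auto simp: abs_mult)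
  also have "\<dots> \<le> 3 * L" using L by simp
  finally have "amp * \<bar>sin (2*pi*X) + b Y * (1 - sin (2*pi*X))\<bar> \<le> amp * (3 * L)" using amp by simp
  then have "\<bar>amp * (sin (2*pi*X) + b Y * (1 - sin (2*pi*X)))\<bar> \<le> 3 * (amp * L)" using amp by (simp add: abs_mult)
  moreover have "H Y X - X = amp * (sin (2*pi*X) + b Y * (1 - sin (2*pi*X))) + E Y X" by (simp add: H_def)
  ultimately show ?thesis using E_bd[of Y X] amp_le by linarith
qed

lemma H_walk_small:
  assumes "orbit Y X" shows "\<bar>X (m + k) - X m\<bar> \<le> k * (4 * (amp * L))"
proof (induction k)
  case (Suc k)
  then show ?case using H_step_small[of "Y (m+k)" "X (m+k)"] orbitD(2)[OF assms, of "m+k"]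
    by (simp add: algebra_simps)
qed simp

lemma H_diff: "H Y X - H Y' X' = (X - X') + amp * ((1 - b Y) * (sin (2*pi*X) - sin (2*pi*X')))
     + amp * ((b Y - b Y') * (1 - sin (2*pi*X'))) + (E Y X - E Y' X')"
  by (simp add: H_def algebra_simps)

lemma H_diff_base: "\<bar>amp * ((b Y - b Y') * (1 - sin (2*pi*X')))\<bar> \<le> 2 * (amp * L) * \<bar>Y - Y'\<bar>"
proof -
  have "\<bar>amp * ((b Y - b Y') * (1 - sin (2*pi*X')))\<bar> \<le> amp * ((L * \<bar>Y - Y'\<bar>) * 2)"
    unfolding abs_mult using amp b_lip[of Y Y'] one_minus_sin[of "2*pi*X'"] L
    by (intro mult_mono) auto
  then show ?thesis by simp
qed

lemma H_lipschitz: "\<bar>(H Y X - H Y' X') - (X - X')\<bar> \<le> 17 * (amp * L) * \<bar>X - X'\<bar> + 3 * (amp * L) * \<bar>Y - Y'\<bar>"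
proof -
  have "\<bar>1 - b Y\<bar> \<le> 2 * L" using b_bd[of Y] L by linarith
  then have 1: "\<bar>amp * ((1 - b Y) * (sin (2*pi*X) - sin (2*pi*X')))\<bar> \<le> amp * ((2*L) * (8 * \<bar>X - X'\<bar>))"
    unfolding abs_mult using amp L sin_2pi_lipschitz[of X X'] by (intro mult_mono) auto
  have 2: "err * \<bar>Y - Y'\<bar> \<le> (amp * L) * \<bar>Y - Y'\<bar>" "err * \<bar>X - X'\<bar> \<le> (amp * L) * \<bar>X - X'\<bar>"
    using amp_le by (auto intro!: mult_right_mono)
  have 3: "\<bar>E Y X - E Y' X'\<bar> \<le> err * \<bar>Y - Y'\<bar> + err * \<bar>X - X'\<bar>"
    using E_lip[of Y X Y' X'] by (simp add: distrib_left)
  show ?thesis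
    using abs_of_perturbed_sum(2)[OF H_diff 1 H_diff_base 3] 2 by argo
qed

text \<open>A common form of the next two estimates: \<open>c = 0\<close> for a step near the orbit of period two, \<open>c = amp\<close> for a
  step near the repelling fixed point. The loss is proportional to the distance \<open>d\<close> from the reference orbit, which is summable along orbits.\<close>

lemma contraction_step:
  fixes d :: real
  assumes d: "d \<le> 6" "0 \<le> d" and c: "0 \<le> c" "c \<le> amp"
    and main: "\<bar>H Y X - H Y' X'\<bar> \<ge> \<bar>X - X'\<bar> * (1 + (2*c - 8 * (amp*L) * d - err)) - 3 * (amp*L) * \<bar>Y - Y'\<bar>"
  shows "\<bar>X - X'\<bar> \<le> exp (16 * (amp*L) * d + 2 * err - c) * (\<bar>H Y X - H Y' X'\<bar> + 3 * (amp*L) * \<bar>Y - Y'\<bar>)"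
proof -
  define x where "x = 8 * (amp*L) * d + err"
  define t where "t = 2*c - x"
  have "8 * (amp*L) * d \<le> 8 * (amp*L) * 6" using d amp_le by (intro mult_left_mono) auto
  moreover have "0 \<le> 8 * (amp*L) * d" using amp_le d by simp
  ultimately have x: "0 \<le> x" "x \<le> 49/1000" using amp_le err amp unfolding x_def
    by linarith+
  have "c \<le> 1/1000" using c amp_le by linarith
  have tb: "\<bar>t\<bar> \<le> x + 2*c" using x c by (simp add: t_def)
  have "t\<^sup>2 \<le> (x + 2*c)\<^sup>2" using tb by (rule power2_le_iff_abs_le[THEN iffD2, rotated]) (use x c in auto)
  also have "\<dots> \<le> (x + 2*c) * (1/10)" unfolding power2_eq_square
    using x c \<open>c \<le> 1/1000\<close> by (intro mult_left_mono) auto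
  finally have t2: "2 * t\<^sup>2 \<le> x/5 + 2*c/5" by simp
  have "exp (-(2*x - c)) \<le> exp (t - 2*t\<^sup>2)"
    using t2 x c by (simp add: t_def)
  also have "\<dots> \<le> 1 + t" using tb x \<open>c \<le> 1/1000\<close> by (intro one_plus_ge_exp) auto
  finally have "\<bar>X - X'\<bar> * exp (-(2*x-c)) \<le> \<bar>H Y X - H Y' X'\<bar> + 3 * (amp*L) * \<bar>Y - Y'\<bar>"
    using main mult_left_mono[of "exp (-(2*x-c))" "1+t" "\<bar>X-X'\<bar>"] by (simp add: t_def x_def algebra_simps)
  then have "\<bar>X - X'\<bar> \<le> exp (2*x-c) * (\<bar>H Y X - H Y' X'\<bar> + 3 * (amp*L) * \<bar>Y - Y'\<bar>)"
    by (subst (asm) exp_minus) (simp add: field_simps)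
  moreover have "2*x - c = 16 * (amp*L) * d + 2 * err - c" by (simp add: x_def)
  ultimately show ?thesis by simp
qed

lemma rotation_pair_step:
  assumes "b R = 1" "\<bar>Y - R\<bar> \<le> 6"
  shows "\<bar>X - X'\<bar> \<le> exp (16 * (amp*L) * \<bar>Y - R\<bar> + 2 * err) * (\<bar>H Y X - H Y' X'\<bar> + 3 * (amp*L) * \<bar>Y - Y'\<bar>)"
proof -
  have "\<bar>1 - b Y\<bar> \<le> L * \<bar>Y - R\<bar>" using b_lip[of Y R] assms by (simp add: abs_minus_commute)
  then have 1: "\<bar>amp * ((1 - b Y) * (sin (2*pi*X) - sin (2*pi*X')))\<bar> \<le> amp * ((L * \<bar>Y - R\<bar>) * (8 * \<bar>X - X'\<bar>))"
    unfolding abs_mult using amp L sin_2pi_lipschitz[of X X'] by (intro mult_mono) auto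
  have 2: "err * \<bar>Y - Y'\<bar> \<le> (amp * L) * \<bar>Y - Y'\<bar>" using amp_le by (intro mult_right_mono) auto
  have 3: "\<bar>E Y X - E Y' X'\<bar> \<le> err * \<bar>Y - Y'\<bar> + err * \<bar>X - X'\<bar>"
    using E_lip[of Y X Y' X'] by (simp add: distrib_left)
  have "\<bar>H Y X - H Y' X'\<bar> \<ge> \<bar>X - X'\<bar> - amp * ((L * \<bar>Y - R\<bar>) * (8 * \<bar>X - X'\<bar>)) - err * \<bar>X - X'\<bar> - 3 * (amp*L) * \<bar>Y - Y'\<bar>"
    using abs_of_perturbed_sum(1)[OF H_diff 1 H_diff_base 3] 2 by argo
  then have "\<bar>H Y X - H Y' X'\<bar> \<ge> \<bar>X - X'\<bar> * (1 + (2*0 - 8 * (amp*L) * \<bar>Y - R\<bar> - err)) - 3 * (amp*L) * \<bar>Y - Y'\<bar>"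
    by (simp add: algebra_simps)
  from contraction_step[OF assms(2) _ _ _ this] amp show ?thesis by simp
qed

lemma source_pair_step:
  fixes n :: int and X X' :: real
  assumes "b R = 0" "\<bar>Y - R\<bar> \<le> 6" "\<bar>X - of_int n\<bar> \<le> 1/6" "\<bar>X' - of_int n\<bar> \<le> 1/6"
  shows "\<bar>X - X'\<bar> \<le> exp (16 * (amp*L) * \<bar>Y - R\<bar> + 2 * err - amp) * (\<bar>H Y X - H Y' X'\<bar> + 3 * (amp*L) * \<bar>Y - Y'\<bar>)"
proof -
  let ?S = "sin (2*pi*X) - sin (2*pi*X')"
  have bY: "\<bar>b Y\<bar> \<le> L * \<bar>Y - R\<bar>" using b_lip[of Y R] assms by simp
  then have 1: "\<bar>amp * (b Y * ?S)\<bar> \<le> amp * ((L * \<bar>Y - R\<bar>) * (8 * \<bar>X - X'\<bar>))"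
    unfolding abs_mult using amp L sin_2pi_lipschitz[of X X'] by (intro mult_mono) auto
  have 2: "err * \<bar>Y - Y'\<bar> \<le> (amp * L) * \<bar>Y - Y'\<bar>" using amp_le by (intro mult_right_mono) auto
  have 4: "\<bar>(X - X') + amp * ?S\<bar> \<ge> \<bar>X - X'\<bar> + amp * (2 * \<bar>X - X'\<bar>)"
  proof (cases "X' \<le> X")
    case True
    then show ?thesis using sin_2pi_expanding[OF assms(3,4)] mult_left_mono[of "2 * (X - X')" ?S amp] amp by simp
  next
    case False
    then have "amp * (2 * (X' - X)) \<le> amp * (- ?S)"
      using sin_2pi_expanding[OF assms(4,3)] amp by (intro mult_left_mono) auto
    then show ?thesis using False by (simp add: abs_if algebra_simps)
  qed
  have 3: "\<bar>E Y X - E Y' X'\<bar> \<le> err * \<bar>Y - Y'\<bar> + err * \<bar>X - X'\<bar>"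
    using E_lip[of Y X Y' X'] by (simp add: distrib_left)
  have 5: "H Y X - H Y' X' = ((X - X') + amp * ?S) + - (amp * (b Y * ?S))
     + amp * ((b Y - b Y') * (1 - sin (2*pi*X'))) + (E Y X - E Y' X')"
    by (simp add: H_def algebra_simps)
  have 6: "\<bar>- (amp * (b Y * ?S))\<bar> \<le> amp * ((L * \<bar>Y - R\<bar>) * (8 * \<bar>X - X'\<bar>))" using 1 by (simp only: abs_minus_cancel)
  have "\<bar>H Y X - H Y' X'\<bar> \<ge> \<bar>X - X'\<bar> + amp * (2 * \<bar>X - X'\<bar>) - amp * ((L * \<bar>Y - R\<bar>) * (8 * \<bar>X - X'\<bar>)) - err * \<bar>X - X'\<bar> - 3 * (amp*L) * \<bar>Y - Y'\<bar>"
    using abs_of_perturbed_sum(1)[OF 5 6 H_diff_base 3] 2 4 by argo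
  then have "\<bar>H Y X - H Y' X'\<bar> \<ge> \<bar>X - X'\<bar> * (1 + (2*amp - 8 * (amp*L) * \<bar>Y - R\<bar> - err)) - 3 * (amp*L) * \<bar>Y - Y'\<bar>"
    by (simp add: algebra_simps)
  from contraction_step[OF assms(2) _ _ _ this] amp show ?thesis by simp
qed

end

section \<open>Growth of small sets to a fixed size\<close>

text \<open>The lifts are onto, so orbits of the plane can be chosen by their last point.\<close>

lemma surj_near_linear:
  fixes f :: "real \<Rightarrow> real"
  assumes cont: "continuous_on UNIV f" and bd: "\<And>x. \<bar>f x - c * x\<bar> \<le> B" and c: "c \<ge> 1"
  shows "\<exists>x. f x = y"
proof -
  have B: "B \<ge> 0" using bd[of 0] by linarith
  define t where "t = \<bar>y\<bar> + B"
  have "c * t \<ge> t" using c B by (simp add: t_def mult_le_cancel_right1)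
  moreover have "\<bar>f (-t) + c * t\<bar> \<le> B" using bd[of "-t"] by simp
  ultimately have "f (-t) \<le> y" "y \<le> f t" using bd[of t] unfolding t_def by linarith+
  moreover have "-t \<le> t" using B by (simp add: t_def)
  ultimately show ?thesis using IVT'[of f "-t" y t] cont continuous_on_subset by blast
qed

lemma lipschitz_imp_continuous_on:
  fixes f :: "real \<Rightarrow> real"
  assumes "\<And>x y. \<bar>f x - f y\<bar> \<le> C * \<bar>x - y\<bar>"
  shows "continuous_on UNIV f"
proof -
  have "lipschitz_on (max C 0) UNIV f"
  proof (rule lipschitz_onI)
    fix x y :: real
    have "C * \<bar>x - y\<bar> \<le> max C 0 * \<bar>x - y\<bar>" by (intro mult_right_mono) auto
    then show "dist (f x) (f y) \<le> max C 0 * dist x y" using assms[of x y] by (simp add: dist_real_def)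
  qed simp
  then show ?thesis by (rule lipschitz_on_continuous_on)
qed

context skew_lift begin

lemma G_surj: "\<exists>Y. G Y = y"
proof (rule surj_near_linear)
  show "continuous_on UNIV G" unfolding G_def
    by (intro continuous_intros lipschitz_imp_continuous_on[of e err] e_lip)
  show "\<bar>G Y - of_int i * Y\<bar> \<le> err" for Y using e_bd[of Y] by (simp add: G_def)
qed (use i in auto)

lemma H_surj: "\<exists>X. H Y X = x"
proof (rule surj_near_linear)
  have "\<bar>E Y X - E Y X'\<bar> \<le> err * \<bar>X - X'\<bar>" for X X' using E_lip[of Y X Y X'] by simp
  then show "continuous_on UNIV (H Y)" unfolding H_def
    by (intro continuous_intros lipschitz_imp_continuous_on[of "E Y" err])
  show "\<bar>H Y X - 1 * X\<bar> \<le> 4 * (amp * L)" for X using H_step_small by simp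
qed auto

lemma orbit_from: "\<exists>Y X. orbit Y X \<and> Y 0 = y \<and> X 0 = x"
proof -
  define u where "u n = ((\<lambda>(Y,X). (G Y, H Y X)) ^^ n) (y,x)" for n
  have "orbit (\<lambda>n. fst (u n)) (\<lambda>n. snd (u n))"
    by (auto simp: orbit_def u_def case_prod_beta)
  then show ?thesis by (force simp: u_def)
qed

lemma orbit_through: "\<exists>Y X. orbit Y X \<and> Y n = y \<and> X n = x"
proof (induction n arbitrary: y x)
  case 0 then show ?case using orbit_from by blast
next
  case (Suc n)
  obtain y' x' where "G y' = y" "H y' x' = x" using G_surj H_surj by metis
  then show ?case using Suc[of y' x'] by (metis orbitD)
qed

lemma orbit_base_unique: "orbit Y X \<Longrightarrow> orbit Y' X' \<Longrightarrow> Y 0 = Y' 0 \<Longrightarrow> Y n = Y' n"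
  by (induction n) (auto simp: orbit_def)

text \<open>Nearly horizontal curves have nearly horizontal images, because the base expands by at least \<open>3/2\<close> and the
  fibres hardly at all. A slope \<open>s\<close> becomes at most \<open>(1.02 s + 3 amp L) / 1.5\<close>, and \<open>12 amp L\<close> is invariant under this bound.\<close>

lemma cone_invariant:
  assumes "\<bar>X - X'\<bar> \<le> 12 * (amp*L) * \<bar>Y - Y'\<bar>"
  shows "\<bar>H Y X - H Y' X'\<bar> \<le> 12 * (amp*L) * \<bar>G Y - G Y'\<bar>"
proof -
  have "17 * (amp*L) \<le> 17/1000" using amp by linarith
  then have "17 * (amp*L) * \<bar>X - X'\<bar> \<le> 17/1000 * \<bar>X - X'\<bar>" by (rule mult_right_mono) simp
  moreover have "\<bar>H Y X - H Y' X'\<bar> \<le> \<bar>(H Y X - H Y' X') - (X - X')\<bar> + \<bar>X - X'\<bar>" by linarith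
  ultimately have "\<bar>H Y X - H Y' X'\<bar> \<le> 5/4 * \<bar>X - X'\<bar> + 3 * (amp * L) * \<bar>Y - Y'\<bar>"
    using H_lipschitz[of Y X Y' X'] abs_ge_zero[of "X - X'"] by linarith
  also have "\<dots> \<le> 5/4 * (12 * (amp*L) * \<bar>Y - Y'\<bar>) + 3 * (amp * L) * \<bar>Y - Y'\<bar>"
    using assms by (intro add_right_mono mult_left_mono) auto
  also have "\<dots> = 18 * (amp*L) * \<bar>Y - Y'\<bar>" by simp
  also have "\<dots> \<le> 18 * (amp*L) * (2/3 * \<bar>G Y - G Y'\<bar>)"
    using G_expanding amp_le by (intro mult_left_mono) auto
  also have "\<dots> = 12 * (amp*L) * \<bar>G Y - G Y'\<bar>" by simp
  finally show ?thesis .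
qed

lemma cone_orbit:
  assumes "orbit Y X" "orbit Y' X'" "\<bar>X 0 - X' 0\<bar> \<le> 12 * (amp*L) * \<bar>Y 0 - Y' 0\<bar>"
  shows "\<bar>X j - X' j\<bar> \<le> 12 * (amp*L) * \<bar>Y j - Y' j\<bar>"
proof (induction j)
  case (Suc j)
  then show ?case using cone_invariant assms by (simp add: orbit_def)
qed (use assms in simp)

lemma inverse_lipschitz: "\<bar>Y - Y'\<bar> + \<bar>X - X'\<bar> \<le> 2 * (\<bar>G Y - G Y'\<bar> + \<bar>H Y X - H Y' X'\<bar>)"
proof -
  have "17 * (amp*L) \<le> 1/10" "3 * (amp*L) \<le> 1/10" using amp by linarith+
  then have "17 * (amp*L) * \<bar>X - X'\<bar> \<le> 1/10 * \<bar>X - X'\<bar>" "3 * (amp*L) * \<bar>Y - Y'\<bar> \<le> 1/10 * \<bar>Y - Y'\<bar>"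
    by (simp_all only: mult_right_mono abs_ge_zero)
  moreover have "\<bar>X - X'\<bar> \<le> \<bar>(H Y X - H Y' X') - (X - X')\<bar> + \<bar>H Y X - H Y' X'\<bar>" by linarith
  ultimately show ?thesis
    using H_lipschitz[of Y X Y' X'] G_expanding[of Y Y'] abs_ge_zero[of "G Y - G Y'"] abs_ge_zero[of "H Y X - H Y' X'"] by argo
qed

lemma vertical_lipschitz: "\<bar>H Y X - H Y X'\<bar> \<le> 5/4 * \<bar>X - X'\<bar>"
proof -
  have "17 * (amp*L) \<le> 1/4" using amp by linarith
  then have "17 * (amp*L) * \<bar>X - X'\<bar> \<le> 1/4 * \<bar>X - X'\<bar>" by (rule mult_right_mono) simp
  moreover have "\<bar>(H Y X - H Y X') - (X - X')\<bar> \<le> 17 * (amp*L) * \<bar>X - X'\<bar>" using H_lipschitz[of Y X Y X'] by simp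
  moreover have "\<bar>H Y X - H Y X'\<bar> \<le> \<bar>(H Y X - H Y X') - (X - X')\<bar> + \<bar>X - X'\<bar>" by linarith
  ultimately show ?thesis by argo
qed

lemma profile_along_rotation: "rot_point i r \<Longrightarrow> b (of_int i ^ j * r) = 1"
  using b_rot rot_point_power i by blast

lemma profile_along_integers: "b (of_int i ^ j * of_int n) = 0"
  using b_int[of "i^j * n"] by simp

text \<open>Steps of length \<open>amp\<close> cannot miss the integers by more than \<open>amp\<close>.\<close>

lemma rotation_time:
  obtains n :: int and T :: nat where "\<bar>x + T * amp - n\<bar> \<le> amp" "T \<le> 1/amp + 1"
proof -
  define n where "n = \<lceil>x\<rceil>"
  define T where "T = nat \<lceil>(n - x)/amp\<rceil>"
  have nx: "0 \<le> n - x" "n - x < 1" unfolding n_def by linarith+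
  then have T0: "real T = of_int \<lceil>(n - x)/amp\<rceil>" using amp by (simp add: T_def)
  then have T: "(n - x)/amp \<le> T" "T < (n-x)/amp + 1" by linarith+
  then have "n - x \<le> T * amp" "T * amp \<le> n - x + amp" using amp by (simp_all add: field_simps)
  moreover have "(n-x)/amp \<le> 1/amp" using nx amp by (simp add: divide_right_mono)
  ultimately show ?thesis using T amp by (intro that[of T n]) auto
qed

lemma floor_dist: "\<bar>of_int \<lfloor>t\<rfloor> - t\<bar> \<le> 1" for t :: real
  by linarith

end

text \<open>The fixed size: half width \<open>3\<close> leaves room to choose an itinerary afresh, and with half width \<open>1/24\<close> in the fibre
  a box around an orbit near an integer stays where the sine expands.\<close>

definition (in skew_lift) in_box :: "nat \<Rightarrow> real \<Rightarrow> real \<Rightarrow> (nat \<Rightarrow> real) \<Rightarrow> (nat \<Rightarrow> real) \<Rightarrow> bool" where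
  "in_box n y x Y X \<longleftrightarrow> orbit Y X \<and> \<bar>Y n - y\<bar> \<le> 3 \<and> \<bar>X n - x\<bar> \<le> 1/24"

text \<open>\<open>K\<close> is the number of steps spent near the repelling fixed point: large enough for the gain \<open>K * amp\<close> to beat all
  losses, which are multiples of \<open>L * amp\<close>, while \<open>amp\<close> is so small that the fibre coordinate moves little in \<open>K\<close> steps.
  The rotation before takes about \<open>1/amp\<close> steps, and \<open>err\<close> has to be negligible even after all these steps.\<close>

locale mixing_lift = skew_lift +
  fixes K :: nat
  assumes K: "4000 * L \<le> K" "400 * (amp * L) * K \<le> 1" and err_small: "err * (3/amp + 3*K + 6) \<le> amp"
begin

text \<open>One round of the growth argument. From \<open>(y, x)\<close>, follow a nearby point of period two until the rotation has brought
  \<open>x\<close> near an integer, then follow an integer for \<open>K\<close> steps. The target \<open>R\<close> encodes this itinerary: any orbit that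
  ends within \<open>3\<close> of \<open>R\<close> has followed it. The centre orbit \<open>(Yc, Xc)\<close> may start anywhere on a nearly horizontal curve
  through \<open>(y, x)\<close>. The map backward from the box around its end contracts fibres and returns into the box around \<open>(y, x)\<close>.\<close>

lemma stage:
  obtains M :: nat and R :: real where "M \<ge> 3"
    "\<And>Yc Xc Y X. orbit Yc Xc \<Longrightarrow> Yc M = R \<Longrightarrow> \<bar>Xc 0 - x\<bar> \<le> 12 * (amp*L) * \<bar>Yc 0 - y\<bar> \<Longrightarrow>
       in_box M R (Xc M) Y X \<Longrightarrow> \<bar>Y 0 - y\<bar> \<le> 3 \<and> \<bar>X 0 - x\<bar> \<le> 1/24"
    "\<And>Yc Xc Y X Y' X'. orbit Yc Xc \<Longrightarrow> Yc M = R \<Longrightarrow> \<bar>Xc 0 - x\<bar> \<le> 12 * (amp*L) * \<bar>Yc 0 - y\<bar> \<Longrightarrow>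
       in_box M R (Xc M) Y X \<Longrightarrow> in_box M R (Xc M) Y' X' \<Longrightarrow>
       \<bar>X 0 - X' 0\<bar> \<le> exp (- amp) * \<bar>X M - X' M\<bar> + 12 * (amp*L) * \<bar>Y M - Y' M\<bar>"
proof -
  obtain r where r: "rot_point i r" "y \<le> r" "r \<le> y + 1" using rot_point_exists by blast
  obtain n :: int and T :: nat where n: "\<bar>x + T * amp - n\<bar> \<le> amp" and T: "T \<le> 1/amp + 1" by (rule rotation_time)
  define n0 :: int where "n0 = \<lfloor>of_int i ^ T * r\<rfloor>"
  define R where "R = of_int i ^ K * real_of_int n0"
  define M where "M = T + K"
  have K4000: "K \<ge> 4000" using K L by linarith
  have "3 * M * err \<le> (3/amp + 3*K + 6) * err"
    using T err by (intro mult_right_mono) (auto simp: M_def)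
  then have Md: "3 * M * err \<le> amp" using err_small by (simp add: mult_ac)
  have "T * err \<le> M * err" using err by (intro mult_right_mono) (auto simp: M_def)
  have d1: "err \<le> 1/1000" using err amp_le by linarith
  have Rpow: "of_int i ^ Suc j * c = of_int i * (of_int i ^ j * c)" for j and c :: real by (simp add: mult_ac)
  \<comment> \<open>closeness to the two parts of the itinerary: \<open>shR\<close> to the integers, \<open>sh0\<close> to the orbit of period two\<close>
  have shR: "\<bar>Y (T + j) - of_int i ^ j * real_of_int n0\<bar> \<le> c / 2^(K-j) + err"
    if "orbit Y X" "\<bar>Y M - R\<bar> \<le> c" "j \<le> K" for Y X j c
    using shadow[of "\<lambda>j. Y (T+j)" "\<lambda>j. X (T+j)" "\<lambda>j. of_int i ^ j * real_of_int n0" j K, OF orbit_shift[OF that(1)] Rpow that(3)]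
      divide_right_mono[OF that(2), of "2^(K-j)"] by (simp add: R_def M_def)
  have shT: "\<bar>Y T - of_int i ^ T * r\<bar> \<le> c + err + 1" if "orbit Y X" "\<bar>Y M - R\<bar> \<le> c" for Y X c
  proof -
    have "0 \<le> c" using that(2) by linarith
    then have "c / 2^K \<le> c" by (simp add: divide_le_eq mult_le_cancel_left1)
    moreover have "\<bar>Y T - of_int n0\<bar> \<le> c / 2^K + err" using shR[OF that, of 0] by simp
    moreover have "\<bar>of_int n0 - of_int i ^ T * r\<bar> \<le> 1" unfolding n0_def by (rule floor_dist)
    ultimately show ?thesis by linarith
  qed
  have sh0: "\<bar>Y j - of_int i ^ j * r\<bar> \<le> c / 2^(T-j) + err"
    if "orbit Y X" "\<bar>Y T - of_int i ^ T * r\<bar> \<le> c" "j \<le> T" for Y X j c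
    using shadow[of Y X "\<lambda>j. of_int i ^ j * r" j T, OF that(1) Rpow that(3)] divide_right_mono[OF that(2), of "2^(T-j)"]
    by simp
  have drift: "\<bar>X T - X 0 - T * amp\<bar> \<le> 10 * (amp*L) + amp" if "orbit Y X" "\<bar>Y M - R\<bar> \<le> 3" for Y X
  proof -
    have "\<bar>Y T - of_int i ^ T * r\<bar> \<le> 5" using shT[OF that] d1 by simp
    from rotation_drift[of Y X "\<lambda>j. of_int i ^ j * r" T, OF that(1) Rpow profile_along_rotation[OF r(1)] this]
    moreover have "0 \<le> M * err" using err by simp
    moreover have "2 * T * err = 2 * (T * err)" "3 * M * err = 3 * (M * err)" by simp_all
    ultimately show ?thesis using \<open>T*err \<le> M*err\<close> Md by linarith
  qed
  have c0: "\<bar>Yc 0 - y\<bar> \<le> 2 + 3*err" if "orbit Yc Xc" "Yc M = R" for Yc Xc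
  proof -
    have "\<bar>Yc T - of_int i ^ T * r\<bar> \<le> 1 + err" using shT[of Yc Xc 0] that by simp
    from sh0[OF that(1) this, of 0] have "\<bar>Yc 0 - r\<bar> \<le> (1+err)/2^T + err" by simp
    moreover have "(1+err)/2^T \<le> 1 + err" using err by (simp add: divide_le_eq mult_le_cancel_left1)
    ultimately show ?thesis using r err by linarith
  qed
  have cT: "\<bar>Xc T - n\<bar> \<le> 38 * (amp*L)" and cx: "\<bar>Xc 0 - x\<bar> \<le> 25 * (amp*L)"
    if c: "orbit Yc Xc" "Yc M = R" "\<bar>Xc 0 - x\<bar> \<le> 12 * (amp*L) * \<bar>Yc 0 - y\<bar>" for Yc Xc
  proof -
    have "12 * (amp*L) * \<bar>Yc 0 - y\<bar> \<le> 12 * (amp*L) * (25/12)"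
      using c0[OF c(1,2)] d1 amp_le by (intro mult_left_mono) auto
    then show x: "\<bar>Xc 0 - x\<bar> \<le> 25 * (amp*L)" using c(3) by linarith
    show "\<bar>Xc T - n\<bar> \<le> 38 * (amp*L)" using drift[of Yc Xc] c n x amp_le by simp
  qed
  have K4: "k * (4 * (amp*L)) \<le> 1/100" if "k \<le> K" for k :: nat
  proof -
    have "k * (4 * (amp*L)) \<le> K * (4 * (amp*L))" using that amp_le by (intro mult_right_mono) auto
    then show ?thesis using K(2) by (simp add: mult_ac)
  qed
  \<comment> \<open>orbits in the box stay in the region around \<open>n\<close> where the sine expands\<close>
  have near: "\<bar>X (T + j) - n\<bar> \<le> 1/6"
    if c: "orbit Yc Xc" "Yc M = R" "\<bar>Xc 0 - x\<bar> \<le> 12 * (amp*L) * \<bar>Yc 0 - y\<bar>"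
     "orbit Y X" "\<bar>X M - Xc M\<bar> \<le> 1/24" and "j < K" for Yc Xc Y X j
  proof -
    have "\<bar>X (T + j) - X M\<bar> \<le> 1/100"
      using H_walk_small[OF c(4), of "T+j" "K-j"] K4[of "K-j"] \<open>j < K\<close> by (simp add: M_def abs_minus_commute)
    moreover have "\<bar>Xc M - Xc T\<bar> \<le> 1/100"
      using H_walk_small[OF c(1), of "T" "K"] K4[of "K"] by (simp add: M_def)
    ultimately show ?thesis using cT[OF c(1-3)] c(5) amp by linarith
  qed
  have main: "\<bar>X 0 - X' 0\<bar> \<le> exp (129 * (amp*L) - amp * K) * \<bar>X M - X' M\<bar> + 12 * (amp*L) * \<bar>Y M - Y' M\<bar>"
    if c: "orbit Yc Xc" "Yc M = R" "\<bar>Xc 0 - x\<bar> \<le> 12 * (amp*L) * \<bar>Yc 0 - y\<bar>"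
     "orbit Y X" "\<bar>Y M - R\<bar> \<le> 3" "\<bar>X M - Xc M\<bar> \<le> 1/24"
     "orbit Y' X'" "\<bar>Y' M - R\<bar> \<le> 3" "\<bar>X' M - Xc M\<bar> \<le> 1/24" for Yc Xc Y X Y' X'
  proof -
    \<comment> \<open>\<open>\<Theta>\<close> is the logarithmic loss of a step: proportional to the distance \<open>D\<close> from the itinerary, minus the gain \<open>amp\<close>
      in each of the last \<open>K\<close> steps\<close>
    define ref where "ref j = (if j < T then of_int i ^ j * r else of_int i ^ (j-T) * real_of_int n0)" for j
    define D where "D j = \<bar>Y j - ref j\<bar>" for j
    define \<Theta> where "\<Theta> j = 16 * (amp*L) * D j + 2 * err - (if j < T then 0 else amp)" for j
    have YT: "\<bar>Y T - of_int i ^ T * r\<bar> \<le> 5" using shT[OF c(4,5)] d1 by simp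
    have D6: "D j \<le> 6" if "j < M" for j
    proof (cases "j < T")
      case True
      have "(5::real) / 2^(T-j) \<le> 5" by (simp add: divide_le_eq)
      then show ?thesis using sh0[OF c(4) YT, of j] True d1 by (simp add: D_def ref_def)
    next
      case False
      have "(3::real) / 2^(K-(j-T)) \<le> 3" by (simp add: divide_le_eq)
      moreover have "j - T \<le> K" using that by (simp add: M_def)
      moreover have "T + (j - T) = j" using False by simp
      ultimately show ?thesis using shR[OF c(4,5), of "j-T"] False d1 by (simp add: D_def ref_def)
    qed
    have "(\<Sum>j<T+k. D j) = (\<Sum>j<T. D j) + (\<Sum>j<k. D (T + j))" for k
      by (induction k) auto
    then have "(\<Sum>j<M. D j) = (\<Sum>j<T. D j) + (\<Sum>j<K. D (T + j))" by (simp add: M_def)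
    also have "(\<Sum>j<T. D j) = (\<Sum>j<T. \<bar>Y j - of_int i ^ j * r\<bar>)" by (simp add: D_def ref_def)
    also have "\<dots> \<le> 5 + T * err" by (rule shadow_sum[OF c(4) Rpow YT])
    also have "(\<Sum>j<K. D (T + j)) = (\<Sum>j<K. \<bar>Y (T + j) - of_int i ^ j * real_of_int n0\<bar>)" by (simp add: D_def ref_def)
    also have "\<dots> \<le> 3 + K * err" 
      by (rule shadow_sum[of "\<lambda>j. Y (T+j)" "\<lambda>j. X (T+j)" "\<lambda>j. of_int i ^ j * real_of_int n0", OF orbit_shift[OF c(4)] Rpow])
        (use c(5) in \<open>simp add: R_def M_def\<close>)
    finally have sumD: "(\<Sum>j<M. D j) \<le> 8 + M * err" by (simp add: M_def algebra_simps)
    have D0: "0 \<le> D j" for j by (simp add: D_def)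
    have sumTh: "(\<Sum>l<j. 16 * (amp*L) * D l + 2 * err) \<le> 129 * (amp*L)" if "j \<le> M" for j
    proof -
      have "(\<Sum>l<j. 16 * (amp*L) * D l + 2 * err) \<le> (\<Sum>l<M. 16 * (amp*L) * D l + 2 * err)"
        using that D0 amp_le err by (intro sum_mono2) auto
      also have "\<dots> = 16 * (amp*L) * (\<Sum>l<M. D l) + 2 * (M * err)" by (simp add: sum.distrib sum_distrib_left)
      also have "\<dots> \<le> 16 * (amp*L) * (8 + M * err) + 2 * (M * err)" using sumD amp_le by (intro add_right_mono mult_left_mono) auto
      also have "\<dots> \<le> 128 * (amp*L) + 1 * (M * err) + 2 * (M * err)"
        using mult_right_mono[of "16*(amp*L)" 1 "M*err"] amp err by (simp add: algebra_simps)
      finally show ?thesis using Md amp_le by linarith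
    qed
    have "\<bar>X 0 - X' 0\<bar> \<le> exp (\<Sum>l<M. \<Theta> l) * \<bar>X M - X' M\<bar> + 2 * (\<Sum>l<M. 3 * (amp*L) * \<bar>Y l - Y' l\<bar>)"
    proof (rule backward_recursion)
      fix j assume j: "j < M"
      show "\<bar>X j - X' j\<bar> \<le> exp (\<Theta> j) * (\<bar>X (Suc j) - X' (Suc j)\<bar> + 3 * (amp*L) * \<bar>Y j - Y' j\<bar>)"
      proof (cases "j < T")
        case True
        then have "b (ref j) = 1" using profile_along_rotation[OF r(1)] by (simp add: ref_def)
        from rotation_pair_step[OF this, of "Y j" "X j" "X' j" "Y' j"] D6[OF j]
        show ?thesis using True orbitD(2)[OF c(4)] orbitD(2)[OF c(7)] by (simp add: \<Theta>_def D_def)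
      next
        case False
        then have "b (ref j) = 0" using profile_along_integers by (simp add: ref_def)
        moreover have "\<bar>X j - n\<bar> \<le> 1/6" using near[OF c(1-4,6), of "j-T"] False j by (simp add: M_def)
        moreover have "\<bar>X' j - n\<bar> \<le> 1/6" using near[OF c(1-3,7,9), of "j-T"] False j by (simp add: M_def)
        ultimately show ?thesis using source_pair_step[of "ref j" "Y j" "X j" n "X' j" "Y' j"] D6[OF j] False orbitD(2)[OF c(4)] orbitD(2)[OF c(7)]
          by (simp add: \<Theta>_def D_def)
      qed
    next
      fix j show "0 \<le> 3 * (amp*L) * \<bar>Y j - Y' j\<bar>" using amp_le by simp
    next
      fix j assume "j \<le> M"
      have "(\<Sum>l<j. \<Theta> l) \<le> (\<Sum>l<j. 16 * (amp*L) * D l + 2 * err)"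
        using amp by (intro sum_mono) (auto simp: \<Theta>_def)
      also note sumTh[OF \<open>j \<le> M\<close>]
      finally have "(\<Sum>l<j. \<Theta> l) \<le> 1/2" using amp by linarith
      then have "exp (\<Sum>l<j. \<Theta> l) \<le> exp (1/2)" by simp
      also have "exp (1/2) \<le> (2::real)" using exp_bound_lemma[of "1/2::real"] by simp
      finally show "exp (\<Sum>l<j. \<Theta> l) \<le> 2" .
    qed
    also have "(\<Sum>l<M. \<Theta> l) = (\<Sum>l<M. 16 * (amp*L) * D l + 2 * err) - (\<Sum>l<M. if l < T then 0 else amp)"
      by (simp add: \<Theta>_def sum_subtractf)
    also have "(\<Sum>l<M. if l < T then 0 else amp) = K * amp"
    proof -
      have "(\<Sum>l<M. if l < T then 0 else amp) = (\<Sum>l\<in>{T..<M}. amp)"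
        by (rule sum.mono_neutral_cong_right) auto
      then show ?thesis by (simp add: M_def)
    qed
    also have "exp ((\<Sum>l<M. 16 * (amp*L) * D l + 2 * err) - K * amp) * \<bar>X M - X' M\<bar> \<le> exp (129 * (amp*L) - amp * K) * \<bar>X M - X' M\<bar>"
      using sumTh[of M] by (intro mult_right_mono) (auto simp: mult_ac)
    also have "(\<Sum>l<M. 3 * (amp*L) * \<bar>Y l - Y' l\<bar>) \<le> (\<Sum>l<M. 3 * (amp*L) * ((2/3)^(M-l) * \<bar>Y M - Y' M\<bar>))"
      using base_backward[OF c(4,7)] amp_le by (intro sum_mono mult_left_mono) auto
    also have "\<dots> = 3 * (amp*L) * ((\<Sum>l<M. (2/3)^(M-l)) * \<bar>Y M - Y' M\<bar>)" by (simp add: sum_distrib_left sum_distrib_right)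
    also have "\<dots> \<le> 3 * (amp*L) * (2 * \<bar>Y M - Y' M\<bar>)"
      using sum_two_thirds_powers[of M] amp_le by (intro mult_left_mono mult_right_mono) auto
    finally show ?thesis by simp
  qed
  \<comment> \<open>the net gain of the round\<close>
  define t where "t = amp * K - 129 * (amp*L)"
  have "amp * (4000 * L) \<le> amp * K" using K amp by (intro mult_left_mono) auto
  moreover have "amp * (4000 * L) = 4000 * (amp*L)" by simp
  ultimately have t1: "t \<ge> 3871 * (amp*L)" unfolding t_def by linarith
  have "amp * K * 1 \<le> amp * K * L" using amp L by (intro mult_left_mono) auto
  then have t2: "t \<le> 1/400" using K(2) amp_le(4) unfolding t_def by (simp add: mult_ac)
  have t3: "exp (- t) \<le> 1 - t/2"
  proof -
    have "t \<ge> 0" using t1 amp_le by linarith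
    have "exp (-t) = 1 / exp t" by (simp add: exp_minus inverse_eq_divide)
    also have "\<dots> \<le> 1 / (1 + t)" using \<open>t \<ge> 0\<close> exp_ge_add_one_self[of t] by (intro divide_left_mono) auto
    also have "\<dots> \<le> 1 - t/2"
    proof -
      have "t * t \<le> t * 1" using t2 \<open>t \<ge> 0\<close> by (intro mult_left_mono) auto
      then have "1 \<le> (1 - t/2) * (1 + t)" by (simp add: algebra_simps)
      then show ?thesis using \<open>t \<ge> 0\<close> by (subst pos_divide_le_eq) auto
    qed
    finally show ?thesis .
  qed
  show ?thesis
  proof (rule that[of M R])
    show M3: "M \<ge> 3" using K4000 by (simp add: M_def)
    fix Yc Xc Y X
    assume cen: "orbit Yc Xc" "Yc M = R" "\<bar>Xc 0 - x\<bar> \<le> 12 * (amp*L) * \<bar>Yc 0 - y\<bar>" and box: "in_box M R (Xc M) Y X"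
    note c = cen box[unfolded in_box_def, THEN conjunct1] box[unfolded in_box_def, THEN conjunct2, THEN conjunct1]
      box[unfolded in_box_def, THEN conjunct2, THEN conjunct2]
    have "(2/3::real)^M \<le> (2/3)^3" using M3 by (intro power_decreasing) auto
    then have "(2/3)^M * \<bar>Y M - Yc M\<bar> \<le> (2/3)^3 * 3" using c by (intro mult_mono) auto
    then have "\<bar>Y 0 - Yc 0\<bar> \<le> 8/9" using base_backward[OF c(4,1), of 0 M] by (simp add: power3_eq_cube)
    moreover have "\<bar>X 0 - Xc 0\<bar> \<le> 1/24 - 80 * (amp*L) + 36 * (amp*L)"
    proof -
      have et: "exp (129 * (amp*L) - amp * K) = exp (-t)" by (simp add: t_def)
      have "exp (-t) * \<bar>X M - Xc M\<bar> \<le> (1 - t/2) * (1/24)" using t2 t3 c by (intro mult_mono) auto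
      moreover have "12 * (amp*L) * \<bar>Y M - Yc M\<bar> \<le> 12 * (amp*L) * 3" using c amp_le by (intro mult_left_mono) auto
      moreover have "\<bar>X 0 - Xc 0\<bar> \<le> exp (129 * (amp*L) - amp * K) * \<bar>X M - Xc M\<bar> + 12 * (amp*L) * \<bar>Y M - Yc M\<bar>"
        using main[OF c c(1)] c(2) by simp
      moreover have "z \<le> 1/24 - 80 * w + 36 * w"
        if "u \<le> (1 - t/2) * (1/24)" "v \<le> 12 * w * 3" "z \<le> u + v" "3871 * w \<le> t" "0 < w" for u v w z :: real
      proof -
        have "(1 - t/2) * (1/24) = 1/24 - t/48" by (simp add: field_simps)
        then show ?thesis using that by linarith
      qed
      ultimately show ?thesis using t1 amp_le(4) unfolding et by blast
    qed
    ultimately show "\<bar>Y 0 - y\<bar> \<le> 3 \<and> \<bar>X 0 - x\<bar> \<le> 1/24"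
      using c0[OF c(1,2)] cx[OF c(1-3)] d1 amp_le by linarith
  next
    fix Yc Xc Y X Y' X'
    assume c: "orbit Yc Xc" "Yc M = R" "\<bar>Xc 0 - x\<bar> \<le> 12 * (amp*L) * \<bar>Yc 0 - y\<bar>"
      and box: "in_box M R (Xc M) Y X" "in_box M R (Xc M) Y' X'"
    have "exp (129 * (amp*L) - amp * K) * \<bar>X M - X' M\<bar> \<le> exp (-amp) * \<bar>X M - X' M\<bar>"
    proof (intro mult_right_mono)
      have "129 * (amp * L) - amp * real K \<le> - amp" using t1 amp_le unfolding t_def by linarith
      then show "exp (129 * (amp*L) - amp * K) \<le> exp (-amp)" by simp
    qed simp
    then show "\<bar>X 0 - X' 0\<bar> \<le> exp (- amp) * \<bar>X M - X' M\<bar> + 12 * (amp*L) * \<bar>Y M - Y' M\<bar>"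
      using main[OF c] box unfolding in_box_def by fastforce
  qed
qed

lemma pair_backward:
  assumes "orbit Y X" "orbit Y' X'"
  shows "\<bar>Y 0 - Y' 0\<bar> + \<bar>X 0 - X' 0\<bar> \<le> 2^n * (\<bar>Y n - Y' n\<bar> + \<bar>X n - X' n\<bar>)"
proof (induction n)
  case (Suc n)
  note Suc.IH
  also have "2^n * (\<bar>Y n - Y' n\<bar> + \<bar>X n - X' n\<bar>) \<le> 2^n * (2 * (\<bar>Y (Suc n) - Y' (Suc n)\<bar> + \<bar>X (Suc n) - X' (Suc n)\<bar>))"
    unfolding orbitD[OF assms(1)] orbitD[OF assms(2)] by (intro mult_left_mono inverse_lipschitz) auto
  also have "\<dots> = 2^Suc n * (\<bar>Y (Suc n) - Y' (Suc n)\<bar> + \<bar>X (Suc n) - X' (Suc n)\<bar>)" by simp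
  finally show ?case .
qed simp

text \<open>Backward from the box at time \<open>n\<close>, orbits return into the box around \<open>(y, x)\<close> at time \<open>m\<close>, and the norm \<open>|X| + 48 amp L |Y|\<close>
  contracts by \<open>\<theta>\<close>. The weight \<open>48 amp L\<close> is four times the shear \<open>12 amp L\<close> in \<open>stage\<close>, so the strong contraction of the
  base absorbs the shear.\<close>

definition box_contracted :: "nat \<Rightarrow> real \<Rightarrow> real \<Rightarrow> nat \<Rightarrow> (nat \<Rightarrow> real) \<Rightarrow> (nat \<Rightarrow> real) \<Rightarrow> real \<Rightarrow> bool" where
  "box_contracted m y x n Yc Xc \<theta> \<longleftrightarrow>
     (\<forall>Y X. in_box n (Yc n) (Xc n) Y X \<longrightarrow> in_box m y x Y X) \<and>
     (\<forall>Y X Y' X'. in_box n (Yc n) (Xc n) Y X \<and> in_box n (Yc n) (Xc n) Y' X' \<longrightarrow>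
        \<bar>X m - X' m\<bar> + 48 * (amp*L) * \<bar>Y m - Y' m\<bar> \<le> \<theta> * (\<bar>X n - X' n\<bar> + 48 * (amp*L) * \<bar>Y n - Y' n\<bar>))"

text \<open>All centre orbits start at the height of the given orbit: their images lie on one nearly horizontal
  curve, as each round requires, and no drift in the fibre accumulates over the rounds.\<close>

lemma box_contracted_exists:
  assumes c: "orbit Y0 X0"
  shows "\<exists>n Yc Xc. n \<ge> m \<and> orbit Yc Xc \<and> Xc 0 = X0 0 \<and> box_contracted m (Y0 m) (X0 m) n Yc Xc (exp (-amp) ^ k)"
proof (induction k)
  case 0
  show ?case using c by (intro exI[of _ m] exI[of _ Y0] exI[of _ X0]) (auto simp: box_contracted_def)
next
  case (Suc k)
  then obtain n Yc Xc where n: "n \<ge> m" "orbit Yc Xc" "Xc 0 = X0 0"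
    and bc: "box_contracted m (Y0 m) (X0 m) n Yc Xc (exp (-amp) ^ k)" by blast
  obtain M R where M: "M \<ge> 3" and
    st1: "\<And>Y1 X1 Y X. orbit Y1 X1 \<Longrightarrow> Y1 M = R \<Longrightarrow> \<bar>X1 0 - Xc n\<bar> \<le> 12 * (amp*L) * \<bar>Y1 0 - Yc n\<bar> \<Longrightarrow>
       in_box M R (X1 M) Y X \<Longrightarrow> \<bar>Y 0 - Yc n\<bar> \<le> 3 \<and> \<bar>X 0 - Xc n\<bar> \<le> 1/24"
    and st2: "\<And>Y1 X1 Y X Y' X'. orbit Y1 X1 \<Longrightarrow> Y1 M = R \<Longrightarrow> \<bar>X1 0 - Xc n\<bar> \<le> 12 * (amp*L) * \<bar>Y1 0 - Yc n\<bar> \<Longrightarrow>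
       in_box M R (X1 M) Y X \<Longrightarrow> in_box M R (X1 M) Y' X' \<Longrightarrow>
       \<bar>X 0 - X' 0\<bar> \<le> exp (- amp) * \<bar>X M - X' M\<bar> + 12 * (amp*L) * \<bar>Y M - Y' M\<bar>"
    using stage[of "Xc n" "Yc n"] by blast
  obtain Y2 X2 where "orbit Y2 X2" "Y2 (n + M) = R" using orbit_through by blast
  moreover obtain Y1 X1 where Y1: "orbit Y1 X1" "Y1 0 = Y2 0" "X1 0 = X0 0" using orbit_from by blast
  ultimately have YR: "Y1 (n + M) = R" using orbit_base_unique by metis
  have cone: "\<bar>X1 n - Xc n\<bar> \<le> 12 * (amp*L) * \<bar>Y1 n - Yc n\<bar>"
    by (rule cone_orbit) (use Y1 n amp_le in auto)
  note sh = orbit_shift[of _ _ n]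
  have sb: "in_box M R (X1 (n + M)) (\<lambda>j. Y (n + j)) (\<lambda>j. X (n + j))" if "in_box (n + M) (Y1 (n + M)) (X1 (n + M)) Y X" for Y X
    using that YR sh unfolding in_box_def by auto
  note S1 = st1[OF sh[OF Y1(1)] YR, unfolded add_0_right, OF cone sb]
  note S2 = st2[OF sh[OF Y1(1)] YR, unfolded add_0_right, OF cone sb sb]
  have S0: "in_box n (Yc n) (Xc n) Y X" if "in_box (n + M) (Y1 (n + M)) (X1 (n + M)) Y X" for Y X
    using S1[OF that] that unfolding in_box_def by auto
  have "box_contracted m (Y0 m) (X0 m) (n + M) Y1 X1 (exp (-amp) ^ Suc k)"
    unfolding box_contracted_def
  proof (intro conjI allI impI; (elim conjE)?)
    fix Y X assume "in_box (n + M) (Y1 (n + M)) (X1 (n + M)) Y X"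
    then show "in_box m (Y0 m) (X0 m) Y X" using bc S0 unfolding box_contracted_def by blast
  next
    fix Y X Y' X'
    assume o: "in_box (n + M) (Y1 (n + M)) (X1 (n + M)) Y X" and o': "in_box (n + M) (Y1 (n + M)) (X1 (n + M)) Y' X'"
    have ob: "orbit Y X" "orbit Y' X'" using o o' by (auto simp: in_box_def)
    define dx dy where "dx = \<bar>X (n+M) - X' (n+M)\<bar>" and "dy = \<bar>Y (n+M) - Y' (n+M)\<bar>"
    have 1: "\<bar>X n - X' n\<bar> \<le> exp (-amp) * dx + 12 * (amp*L) * dy"
      using S2[OF o o'] by (simp add: dx_def dy_def)
    have "(2/3::real)^M \<le> (2/3)^3" using M by (intro power_decreasing) auto
    then have "(2/3)^M * dy \<le> (2/3)^3 * dy" by (intro mult_right_mono) (auto simp: dy_def)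
    then have "\<bar>Y n - Y' n\<bar> \<le> 8/27 * dy"
      using base_backward[OF sh[OF ob(1)] sh[OF ob(2)], of 0 M] by (simp add: power3_eq_cube dy_def)
    then have 2: "48 * (amp*L) * \<bar>Y n - Y' n\<bar> \<le> 48 * (amp*L) * (8/27 * dy)"
      using amp_le by (intro mult_left_mono) auto
    have "exp (-amp) \<ge> 1 - amp" using exp_ge_add_one_self[of "-amp"] by simp
    then have "12 + 48 * (8/27) \<le> 48 * exp (-amp)" using amp_le by simp
    moreover have "0 \<le> (amp*L) * dy" by (rule mult_nonneg_nonneg) (use amp_le in \<open>auto simp: dy_def\<close>)
    ultimately have "(12 + 48 * (8/27)) * ((amp*L) * dy) \<le> 48 * exp (-amp) * ((amp*L) * dy)"
      by (rule mult_right_mono)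
    then have 3: "\<bar>X n - X' n\<bar> + 48 * (amp*L) * \<bar>Y n - Y' n\<bar> \<le> exp (-amp) * (dx + 48 * (amp*L) * dy)"
      using 1 2 by (simp add: algebra_simps)
    have "\<bar>X m - X' m\<bar> + 48 * (amp*L) * \<bar>Y m - Y' m\<bar> \<le> exp (-amp)^k * (\<bar>X n - X' n\<bar> + 48 * (amp*L) * \<bar>Y n - Y' n\<bar>)"
      using bc S0[OF o] S0[OF o'] unfolding box_contracted_def by blast
    also have "\<dots> \<le> exp (-amp)^k * (exp (-amp) * (dx + 48 * (amp*L) * dy))"
      using 3 by (intro mult_left_mono) auto
    finally show "\<bar>X m - X' m\<bar> + 48 * (amp*L) * \<bar>Y m - Y' m\<bar> \<le> exp (-amp)^Suc k *
      (\<bar>X (n+M) - X' (n+M)\<bar> + 48 * (amp*L) * \<bar>Y (n+M) - Y' (n+M)\<bar>)"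
      by (simp add: dx_def dy_def mult_ac)
  qed
  moreover have "n + M \<ge> m" using n by simp
  ultimately show ?case using Y1 by blast
qed

text \<open>First \<open>m\<close> steps make the horizontal size small at time \<open>0\<close>; they may distort the fibre by \<open>2^m\<close>. Then enough rounds are
  performed to make up for this factor.\<close>

lemma growth:
  assumes r: "r > 0"
  obtains n p q where "\<And>Y X. in_box n p q Y X \<Longrightarrow> \<bar>Y 0 - y\<bar> \<le> r \<and> \<bar>X 0 - x\<bar> \<le> r"
proof -
  obtain Y0 X0 where o: "orbit Y0 X0" "Y0 0 = y" "X0 0 = x" using orbit_from by blast
  obtain m where m: "(2/3::real)^m < r/3" using real_arch_pow_inv[of "r/3" "2/3"] r by auto
  define A where "A = 48 * (amp*L)"
  have A: "0 < A" "A \<le> 1" using amp_le amp by (auto simp: A_def)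
  define C where "C = 2^m * ((1/24 + 3 * A) / A)"
  have C: "C > 0" using A unfolding C_def by (intro mult_pos_pos divide_pos_pos) auto
  have "exp (-amp) < 1" using amp by simp
  then obtain k where k: "exp (-amp) ^ k < r / C" using real_arch_pow_inv[of "r/C" "exp (-amp)"] r C by auto
  obtain n Yc Xc where n: "n \<ge> m" "orbit Yc Xc" "Xc 0 = X0 0"
    and bc: "box_contracted m (Y0 m) (X0 m) n Yc Xc (exp (-amp) ^ k)"
    using box_contracted_exists[OF o(1)] by blast
  show ?thesis
  proof (rule that[of n "Yc n" "Xc n"])
    fix Y X assume box: "in_box n (Yc n) (Xc n) Y X"
    then have u: "orbit Y X" "\<bar>Y n - Yc n\<bar> \<le> 3" "\<bar>X n - Xc n\<bar> \<le> 1/24" by (auto simp: in_box_def)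
    have "\<bar>Y m - Y0 m\<bar> \<le> 3" using bc box unfolding box_contracted_def in_box_def by blast
    then have "(2/3)^m * \<bar>Y m - Y0 m\<bar> \<le> (r/3) * 3" using m r by (intro mult_mono) auto
    then have "\<bar>Y 0 - y\<bar> \<le> r" using base_backward[OF u(1) o(1), of 0 m] o by simp
    moreover have "\<bar>X 0 - x\<bar> \<le> r"
    proof -
      have "\<bar>X m - Xc m\<bar> + A * \<bar>Y m - Yc m\<bar> \<le> exp (-amp)^k * (\<bar>X n - Xc n\<bar> + A * \<bar>Y n - Yc n\<bar>)"
      proof -
        have "in_box n (Yc n) (Xc n) Yc Xc" using n(2) by (simp add: in_box_def)
        then show ?thesis using bc box unfolding A_def box_contracted_def by blast
      qed
      also have "\<dots> \<le> (r/C) * (1/24 + A * 3)"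
        using k u A r C by (intro mult_mono add_mono) auto
      also have "\<dots> = r * A / 2^m"
      proof -
        have "(1/24 + 3 * A) \<noteq> 0" using A by linarith
        then show ?thesis using A by (simp add: C_def mult.commute)
      qed
      finally have D: "\<bar>X m - Xc m\<bar> + A * \<bar>Y m - Yc m\<bar> \<le> r * A / 2^m" .
      have "A * \<bar>X m - Xc m\<bar> \<le> 1 * \<bar>X m - Xc m\<bar>" using A by (intro mult_right_mono) auto
      then have "A * (\<bar>Y m - Yc m\<bar> + \<bar>X m - Xc m\<bar>) \<le> r * A / 2^m" using D by (simp add: distrib_left)
      then have "A * (2^m * (\<bar>Y m - Yc m\<bar> + \<bar>X m - Xc m\<bar>)) \<le> A * r" by (simp add: field_simps)
      then have "2^m * (\<bar>Y m - Yc m\<bar> + \<bar>X m - Xc m\<bar>) \<le> r" using A by (simp only: mult_le_cancel_left_pos)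
      then show ?thesis using pair_backward[OF u(1) n(2), of m] o n by linarith
    qed
    ultimately show "\<bar>Y 0 - y\<bar> \<le> r \<and> \<bar>X 0 - x\<bar> \<le> r" by simp
  qed
qed

end

section \<open>Covering the torus from a fixed size\<close>

context skew_lift begin

lemma unperturbed: "skew_lift i b L amp 0 (\<lambda>_. 0) (\<lambda>_ _. 0)"
  using i L b_lip b_bd b_int b_rot amp by unfold_locales auto

text \<open>Near an integer the sine pushes away from it, so backward orbits cannot leave.\<close>

lemma source_backward:
  fixes n :: int and R X Y :: real
  assumes "err = 0" "b R = 0" "\<bar>X - of_int n\<bar> \<le> 1/6"
  shows "\<bar>X - n\<bar> \<le> \<bar>H Y X - n\<bar> + 2 * (amp*L) * \<bar>Y - R\<bar>"
proof -
  have "E Y X = 0" using E_bd[of Y X] assms by simp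
  then have H: "H Y X = X + amp * sin (2*pi*X) + amp * ((b Y - b R) * (1 - sin (2*pi*X)))"
    using assms by (simp add: H_def algebra_simps)
  have s0: "sin (2 * pi * of_int n) = 0" using sin_2pi_add_int[of 0 n] by simp
  have "\<bar>X + amp * sin (2*pi*X) - n\<bar> \<ge> \<bar>X - n\<bar>"
  proof (cases "X \<ge> n")
    case True
    then have "sin (2*pi*X) \<ge> 0" using sin_2pi_expanding[OF assms(3), of n] s0 by simp
    then have "amp * sin (2*pi*X) \<ge> 0" using amp by simp
    then show ?thesis using True by simp
  next
    case False
    then have "sin (2*pi*X) \<le> 0" using sin_2pi_expanding[of n n X] assms(3) s0 by simp
    then have "amp * sin (2*pi*X) \<le> 0" using amp by (simp add: mult_le_0_iff)
    then show ?thesis using False by simp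
  qed
  then show ?thesis using H_diff_base[of Y R X] unfolding H by linarith
qed

text \<open>A number of steps that suffices for one full turn of the rotation, with two steps to spare for the passage between
  the two parts of an itinerary.\<close>

definition transit :: nat where "transit = nat \<lceil>1/amp\<rceil> + 2"

lemma transit: "1/amp + 2 \<le> transit" unfolding transit_def using amp by (simp add: of_nat_ceiling)

text \<open>Rotate for \<open>T\<close> steps from \<open>x\<close> to an integer, stay there for \<open>l2\<close> steps, then rotate for \<open>l1\<close> steps to the target. The
  number \<open>l1\<close> depends on the target, but \<open>l1 + l2 = transit\<close> does not: waiting at the repelling fixed point makes the total time
  the same for all targets.\<close>

lemma covering_at_scale:
  assumes d0: "err = 0"
  obtains T where "T \<le> transit" "\<And>p q :: real. \<exists>(k::int) (l::int) Y X. orbit Y X \<and> Y (T + transit) = p + k \<and> X (T + transit) = q + l \<and>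
     \<bar>Y 0 - y\<bar> \<le> 5/2 \<and> \<bar>X 0 - x\<bar> \<le> 1/48"
proof -
  obtain r where r: "rot_point i r" "y \<le> r" "r \<le> y + 1" using rot_point_exists by blast
  obtain n :: int and T :: nat where n: "\<bar>x + T * amp - n\<bar> \<le> amp" and T: "T \<le> 1/amp + 1" by (rule rotation_time)
  define n0 :: int where "n0 = \<lfloor>of_int i ^ T * r\<rfloor>"
  have n0: "\<bar>of_int n0 - of_int i ^ T * r\<bar> \<le> 1" unfolding n0_def by (rule floor_dist)
  have Rpow: "of_int i ^ Suc j * c = of_int i * (of_int i ^ j * c)" for j and c :: real by (simp add: mult_ac)
  have "T \<le> transit" using T transit by linarith
  moreover have "\<exists>(k::int) (l::int) Y X. orbit Y X \<and> Y (T + transit) = p + k \<and> X (T + transit) = q + l \<and>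
     \<bar>Y 0 - y\<bar> \<le> 5/2 \<and> \<bar>X 0 - x\<bar> \<le> 1/48" for p q :: real
  proof -
    \<comment> \<open>the height of the target is shifted so that the rotation back from it ends near \<open>n\<close> itself\<close>
    define l :: int where "l = n - \<lfloor>q\<rfloor>"
    define l1 where "l1 = nat \<lfloor>(q + l - n)/amp\<rfloor>"
    have ql: "0 \<le> q + l - n" "q + l - n < 1" unfolding l_def of_int_diff by linarith+
    then have "real l1 = of_int \<lfloor>(q + l - n)/amp\<rfloor>" using amp by (simp add: l1_def)
    then have l1: "l1 \<le> (q + l - n)/amp" "(q + l - n)/amp \<le> l1 + 1" by linarith+
    then have qe: "l1 * amp \<le> q + l - n" "q + l - n \<le> l1 * amp + amp" using amp by (simp_all add: field_simps)
    have "(q + l - n)/amp \<le> 1/amp" using ql amp by (intro divide_right_mono) auto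
    then have "real l1 + 2 \<le> real transit" using l1 transit by linarith
    then have l12: "l1 + 2 \<le> transit" by linarith
    define l2 where "l2 = transit - l1"
    have l2: "l2 \<ge> 2" "transit = l2 + l1" using l12 by (auto simp: l2_def)
    define s where "s = of_int i ^ l2 * real_of_int n0 + 1/(of_int i+1)"
    have s: "rot_point i s" unfolding rot_point_def s_def
      by (rule exI[of _ "i ^ l2 * n0"]) simp
    have s1: "\<bar>s - of_int i ^ l2 * real_of_int n0\<bar> \<le> 1" using i by (simp add: s_def)
    \<comment> \<open>among the lifts of the target the one near the itinerary\<close>
    define k :: int where "k = \<lfloor>of_int i ^ l1 * s - p\<rfloor>"
    have k: "\<bar>(p + k) - of_int i ^ l1 * s\<bar> \<le> 1" unfolding k_def by linarith
    obtain Y X where o: "orbit Y X" "Y (T + transit) = p + k" "X (T + transit) = q + l" using orbit_through by blast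
    note oT = orbit_shift[OF o(1), of T]
    note oTl = orbit_shift[OF o(1), of "T + l2"]
    have TN: "T + transit = T + l2 + l1" using l2 by simp
    have YTl: "\<bar>Y (T + l2) - s\<bar> \<le> 1"
    proof -
      have "\<bar>Y (T + l2 + l1) - of_int i ^ l1 * s\<bar> \<le> 1" using k o(2) unfolding TN by simp
      from shadow[of _ _ "\<lambda>j. of_int i ^ j * s" 0 l1, OF oTl Rpow] this
      have "\<bar>Y (T + l2) - s\<bar> \<le> \<bar>Y (T + l2 + l1) - of_int i ^ l1 * s\<bar> / 2^l1" using d0 by simp
      also have "\<dots> \<le> 1 / 2^l1" using \<open>\<bar>Y (T + l2 + l1) - of_int i ^ l1 * s\<bar> \<le> 1\<close> by (intro divide_right_mono) auto
      also have "\<dots> \<le> 1" by (simp add: divide_le_eq)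
      finally show ?thesis .
    qed
    then have YTl2: "\<bar>Y (T + l2) - of_int i ^ l2 * real_of_int n0\<bar> \<le> 2" using s1 by linarith
    have YT: "\<bar>Y T - n0\<bar> \<le> 1/2"
    proof -
      have "\<bar>Y T - n0\<bar> \<le> \<bar>Y (T + l2) - of_int i ^ l2 * real_of_int n0\<bar> / 2^l2"
        using shadow[of _ _ "\<lambda>j. of_int i ^ j * real_of_int n0" 0 l2, OF oT Rpow] d0 by simp
      also have "\<dots> \<le> 2 / 2^2" using YTl2 l2 by (intro frac_le power_increasing) auto
      finally show ?thesis by simp
    qed
    then have YT': "\<bar>Y T - of_int i ^ T * r\<bar> \<le> 3/2" using n0 by linarith
    have Y0: "\<bar>Y 0 - r\<bar> \<le> 3/2"
    proof -
      have "\<bar>Y 0 - r\<bar> \<le> \<bar>Y T - of_int i ^ T * r\<bar> / 2^T"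
        using shadow[of _ _ "\<lambda>j. of_int i ^ j * r" 0 T, OF o(1) Rpow] d0 by simp
      also have "\<dots> \<le> (3/2) / 1" using YT' by (intro frac_le) auto
      finally show ?thesis by simp
    qed
    have XTl: "\<bar>X (T + l2) - n\<bar> \<le> 3 * (amp*L)"
    proof -
      have "\<bar>Y (T + l2 + l1) - of_int i ^ l1 * s\<bar> \<le> 1" using k o(2) unfolding TN by simp
      from rotation_drift[of _ _ "\<lambda>j. of_int i ^ j * s" l1 1, OF oTl Rpow profile_along_rotation[OF s] this]
      have "\<bar>q + l - X (T + l2) - l1 * amp\<bar> \<le> 2 * (amp*L)" using d0 o(3) TN by simp
      then show ?thesis using qe amp_le by linarith
    qed
    have sumY: "(\<Sum>j<l2. \<bar>Y (T + j) - of_int i ^ j * real_of_int n0\<bar>) \<le> 2"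
      using shadow_sum[of _ _ "\<lambda>j. of_int i ^ j * real_of_int n0" l2 2, OF oT Rpow YTl2] d0 by simp
    have X: "\<bar>X (T + j) - n\<bar> \<le> 3 * (amp*L) + 2 * (amp*L) * (\<Sum>m=j..<l2. \<bar>Y (T + m) - of_int i ^ m * real_of_int n0\<bar>)" if "j \<le> l2" for j
      using that
    proof (induction j rule: inc_induct)
      case base then show ?case using XTl by simp
    next
      case (step j)
      have "(\<Sum>m=Suc j..<l2. \<bar>Y (T + m) - of_int i ^ m * real_of_int n0\<bar>) \<le> (\<Sum>j<l2. \<bar>Y (T + j) - of_int i ^ j * real_of_int n0\<bar>)"
        by (intro sum_mono2) auto
      then have "2 * (amp*L) * (\<Sum>m=Suc j..<l2. \<bar>Y (T + m) - of_int i ^ m * real_of_int n0\<bar>) \<le> 2 * (amp*L) * 2"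
        using sumY amp_le by (intro mult_left_mono) auto
      moreover have "\<bar>X (Suc (T + j)) - n\<bar> \<le> 3 * (amp*L) + 2 * (amp*L) * (\<Sum>m=Suc j..<l2. \<bar>Y (T + m) - of_int i ^ m * real_of_int n0\<bar>)"
        using step.IH by simp
      ultimately have "\<bar>X (Suc (T + j)) - n\<bar> \<le> 7 * (amp*L)" by linarith
      moreover have Xs: "X (Suc (T + j)) = H (Y (T + j)) (X (T + j))" by (rule orbitD(2)[OF o(1)])
      ultimately have "\<bar>X (T + j) - n\<bar> \<le> 1/6"
        using H_step_small[of "Y (T+j)" "X (T+j)"] amp by linarith
      from source_backward[OF d0 profile_along_integers this, of "Y (T+j)" j n0]
      show ?case using step.IH step.hyps Xs by (simp add: sum.atLeast_Suc_lessThan distrib_left)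
    qed
    have "2 * (amp*L) * (\<Sum>j<l2. \<bar>Y (T + j) - of_int i ^ j * real_of_int n0\<bar>) \<le> 2 * (amp*L) * 2"
      using sumY amp_le by (intro mult_left_mono) auto
    then have XT: "\<bar>X T - n\<bar> \<le> 7 * (amp*L)" using X[of 0] unfolding lessThan_atLeast0 add_0_right by linarith
    have "\<bar>X T - X 0 - T * amp\<bar> \<le> 3 * (amp*L)"
      using rotation_drift[of _ _ "\<lambda>j. of_int i ^ j * r" T "3/2", OF o(1) Rpow profile_along_rotation[OF r(1)] YT'] d0 by (simp add: mult_ac)
    then have "\<bar>X 0 - x\<bar> \<le> 11 * (amp*L)" using XT n amp_le by linarith
    then have "\<bar>X 0 - x\<bar> \<le> 1/48" using amp by linarith
    moreover have "\<bar>Y 0 - y\<bar> \<le> 5/2" using Y0 r by linarith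
    ultimately show ?thesis using o by blast
  qed
  ultimately show ?thesis using that by blast
qed

text \<open>The inverse of the lift is Lipschitz, so an orbit of the perturbed map with the same end as an unperturbed one
  shadows it for a bounded number of steps.\<close>

lemma backward_closeness:
  assumes "orbit Y X" "skew_lift.orbit i b amp (\<lambda>_. 0) (\<lambda>_ _. 0) Y' X'"
  shows "\<bar>Y 0 - Y' 0\<bar> + \<bar>X 0 - X' 0\<bar> + 4 * err \<le> 2^n * (\<bar>Y n - Y' n\<bar> + \<bar>X n - X' n\<bar> + 4 * err)"
proof -
  interpret U: skew_lift i b L amp 0 "\<lambda>_. 0" "\<lambda>_ _. 0" by (rule unperturbed)
  show ?thesis
  proof (induction n)
    case (Suc n)
    have "U.G (Y n) - U.G (Y' n) = Y (Suc n) - Y' (Suc n) - e (Y n)"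
      "U.H (Y n) (X n) - U.H (Y' n) (X' n) = X (Suc n) - X' (Suc n) - E (Y n) (X n)"
      using orbitD[OF assms(1), of n] U.orbitD[OF assms(2), of n] by (simp_all add: G_def U.G_def H_def U.H_def)
    then have "\<bar>Y n - Y' n\<bar> + \<bar>X n - X' n\<bar> + 4 * err \<le> 2 * (\<bar>Y (Suc n) - Y' (Suc n)\<bar> + \<bar>X (Suc n) - X' (Suc n)\<bar> + 4 * err)"
      using U.inverse_lipschitz[of "Y n" "Y' n" "X n" "X' n"] e_bd[of "Y n"] E_bd[of "Y n" "X n"]
        abs_triangle_ineq4[of "Y (Suc n) - Y' (Suc n)" "e (Y n)"] abs_triangle_ineq4[of "X (Suc n) - X' (Suc n)" "E (Y n) (X n)"]
      by argo
    then have "2^n * (\<bar>Y n - Y' n\<bar> + \<bar>X n - X' n\<bar> + 4 * err) \<le> 2^n * (2 * (\<bar>Y (Suc n) - Y' (Suc n)\<bar> + \<bar>X (Suc n) - X' (Suc n)\<bar> + 4 * err))"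
      by (intro mult_left_mono) auto
    also have "\<dots> = 2^Suc n * (\<bar>Y (Suc n) - Y' (Suc n)\<bar> + \<bar>X (Suc n) - X' (Suc n)\<bar> + 4 * err)" by simp
    finally show ?case using Suc.IH by linarith
  qed simp
qed

end

context mixing_lift begin

text \<open>Growth is performed by the perturbed map itself; the remaining, boundedly many steps follow an orbit of the
  unperturbed map.\<close>

lemma exact:
  assumes "r > 0" and d: "err * (4 * 2^(2 * transit)) \<le> 1/100"
  obtains N where "\<And>p q :: real. \<exists>(k::int) (l::int) Y X. orbit Y X \<and> \<bar>Y 0 - y\<bar> \<le> r \<and> \<bar>X 0 - x\<bar> \<le> r \<and>
     Y N = p + k \<and> X N = q + l"
proof -
  interpret U: skew_lift i b L amp 0 "\<lambda>_. 0" "\<lambda>_ _. 0" by (rule unperturbed)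
  obtain n p0 q0 where gr: "\<And>Y X. in_box n p0 q0 Y X \<Longrightarrow> \<bar>Y 0 - y\<bar> \<le> r \<and> \<bar>X 0 - x\<bar> \<le> r"
    using growth[OF assms(1)] by blast
  obtain T where T: "T \<le> transit" and cov: "\<And>p q :: real. \<exists>(k::int) (l::int) Y X. U.orbit Y X \<and> Y (T + transit) = p + k \<and> X (T + transit) = q + l \<and>
     \<bar>Y 0 - p0\<bar> \<le> 5/2 \<and> \<bar>X 0 - q0\<bar> \<le> 1/48"
    using U.covering_at_scale[OF refl, of p0 q0] unfolding U.transit_def transit_def by blast
  show ?thesis
  proof (rule that[of "n + (T + transit)"])
    fix p q :: real
    obtain k l :: int and Y' X' where u: "U.orbit Y' X'" "Y' (T + transit) = p + k" "X' (T + transit) = q + l"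
      "\<bar>Y' 0 - p0\<bar> \<le> 5/2" "\<bar>X' 0 - q0\<bar> \<le> 1/48" using cov by blast
    obtain Y X where o: "orbit Y X" "Y (n + (T + transit)) = p + k" "X (n + (T + transit)) = q + l" using orbit_through by blast
    have "\<bar>Y n - Y' 0\<bar> + \<bar>X n - X' 0\<bar> + 4 * err \<le> 2^(T + transit) * (4 * err)"
      using backward_closeness[OF orbit_shift[OF o(1), of n] u(1), of "T + transit"] o u by simp
    also have "\<dots> \<le> 2^(2*transit) * (4 * err)" using T err by (intro mult_right_mono power_increasing) auto
    also have "\<dots> \<le> 1/100" using d by (simp add: mult_ac)
    finally have "\<bar>Y n - Y' 0\<bar> \<le> 1/100" "\<bar>X n - X' 0\<bar> \<le> 1/100" using err by linarith+
    then have "\<bar>Y n - p0\<bar> \<le> 3" "\<bar>X n - q0\<bar> \<le> 1/24" using u(4,5) by linarith+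
    with o(1) have "in_box n p0 q0 Y X" by (simp add: in_box_def)
    from gr[OF this] o show "\<exists>(k::int) (l::int) Y X. orbit Y X \<and> \<bar>Y 0 - y\<bar> \<le> r \<and> \<bar>X 0 - x\<bar> \<le> r \<and>
     Y (n + (T + transit)) = p + k \<and> X (n + (T + transit)) = q + l" by blast
  qed
qed

end

section \<open>Nearly horizontal curves come close to every point\<close>

context skew_lift begin

lemma base_injective: "orbit Y X \<Longrightarrow> orbit Y' X' \<Longrightarrow> Y n = Y' n \<Longrightarrow> j \<le> n \<Longrightarrow> Y j = Y' j"
  using base_backward[of Y X Y' X' j n] by simp

lemma orbit_from_through:
  obtains Y X where "orbit Y X" "Y n = y" "X 0 = l (Y 0)"
proof -
  obtain Y1 X1 where 1: "orbit Y1 X1" "Y1 n = y" using orbit_through by blast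
  obtain Y X where 2: "orbit Y X" "Y 0 = Y1 0" "X 0 = l (Y1 0)" using orbit_from by blast
  then have "Y n = y" using orbit_base_unique[OF 2(1) 1(1)] 1 by simp
  then show ?thesis using that 2 by simp
qed

lemma vertical_forward:
  assumes "orbit Y X" "orbit Y' X'" "Y 0 = Y' 0"
  shows "\<bar>X n - X' n\<bar> \<le> (5/4)^n * \<bar>X 0 - X' 0\<bar>"
proof (induction n)
  case (Suc n)
  have "\<bar>X (Suc n) - X' (Suc n)\<bar> \<le> 5/4 * \<bar>X n - X' n\<bar>"
    using vertical_lipschitz[of "Y n" "X n" "X' n"] orbitD(2)[OF assms(1), of n] orbitD(2)[OF assms(2), of n]
      orbit_base_unique[OF assms, of n] by simp
  also have "\<dots> \<le> 5/4 * ((5/4)^n * \<bar>X 0 - X' 0\<bar>)" using Suc.IH by simp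
  finally show ?case by simp
qed simp

text \<open>The fibre over an integer also has an attracting fixed point, at \<open>1/2\<close>.\<close>

lemma sink_step:
  fixes n :: int and X :: real
  assumes "err = 0" "b Y = 0" "\<bar>X - n - 1/2\<bar> \<le> 1/6"
  shows "\<bar>H Y X - n - 1/2\<bar> \<le> (1 - amp) * \<bar>X - n - 1/2\<bar>"
proof -
  define u where "u = X - n - 1/2"
  have "E Y X = 0" using E_bd[of Y X] assms by simp
  moreover have "sin (2*pi*X) = - sin (2*pi*u)"
  proof -
    have "2*pi*X = 2*pi*(u + n) + pi" by (simp add: u_def field_simps)
    then show ?thesis using sin_2pi_add_int[of u n] by (simp only: sin_periodic_pi)
  qed
  ultimately have H: "H Y X - n - 1/2 = u - amp * sin (2*pi*u)" using assms by (simp add: H_def u_def)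
  have e8: "8 * amp \<le> 1" using amp_le by linarith
  have "\<bar>u - amp * sin (2*pi*u)\<bar> \<le> (1 - amp) * \<bar>u\<bar>"
  proof (cases "u \<ge> 0")
    case True
    have "2 * u \<le> sin (2*pi*u)" "sin (2*pi*u) \<le> 8 * u"
      using sin_2pi_expanding_aux[of u 0] sin_2pi_lipschitz[of u 0] assms(3) True by (auto simp: u_def)
    then have "amp * (2 * u) \<le> amp * sin (2*pi*u)" "amp * sin (2*pi*u) \<le> amp * (8 * u)" using amp by (simp_all add: mult_left_mono)
    moreover have "8 * amp * u \<le> 1 * u" using e8 True by (intro mult_right_mono) auto
    moreover have "0 \<le> amp * u" using amp True by simp
    ultimately show ?thesis using True by (simp add: algebra_simps)
  next
    case False
    have "sin (2*pi*u) \<le> 2 * u" "8 * u \<le> sin (2*pi*u)"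
      using sin_2pi_expanding_aux[of 0 u] sin_2pi_lipschitz[of u 0] assms(3) False by (auto simp: u_def)
    then have "amp * sin (2*pi*u) \<le> amp * (2 * u)" "amp * (8 * u) \<le> amp * sin (2*pi*u)" using amp by (simp_all add: mult_left_mono)
    moreover have "8 * amp * (-u) \<le> 1 * (-u)" using e8 False by (intro mult_right_mono) auto
    moreover have "0 \<le> amp * (-u)" using amp False by (intro mult_nonneg_nonneg) auto
    ultimately have "u \<le> amp * sin (2*pi*u)" "amp * sin (2*pi*u) \<le> amp * u"
      by (simp_all only: mult_minus_right mult.assoc mult_1 mult.left_commute[of 8])
    then show ?thesis using False e8 amp by (simp add: left_diff_distrib abs_if)
  qed
  then show ?thesis unfolding H by (simp add: u_def)
qed

lemma shadow_exact:
  assumes "err = 0" "orbit Y X" "\<bar>Y (n + T) - of_int i ^ T * r\<bar> \<le> c" "j \<le> T"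
  shows "\<bar>Y (n + j) - of_int i ^ j * r\<bar> \<le> c / 2^(T-j)"
proof -
  have Rpow: "of_int i ^ Suc j * r = of_int i * (of_int i ^ j * r)" for j by (simp add: mult_ac)
  show ?thesis
    using shadow[of _ _ "\<lambda>j. of_int i ^ j * r" j T, OF orbit_shift[OF assms(2), of n] Rpow assms(4)]
      divide_right_mono[OF assms(3), of "2^(T-j)"] assms(1) by simp
qed

text \<open>The nearly horizontal curves, as graphs over the universal cover of the base. By \<open>cone_invariant\<close> this slope is
  preserved.\<close>

definition flat :: "(real \<Rightarrow> real) \<Rightarrow> bool" where
  "flat l \<longleftrightarrow> (\<forall>Y Y'. \<bar>l Y - l Y'\<bar> \<le> 12 * (amp*L) * \<bar>Y - Y'\<bar>)"

abbreviation ystar :: real where "ystar \<equiv> 1 / (of_int i + 1)"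

lemma ystar: "0 \<le> ystar" "ystar \<le> 1" "rot_point i (of_int m + ystar)" "rot_point i ystar"
proof -
  show "0 \<le> ystar" "ystar \<le> 1" using i by auto
  show *: "rot_point i (of_int m + ystar)" for m unfolding rot_point_def by blast
  show "rot_point i ystar" using *[of 0] by simp
qed

lemma flat_orbits:
  assumes "flat l" "orbit Y X" "X 0 = l (Y 0)" "orbit Y' X'" "X' 0 = l (Y' 0)"
  shows "\<bar>X j - X' j\<bar> \<le> 12 * (amp*L) * \<bar>Y j - Y' j\<bar>"
  by (rule cone_orbit) (use assms in \<open>auto simp: flat_def\<close>)

text \<open>After \<open>N\<close> steps the curve passes, up to integer translations, over \<open>y\<close> at distance at most \<open>r\<close> from \<open>x\<close>.\<close>

definition meets :: "(real \<Rightarrow> real) \<Rightarrow> nat \<Rightarrow> real \<Rightarrow> real \<Rightarrow> real \<Rightarrow> bool" where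
  "meets l N y x r \<longleftrightarrow> (\<exists>Y X (m::int) (n::int). orbit Y X \<and> X 0 = l (Y 0) \<and> Y N = y + m \<and> \<bar>X N - n - x\<bar> \<le> r)"

lemma meetsI:
  fixes m n :: int and x y :: real
  assumes "orbit Y X" "X 0 = l (Y 0)" "Y N = y + m" "\<bar>X N - n - x\<bar> \<le> r" shows "meets l N y x r"
  using assms unfolding meets_def by blast

text \<open>The time \<open>T\<close> of rotation depends on the curve, but the total time does not: after the rotation the orbit stays at the
  attracting fixed point until time \<open>transit + m'\<close>.\<close>

lemma curves_reach_sink:
  assumes d0: "err = 0" and \<eta>: "\<eta> > 0"
  obtains N where "\<And>l. flat l \<Longrightarrow> meets l N 0 (1/2) \<eta>"
proof -
  have "1 - amp < 1" "0 \<le> 1 - amp" using amp amp_le by auto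
  then obtain m' where m': "(1 - amp)^m' < \<eta>" using real_arch_pow_inv[of \<eta> "1-amp"] \<eta> by auto
  show ?thesis
  proof (rule that[of "transit + m'"])
    fix l assume l: "flat l"
    obtain n :: int and T :: nat where n: "\<bar>(l ystar - 1/2) + T * amp - n\<bar> \<le> amp" and T: "T \<le> 1/amp + 1" by (rule rotation_time)
    have TN: "T \<le> transit" using T transit by linarith
    define k where "k = transit + m' - T"
    have k: "k \<ge> m'" "transit + m' = T + k" using TN by (auto simp: k_def)
    define m0 where "m0 = \<lfloor>of_int i ^ T * ystar\<rfloor>"
    have m0: "\<bar>of_int m0 - of_int i ^ T * ystar\<bar> \<le> 1" unfolding m0_def by (rule floor_dist)
    obtain Y X where o: "orbit Y X" "Y (T + k) = of_int i ^ k * real_of_int m0" "X 0 = l (Y 0)"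
      by (rule orbit_from_through)
    have YT: "Y (T + j) = of_int i ^ j * real_of_int m0" if "j \<le> k" for j
      using shadow_exact[OF d0 o(1), of T k "real_of_int m0" 0 j] o(2) that by simp
    have YT0: "\<bar>Y (0 + T) - of_int i ^ T * ystar\<bar> \<le> 1" using YT[of 0] m0 by simp
    have "\<bar>Y 0 - ystar\<bar> \<le> 1 / 2^T" using shadow_exact[OF d0 o(1) YT0, of 0] by simp
    also have "\<dots> \<le> 1" by (simp add: divide_le_eq)
    finally have "12 * (amp*L) * \<bar>Y 0 - ystar\<bar> \<le> 12 * (amp*L) * 1" using amp_le by (intro mult_left_mono) auto
    then have "\<bar>X 0 - l ystar\<bar> \<le> 12 * (amp*L)"
      using l o(3) unfolding flat_def by (metis mult.right_neutral order_trans)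
    moreover have "\<bar>X T - X 0 - T * amp\<bar> \<le> 2 * (amp*L)"
    proof -
      have Rpow: "of_int i ^ Suc j * ystar = of_int i * (of_int i ^ j * ystar)" for j by simp
      show ?thesis using rotation_drift[of _ _ "\<lambda>j. of_int i ^ j * ystar" T 1, OF o(1) Rpow profile_along_rotation[OF ystar(4)]] YT0 d0
        by simp
    qed
    ultimately have "\<bar>X T - n - 1/2\<bar> \<le> 15 * (amp*L)" using n amp_le by linarith
    then have X0: "\<bar>X T - n - 1/2\<bar> \<le> 1/6" using amp by linarith
    have X: "\<bar>X (T + j) - n - 1/2\<bar> \<le> (1 - amp)^j * (1/6)" if "j \<le> k" for j
      using that
    proof (induction j)
      case (Suc j)
      have b0: "b (Y (T + j)) = 0" using YT[of j] Suc.prems profile_along_integers by simp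
      have IH: "\<bar>X (T + j) - n - 1/2\<bar> \<le> (1 - amp)^j * (1/6)" using Suc by simp
      also have "\<dots> \<le> 1 * (1/6)" using amp amp_le by (intro mult_right_mono power_le_one) auto
      finally have "\<bar>H (Y (T+j)) (X (T+j)) - n - 1/2\<bar> \<le> (1 - amp) * \<bar>X (T + j) - n - 1/2\<bar>"
        by (intro sink_step d0 b0) simp
      also have "\<dots> \<le> (1 - amp) * ((1 - amp)^j * (1/6))" using IH amp_le by (intro mult_left_mono) auto
      finally show ?case using orbitD(2)[OF o(1), of "T+j"] by simp
    qed (use X0 in simp)
    have "(1-amp)^k * (1/6) \<le> (1-amp)^m' * 1"
      using k amp amp_le by (intro mult_mono power_decreasing) auto
    then have "\<bar>X (T + k) - n - 1/2\<bar> \<le> \<eta>" using X[of k] m' by linarith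
    moreover have "Y (T + k) = 0 + of_int (i ^ k * m0)" using o(2) by simp
    ultimately show "meets l (transit + m') 0 (1/2) \<eta>" unfolding k(2) by (rule meetsI[where l = l, OF o(1,3), rotated])
  qed
qed

lemma orbit_translate:
  fixes k l :: int
  assumes d0: "err = 0" and per: "\<And>Y (n::int). b (Y + n) = b Y" and o: "orbit Y X"
  shows "orbit (\<lambda>j. Y j + of_int i ^ j * k) (\<lambda>j. X j + l)"
proof -
  have e: "e Y = 0" "E Y X = 0" for Y X using e_bd[of Y] E_bd[of Y X] d0 by auto
  have "b (Y j + of_int i ^ j * k) = b (Y j)" for j using per[of "Y j" "i^j * k"] by simp
  then have "G (Y j + of_int i ^ j * k) = G (Y j) + of_int i ^ Suc j * k"
    "H (Y j + of_int i ^ j * k) (X j + l) = H (Y j) (X j) + l" for j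
    unfolding G_def H_def e sin_2pi_add_int by (auto simp: distrib_left)
  then show ?thesis using o unfolding orbit_def by simp
qed

text \<open>From the common position \<open>(0, 1/2)\<close> all curves are followed to the fibre over \<open>1/(i+1)\<close> in \<open>h\<close> steps. The starting points
  lie within \<open>2^-h\<close> of the fibre over the integer, which beats the growth \<open>(5/4)^h\<close> of fibre distances.\<close>

lemma curves_reach_reference:
  assumes d0: "err = 0" and per: "\<And>Y (n::int). b (Y + n) = b Y" and \<zeta>: "\<zeta> > 0"
  obtains N xref where "\<And>l. flat l \<Longrightarrow> meets l N ystar xref \<zeta>"
proof -
  obtain h where h: "(5/8::real)^h < \<zeta>/2" using real_arch_pow_inv[of "\<zeta>/2" "5/8"] \<zeta> by auto
  \<comment> \<open>small enough to survive the growth \<open>(5/4)^h\<close>\<close>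
  define \<eta> where "\<eta> = (4/5)^h * (\<zeta>/2)"
  have \<eta>: "\<eta> > 0" using \<zeta> by (simp add: \<eta>_def)
  obtain N where N: "\<And>l. flat l \<Longrightarrow> meets l N 0 (1/2) \<eta>"
    using curves_reach_sink[OF d0 \<eta>] by blast
  obtain Yr Xr where r: "orbit Yr Xr" "Yr h = ystar" "Xr 0 = 1/2" by (rule orbit_from_through[of h ystar "\<lambda>_. 1/2"])
  show ?thesis
  proof (rule that[of "N + h" "Xr h"])
    fix l assume l: "flat l"
    obtain Y X :: "nat \<Rightarrow> real" and m n :: int where o: "orbit Y X" "X 0 = l (Y 0)" "Y N = 0 + real_of_int m" "\<bar>X N - n - 1/2\<bar> \<le> \<eta>"
      using N[OF l] unfolding meets_def by blast
    obtain Y' X' where o': "orbit Y' X'" "Y' (N + h) = of_int i ^ h * m + ystar" "X' 0 = l (Y' 0)"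
      by (rule orbit_from_through)
    have "\<bar>Y' N - m\<bar> \<le> 1 / 2^h"
      using shadow_exact[OF d0 o'(1), of N h m ystar 0] o'(2) ystar(1) divide_right_mono[OF ystar(2), of "2^h"] by simp
    then have "12 * (amp*L) * \<bar>Y' N - Y N\<bar> \<le> 1 * (1/2^h)" using o amp amp_le by (intro mult_mono) auto
    then have "\<bar>X' N - X N\<bar> \<le> 1/2^h" using flat_orbits[OF l o'(1,3) o(1,2), of N] by linarith
    then have X'N: "\<bar>X' N - n - 1/2\<bar> \<le> \<eta> + 1/2^h" using o(4) by linarith
    note rt = orbit_translate[OF d0 per r(1), of m n]
    have Y0: "Y' (N + 0) = Yr 0 + of_int i ^ 0 * m"
      by (rule base_injective[OF orbit_shift[OF o'(1)] rt, of N h 0]) (use o'(2) r(2) in auto)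
    have "\<bar>X' (N + h) - (Xr h + n)\<bar> \<le> (5/4)^h * \<bar>X' (N + 0) - (Xr 0 + n)\<bar>"
      by (rule vertical_forward[OF orbit_shift[OF o'(1)] rt Y0])
    also have "\<dots> \<le> (5/4)^h * (\<eta> + 1/2^h)" using X'N r(3) by (intro mult_left_mono) (auto simp: algebra_simps)
    also have "\<dots> = ((5/4)*(4/5))^h * (\<zeta>/2) + (5/8)^h"
      unfolding \<eta>_def power_mult_distrib by (simp add: algebra_simps power_divide flip: power_mult_distrib)
    also have "\<dots> \<le> \<zeta>" using h by simp
    finally have "\<bar>X' (N + h) - n - Xr h\<bar> \<le> \<zeta>" by (simp add: algebra_simps)
    moreover have "Y' (N + h) = ystar + of_int (i^h * m)" using o'(2) by simp
    ultimately show "meets l (N + h) ystar (Xr h) \<zeta>" by (rule meetsI[where l = l, OF o'(1,3), rotated])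
  qed
qed

text \<open>After an even number of steps the base point \<open>1/(i+1)\<close> is back, so that the approach to the target below does not
  depend on the number of rotations.\<close>

lemma ystar_even_power: "\<exists>m::int. of_int i ^ (2*q) * ystar = m + ystar"
proof (induction q)
  case 0 show ?case by (intro exI[of _ 0]) simp
next
  case (Suc q)
  then obtain m :: int where m: "of_int i ^ (2*q) * ystar = m + ystar" by blast
  have y: "of_int i * ystar = 1 - ystar" using i by (simp add: field_simps)
  have "of_int i ^ (2 * Suc q) * ystar = of_int i * (of_int i * (of_int i ^ (2*q) * ystar))" by (simp only: mult_Suc_right) (simp add: mult_ac)
  also have "\<dots> = of_int i * (of_int i * real_of_int m + (1 - ystar))" unfolding m by (simp only: distrib_left y)
  also have "\<dots> = of_int (i * (i * m + 1) - 1) + ystar" using y by (simp add: algebra_simps)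
  finally show ?case by blast
qed

text \<open>The target is approached from \<open>1/(i+1)\<close> in \<open>h\<close> steps, along a fixed branch of the inverse of the base map; this
  prescribes a height \<open>Xa 0\<close> at the beginning of the approach. As the heights of all curves are nearly the same, one
  number \<open>2*q\<close> of rotation steps brings all of them near this height.\<close>

theorem curves_hit:
  fixes y x r :: real
  assumes d0: "err = 0" and per: "\<And>Y (n::int). b (Y + n) = b Y" and irr: "amp \<notin> \<rat>" and r: "r > 0"
  obtains N where "\<And>l. flat l \<Longrightarrow> meets l N y x r"
proof -
  obtain h where h: "(5/8::real)^h < r/4" using real_arch_pow_inv[of "r/4" "5/8"] r by auto
  define k where "k = \<lfloor>of_int i ^ h * ystar - y\<rfloor>"
  have k: "\<bar>(y + k) - of_int i ^ h * ystar\<bar> \<le> 1" unfolding k_def by linarith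
  obtain Ya Xa where a: "orbit Ya Xa" "Ya h = y + k" "Xa h = x" using orbit_through by blast
  define \<omega> where "\<omega> = (4/5)^h * (r/4)"
  have \<omega>: "\<omega> > 0" using r by (simp add: \<omega>_def)
  obtain N xref where N: "\<And>l. flat l \<Longrightarrow> meets l N ystar xref \<omega>"
    using curves_reach_reference[OF d0 per \<omega>] by blast
  have "2 * amp \<notin> \<rat>"
  proof
    assume "2 * amp \<in> \<rat>"
    then have "(2 * amp) / 2 \<in> \<rat>" by (intro Rats_divide) auto
    then show False using irr by simp
  qed
  then obtain z q0 :: int where q0: "q0 > 0" "\<bar>of_int q0 * (2 * amp) - of_int z - (Xa 0 - xref)\<bar> < \<omega>"
    using sequence_of_fractional_parts_is_dense[OF _ \<omega>] by metis
  define q where "q = nat q0"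
  have q: "\<bar>real (2*q) * amp - of_int z - (Xa 0 - xref)\<bar> < \<omega>" using q0 by (simp add: q_def mult_ac)
  show ?thesis
  proof (rule that[of "N + 2*q + h"])
    fix l assume l: "flat l"
    obtain Y X :: "nat \<Rightarrow> real" and m n :: int where o: "orbit Y X" "X 0 = l (Y 0)" "Y N = ystar + m" "\<bar>X N - n - xref\<bar> \<le> \<omega>"
      using N[OF l] unfolding meets_def by blast
    obtain m1 :: int where m1: "of_int i ^ (2*q) * ystar = m1 + ystar" using ystar_even_power by blast
    define m' where "m' = i ^ (2*q) * m + m1"
    have m': "of_int i ^ (2*q) * (m + ystar) = m' + ystar" unfolding distrib_left m1 by (simp add: m'_def)
    obtain Y' X' where o': "orbit Y' X'" "Y' (N + 2*q + h) = of_int i ^ h * m' + (y + k)" "X' 0 = l (Y' 0)"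
      by (rule orbit_from_through)
    have "\<bar>Y' (N + 2*q + h) - of_int i ^ h * (m' + ystar)\<bar> \<le> 1" using o'(2) k by (simp add: algebra_simps)
    from shadow_exact[OF d0 o'(1) this, of 0]
    have Yq: "\<bar>Y' (N + 2*q) - of_int i ^ (2*q) * (m + ystar)\<bar> \<le> 1/2^h" by (simp add: m')
    from shadow_exact[OF d0 o'(1) this, of 0] have "\<bar>Y' N - (m + ystar)\<bar> \<le> 1/2^h / 2^(2*q)" by simp
    also have "\<dots> \<le> 1/2^h" by (simp add: divide_le_eq)
    finally have "12 * (amp*L) * \<bar>Y' N - Y N\<bar> \<le> 12 * (amp*L) * (1/2^h)" using o amp_le by (intro mult_left_mono) auto
    then have 1: "\<bar>X' N - X N\<bar> \<le> 12 * (amp*L) * (1/2^h)" using flat_orbits[OF l o'(1,3) o(1,2), of N] by linarith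
    have Rpow: "of_int i ^ Suc j * (m + ystar) = of_int i * (of_int i ^ j * (m + ystar))" for j by (simp add: mult_ac)
    have 2: "\<bar>X' (N + 2*q) - X' N - real (2*q) * amp\<bar> \<le> 2 * (amp*L) * (1/2^h)"
      using rotation_drift[of _ _ "\<lambda>j. of_int i ^ j * (m + ystar)" "2*q" "1/2^h", OF orbit_shift[OF o'(1), of N] Rpow profile_along_rotation[OF ystar(3)] Yq] d0
      by simp
    have "14 * (amp*L) * (1/2^h) \<le> 1 * (1/2^h)" using amp by (intro mult_right_mono) auto
    then have 3: "\<bar>X' (N + 2*q) - (Xa 0 + (n + z))\<bar> \<le> 1/2^h + 2 * \<omega>" using 1 2 o(4) q by linarith
    note rt = orbit_translate[OF d0 per a(1), of m' "n + z"]
    have Y0: "Y' (N + 2*q + 0) = Ya 0 + of_int i ^ 0 * m'"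
      by (rule base_injective[OF orbit_shift[OF o'(1)] rt, of "N+2*q" h 0]) (use o'(2) a(2) in auto)
    have "\<bar>X' (N + 2*q + h) - (Xa h + of_int (n + z))\<bar> \<le> (5/4)^h * \<bar>X' (N + 2*q + 0) - (Xa 0 + of_int (n + z))\<bar>"
      by (rule vertical_forward[OF orbit_shift[OF o'(1)] rt Y0])
    also have "\<dots> \<le> (5/4)^h * (1/2^h + 2 * \<omega>)" using 3 by (intro mult_left_mono) auto
    also have "\<dots> = ((5/4)*(4/5))^h * (r/2) + (5/8)^h"
      unfolding \<omega>_def power_mult_distrib by (simp add: algebra_simps power_divide flip: power_mult_distrib)
    also have "\<dots> \<le> r" using h r by simp
    finally have "\<bar>X' (N + 2*q + h) - of_int (n + z) - x\<bar> \<le> r" using a(3) by (simp add: algebra_simps)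
    moreover have "Y' (N + 2*q + h) = y + of_int (i^h * m' + k)" using o'(2) by simp
    ultimately show "meets l (N + 2*q + h) y x r" by (rule meetsI[where l = l, OF o'(1,3), rotated])
  qed
qed

end

section \<open>Smoothness of trigonometric maps and their inverses\<close>

lemma frechet_eq: "(f has_derivative f') (at v) \<Longrightarrow> frechet_derivative f (at v) h = f' h"
  using frechet_derivative_at by metis

text \<open>A set of differentiable functions that is closed under partial derivatives consists of smooth functions. The
  smoothness proofs below exhibit such sets.\<close>

lemma smooth_class:
  assumes "\<Phi> \<in> A" and diff: "\<And>\<psi> v. \<psi> \<in> A \<Longrightarrow> \<psi> differentiable (at v)"
    and closed: "\<And>\<psi> b. \<psi> \<in> A \<Longrightarrow> b \<in> Basis \<Longrightarrow> (\<lambda>v. frechet_derivative \<psi> (at v) b) \<in> A"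
  shows "smooth \<Phi>" and "bs \<in> lists Basis \<Longrightarrow> partials bs \<Phi> \<in> A"
proof -
  have *: "partials bs \<Phi> \<in> A" if "bs \<in> lists Basis" for bs
    using that by (induction bs) (use assms in auto)
  then show "bs \<in> lists Basis \<Longrightarrow> partials bs \<Phi> \<in> A" .
  show "smooth \<Phi>" unfolding smooth_def using * diff by blast
qed

lemma smooth_differentiable: "smooth \<Phi> \<Longrightarrow> \<Phi> differentiable (at v)"
  unfolding smooth_def using lists.Nil by (metis partials.simps(1))

lemma smooth_continuous_on: "smooth \<Phi> \<Longrightarrow> continuous_on UNIV \<Phi>"
  by (meson continuous_at_imp_continuous_on differentiable_imp_continuous_within smooth_differentiable)

lemma real_deriv_frechet: "(f has_real_derivative d) (at v) \<Longrightarrow> frechet_derivative f (at v) 1 = d"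
  unfolding has_field_derivative_def using frechet_eq[of f "(*) d" v 1] by simp

lemma smooth_real_class:
  fixes \<Phi> :: "real \<Rightarrow> real"
  assumes "\<Phi> \<in> A" and A: "\<And>\<psi>. \<psi> \<in> A \<Longrightarrow> \<exists>\<psi>'\<in>A. \<forall>v. (\<psi> has_real_derivative \<psi>' v) (at v)"
  shows "smooth \<Phi>"
proof (rule smooth_class(1)[OF assms(1)])
  show "\<psi> differentiable (at v)" if "\<psi> \<in> A" for \<psi> v
    using A[OF that] real_differentiable_def by blast
  show "(\<lambda>v. frechet_derivative \<psi> (at v) b) \<in> A" if "\<psi> \<in> A" "b \<in> Basis" for \<psi> and b :: real
  proof -
    obtain \<psi>' where "\<psi>' \<in> A" "\<forall>v. (\<psi> has_real_derivative \<psi>' v) (at v)" using A[OF \<open>\<psi> \<in> A\<close>] by blast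
    then have "(\<lambda>v. frechet_derivative \<psi> (at v) b) = \<psi>'" using that(2) real_deriv_frechet by auto
    with \<open>\<psi>' \<in> A\<close> show ?thesis by simp
  qed
qed

text \<open>The further generators \<open>W\<close> are for inverse functions, see below.\<close>

inductive_set trig_algebra :: "(real \<Rightarrow> real) set \<Rightarrow> (real \<Rightarrow> real) set" for W where
  const: "(\<lambda>x. c) \<in> trig_algebra W"
| sin: "(\<lambda>x. sin (2*pi*x)) \<in> trig_algebra W"
| cos: "(\<lambda>x. cos (2*pi*x)) \<in> trig_algebra W"
| gen: "w \<in> W \<Longrightarrow> w \<in> trig_algebra W"
| add: "f \<in> trig_algebra W \<Longrightarrow> g \<in> trig_algebra W \<Longrightarrow> (\<lambda>x. f x + g x) \<in> trig_algebra W"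
| mult: "f \<in> trig_algebra W \<Longrightarrow> g \<in> trig_algebra W \<Longrightarrow> (\<lambda>x. f x * g x) \<in> trig_algebra W"

lemma trig_algebra_deriv:
  assumes W: "\<And>w. w \<in> W \<Longrightarrow> \<exists>w'\<in>trig_algebra W. \<forall>x. (w has_real_derivative w' x) (at x)"
    and "f \<in> trig_algebra W"
  shows "\<exists>f'\<in>trig_algebra W. \<forall>x. (f has_real_derivative f' x) (at x)"
  using assms(2)
proof induction
  case (const c)
  show ?case by (rule bexI[of _ "\<lambda>_. 0"]) (auto intro: trig_algebra.const)
next
  case sin
  show ?case by (rule bexI[of _ "\<lambda>x. 2 * pi * cos (2*pi*x)"])
     (auto intro!: derivative_eq_intros trig_algebra.mult trig_algebra.const trig_algebra.cos)
next
  case cos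
  show ?case by (rule bexI[of _ "\<lambda>x. - (2 * pi) * sin (2*pi*x)"])
     (auto intro!: derivative_eq_intros trig_algebra.mult[of "\<lambda>_. - (2*pi)", simplified] trig_algebra.const trig_algebra.sin)
next
  case (gen w) then show ?case by (rule W)
next
  case (add f g)
  then obtain f' g' where "f' \<in> trig_algebra W" "g' \<in> trig_algebra W"
    "\<forall>x. (f has_real_derivative f' x) (at x)" "\<forall>x. (g has_real_derivative g' x) (at x)" by blast
  then show ?case by (intro bexI[of _ "\<lambda>x. f' x + g' x"]) (auto intro!: derivative_eq_intros trig_algebra.add)
next
  case (mult f g)
  then obtain f' g' where "f' \<in> trig_algebra W" "g' \<in> trig_algebra W"
    "\<forall>x. (f has_real_derivative f' x) (at x)" "\<forall>x. (g has_real_derivative g' x) (at x)" by blast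
  then show ?case using mult.hyps
    by (intro bexI[of _ "\<lambda>x. f' x * g x + f x * g' x"])
     (auto intro!: derivative_eq_intros trig_algebra.add trig_algebra.mult)
qed

lemma smooth_linear_plus_trig:
  assumes "f \<in> trig_algebra {}"
  shows "smooth (\<lambda>x. c * x + f x)"
proof (rule smooth_real_class)
  let ?A = "{\<lambda>x. c * x + f x | c f. f \<in> trig_algebra {}}"
  show "(\<lambda>x. c * x + f x) \<in> ?A" using assms by blast
  fix \<psi> assume "\<psi> \<in> ?A"
  then obtain c f where f: "\<psi> = (\<lambda>x. c * x + f x)" "f \<in> trig_algebra {}" by blast
  obtain f' where f': "f' \<in> trig_algebra {}" "\<forall>x. (f has_real_derivative f' x) (at x)"
    using trig_algebra_deriv[OF _ f(2)] by blast
  show "\<exists>\<psi>'\<in>?A. \<forall>v. (\<psi> has_real_derivative \<psi>' v) (at v)"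
  proof (intro bexI[of _ "\<lambda>x. c + f' x"] allI)
    show "(\<psi> has_real_derivative c + f' v) (at v)" for v
      unfolding f using f'(2) by (auto intro!: derivative_eq_intros)
    have "(\<lambda>x. c + f' x) \<in> trig_algebra {}" by (intro trig_algebra.add trig_algebra.const f')
    then show "(\<lambda>x. c + f' x) \<in> ?A"
      unfolding mem_Collect_eq by (intro exI[of _ 0] exI[of _ "\<lambda>x. c + f' x"]) simp
  qed
qed

text \<open>With \<open>w = 1 / H'\<close>, the inverse satisfies \<open>K' = w \<circ> K\<close>, and \<open>w' = - H'' w\<^sup>2\<close>. Hence the functions \<open>g \<circ> K\<close>, with
  \<open>g\<close> in the algebra generated by sine, cosine and \<open>w\<close>, are closed under derivatives.\<close>

lemma smooth_inverse_of_trig: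
  assumes f: "f \<in> trig_algebra {}" and H: "\<And>x. (H has_real_derivative f x) (at x)" and pos: "\<And>x. f x > 0"
    and inv: "\<And>x. K (H x) = x" "\<And>x. H (K x) = x"
  shows "smooth K"
proof -
  define w where "w x = 1 / f x" for x
  let ?T = "trig_algebra {w}"
  have K: "(K has_real_derivative w (K x)) (at x)" for x
    unfolding w_def divide_inverse mult_1
  proof (rule DERIV_inverse_function[where f = H and a = "x - 1" and b = "x + 1"])
    show "DERIV H (K x) :> f (K x)" by (rule H)
    show "f (K x) \<noteq> 0" using pos[of "K x"] by simp
    have "strict_mono H"
    proof (rule strict_monoI)
      fix a c :: real assume "a < c"
      then show "H a < H c"
        by (rule DERIV_pos_imp_increasing) (use H pos in auto)
    qed
    then have "mono K" using inv(2) strict_mono_less_eq[of H "K _" "K _"] by (intro monoI) simp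
    have "surj K" using inv(1) by (rule surjI)
    then have "continuous_on UNIV K"
      using \<open>mono K\<close> by (intro continuous_onI_mono) (auto simp: mono_def)
    then show "isCont K x" by (simp add: continuous_on_eq_continuous_at)
  qed (use inv in auto)
  have sub: "g \<in> trig_algebra {} \<Longrightarrow> g \<in> ?T" for g
    by (induction rule: trig_algebra.induct) (auto intro: trig_algebra.intros)
  obtain f' where f': "f' \<in> trig_algebra {}" "\<forall>x. (f has_real_derivative f' x) (at x)"
    using trig_algebra_deriv[OF _ f] by blast
  have w: "\<exists>w'\<in>?T. \<forall>x. (w has_real_derivative w' x) (at x)"
  proof (intro bexI[of _ "\<lambda>x. (-1) * (f' x * (w x * w x))"] allI)
    show "(w has_real_derivative (-1) * (f' x * (w x * w x))) (at x)" for x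
      unfolding w_def using f'(2) pos[of x] by (auto intro!: derivative_eq_intros simp: field_simps)
    show "(\<lambda>x. (-1) * (f' x * (w x * w x))) \<in> ?T"
      by (intro trig_algebra.mult trig_algebra.const sub f' trig_algebra.gen) auto
  qed
  show "smooth K"
  proof (rule smooth_real_class[where A = "insert K {\<lambda>x. g (K x) | g. g \<in> ?T}"])
    fix \<psi> assume "\<psi> \<in> insert K {\<lambda>x. g (K x) | g. g \<in> ?T}"
    then consider "\<psi> = K" | g where "\<psi> = (\<lambda>x. g (K x))" "g \<in> ?T" by blast
    then show "\<exists>\<psi>'\<in>insert K {\<lambda>x. g (K x) | g. g \<in> ?T}. \<forall>v. (\<psi> has_real_derivative \<psi>' v) (at v)"
    proof cases
      case 1
      have "w \<in> ?T" by (intro trig_algebra.gen) simp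
      then have "(\<lambda>x. w (K x)) \<in> {\<lambda>x. g (K x) | g. g \<in> ?T}" by blast
      then show ?thesis unfolding 1 by (intro bexI[of _ "\<lambda>x. w (K x)"] allI K) simp
    next
      case 2
      obtain g' where g': "g' \<in> ?T" "\<forall>x. (g has_real_derivative g' x) (at x)"
        using trig_algebra_deriv[OF _ 2(2)] w by blast
      have "(\<psi> has_real_derivative (g' (K x) * w (K x))) (at x)" for x
        unfolding 2 using g'(2) K by (intro DERIV_chain2) auto
      moreover have T: "(\<lambda>x. g' x * w x) \<in> ?T" by (rule trig_algebra.mult[OF g'(1) trig_algebra.gen]) simp
      then have "(\<lambda>x. g' (K x) * w (K x)) \<in> {\<lambda>x. g (K x) | g. g \<in> ?T}"
        unfolding mem_Collect_eq by (intro exI[of _ "\<lambda>x. g' x * w x"]) simp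
      ultimately show ?thesis by (intro bexI[of _ "\<lambda>x. g' (K x) * w (K x)"]) auto
    qed
  qed simp
qed

inductive_set trig2 :: "(real \<times> real \<Rightarrow> real) set" where
  const: "(\<lambda>v. c) \<in> trig2"
| sin_fst: "(\<lambda>v. sin (2*pi * fst v)) \<in> trig2"
| cos_fst: "(\<lambda>v. cos (2*pi * fst v)) \<in> trig2"
| sin_snd: "(\<lambda>v. sin (2*pi * snd v)) \<in> trig2"
| cos_snd: "(\<lambda>v. cos (2*pi * snd v)) \<in> trig2"
| add: "f \<in> trig2 \<Longrightarrow> g \<in> trig2 \<Longrightarrow> (\<lambda>v. f v + g v) \<in> trig2"
| mult: "f \<in> trig2 \<Longrightarrow> g \<in> trig2 \<Longrightarrow> (\<lambda>v. f v * g v) \<in> trig2"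

lemma trig2_bounded: "f \<in> trig2 \<Longrightarrow> \<exists>B. \<forall>v. \<bar>f v\<bar> \<le> B"
proof (induction rule: trig2.induct)
  case (add f g)
  then obtain B C where "\<And>v. \<bar>f v\<bar> \<le> B" "\<And>v. \<bar>g v\<bar> \<le> C" by blast
  then have "\<bar>f v + g v\<bar> \<le> B + C" for v by (intro order_trans[OF abs_triangle_ineq add_mono])
  then show ?case by blast
next
  case (mult f g)
  then obtain B C where B: "\<And>v. \<bar>f v\<bar> \<le> B" "\<And>v. \<bar>g v\<bar> \<le> C" by blast
  have "0 \<le> B" using B(1)[of 0] by linarith
  then have "\<bar>f v * g v\<bar> \<le> B * C" for v unfolding abs_mult using B by (intro mult_mono) auto
  then show ?case by blast
qed (auto intro: exI[of _ 1])

lemma trig2_deriv: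
  "f \<in> trig2 \<Longrightarrow> \<exists>f1\<in>trig2. \<exists>f2\<in>trig2. \<forall>v. (f has_derivative (\<lambda>h. fst h * f1 v + snd h * f2 v)) (at v)"
proof (induction rule: trig2.induct)
  case (const c)
  show ?case by (intro bexI[of _ "\<lambda>_. 0"]) (auto intro: trig2.const)
next
  case sin_fst
  show ?case by (intro bexI[of _ "\<lambda>_. 0"] bexI[of _ "\<lambda>v. 2*pi * cos (2*pi * fst v)"])
    (auto intro!: derivative_eq_intros trig2.intros)
next
  case cos_fst
  show ?case by (intro bexI[of _ "\<lambda>_. 0"] bexI[of _ "\<lambda>v. (- 2*pi) * sin (2*pi * fst v)"] trig2.mult trig2.const trig2.sin_fst)
    (auto intro!: derivative_eq_intros)
next
  case sin_snd
  show ?case by (intro bexI[of _ "\<lambda>_. 0"] bexI[of _ "\<lambda>v. 2*pi * cos (2*pi * snd v)"] trig2.mult trig2.const trig2.cos_snd)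
    (auto intro!: derivative_eq_intros)
next
  case cos_snd
  show ?case by (intro bexI[of _ "\<lambda>_. 0"] bexI[of _ "\<lambda>v. (- 2*pi) * sin (2*pi * snd v)"] trig2.mult trig2.const trig2.sin_snd)
    (auto intro!: derivative_eq_intros)
next
  case (add f g)
  then obtain f1 f2 g1 g2 where m: "f1 \<in> trig2" "f2 \<in> trig2" "g1 \<in> trig2" "g2 \<in> trig2" and
    d: "\<And>v. (f has_derivative (\<lambda>h. fst h * f1 v + snd h * f2 v)) (at v)"
    "\<And>v. (g has_derivative (\<lambda>h. fst h * g1 v + snd h * g2 v)) (at v)" by blast
  have "((\<lambda>v. f v + g v) has_derivative (\<lambda>h. fst h * (f1 v + g1 v) + snd h * (f2 v + g2 v))) (at v)" for v
    by (rule derivative_eq_intros d refl | simp add: algebra_simps)+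
  then show ?case
    by (intro bexI[of _ "\<lambda>v. f2 v + g2 v"] bexI[of _ "\<lambda>v. f1 v + g1 v"] allI) (auto intro: trig2.add m)
next
  case (mult f g)
  then obtain f1 f2 g1 g2 where m: "f1 \<in> trig2" "f2 \<in> trig2" "g1 \<in> trig2" "g2 \<in> trig2" and
    d: "\<And>v. (f has_derivative (\<lambda>h. fst h * f1 v + snd h * f2 v)) (at v)"
    "\<And>v. (g has_derivative (\<lambda>h. fst h * g1 v + snd h * g2 v)) (at v)" by blast
  have "((\<lambda>v. f v * g v) has_derivative (\<lambda>h. fst h * (f v * g1 v + f1 v * g v) + snd h * (f v * g2 v + f2 v * g v))) (at v)" for v
    by (rule derivative_eq_intros d refl | simp add: algebra_simps)+
  then show ?case
    by (intro bexI[of _ "\<lambda>v. f v * g2 v + f2 v * g v"] bexI[of _ "\<lambda>v. f v * g1 v + f1 v * g v"] allI)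
       (auto intro!: trig2.add trig2.mult m mult.hyps)
qed

definition trig_pairs :: "(real \<times> real \<Rightarrow> real \<times> real) set" where
  "trig_pairs = {\<lambda>v. (f v, g v) | f g. f \<in> trig2 \<and> g \<in> trig2}"

lemma trig_pairsI: "f \<in> trig2 \<Longrightarrow> g \<in> trig2 \<Longrightarrow> (\<lambda>v. (f v, g v)) \<in> trig_pairs"
  unfolding trig_pairs_def by blast

lemma trig2_scale: "f \<in> trig2 \<Longrightarrow> (\<lambda>v. c * f v) \<in> trig2"
  by (intro trig2.mult trig2.const)

lemma trig_pairs_deriv:
  assumes "\<psi> \<in> trig_pairs"
  shows "\<psi> differentiable (at v)" "(\<lambda>v. frechet_derivative \<psi> (at v) b) \<in> trig_pairs"
proof -
  obtain f g where \<psi>: "\<psi> = (\<lambda>v. (f v, g v))" "f \<in> trig2" "g \<in> trig2"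
    using assms unfolding trig_pairs_def by blast
  obtain f1 f2 g1 g2 where m: "f1 \<in> trig2" "f2 \<in> trig2" "g1 \<in> trig2" "g2 \<in> trig2" and
    d: "\<And>v. (f has_derivative (\<lambda>h. fst h * f1 v + snd h * f2 v)) (at v)"
    "\<And>v. (g has_derivative (\<lambda>h. fst h * g1 v + snd h * g2 v)) (at v)"
    using trig2_deriv[OF \<psi>(2)] trig2_deriv[OF \<psi>(3)] by blast
  have D: "(\<psi> has_derivative (\<lambda>h. (fst h * f1 v + snd h * f2 v, fst h * g1 v + snd h * g2 v))) (at v)" for v
    unfolding \<psi> by (rule has_derivative_Pair[OF d])
  then show "\<psi> differentiable (at v)" unfolding differentiable_def by blast
  have "(\<lambda>v. frechet_derivative \<psi> (at v) b) = (\<lambda>v. (fst b * f1 v + snd b * f2 v, fst b * g1 v + snd b * g2 v))"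
    using frechet_eq[OF D] by auto
  also have "\<dots> \<in> trig_pairs" by (intro trig_pairsI trig2.add trig2_scale m)
  finally show "(\<lambda>v. frechet_derivative \<psi> (at v) b) \<in> trig_pairs" .
qed

lemma trig_pairs_smooth: "\<psi> \<in> trig_pairs \<Longrightarrow> smooth \<psi>"
  by (rule smooth_class(1)[of \<psi> trig_pairs]) (auto intro: trig_pairs_deriv)

lemma trig_pairs_partials: "\<psi> \<in> trig_pairs \<Longrightarrow> bs \<in> lists Basis \<Longrightarrow> partials bs \<psi> \<in> trig_pairs"
  by (rule smooth_class(2)[of \<psi> trig_pairs]) (auto intro: trig_pairs_deriv)

lemma diagonal_smooth: "smooth (\<lambda>v::real \<times> real. (c * fst v, d * snd v))"
proof (rule smooth_class(1)[where A = "insert (\<lambda>v. (c * fst v, d * snd v)) trig_pairs"])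
  have D: "((\<lambda>v::real \<times> real. (c * fst v, d * snd v)) has_derivative (\<lambda>v. (c * fst v, d * snd v))) (at v)" for v
    by (rule derivative_eq_intros refl | simp)+
  fix \<psi> :: "real \<times> real \<Rightarrow> real \<times> real" assume \<psi>: "\<psi> \<in> insert (\<lambda>v. (c * fst v, d * snd v)) trig_pairs"
  then show "\<psi> differentiable (at v)" for v using D trig_pairs_deriv(1) unfolding differentiable_def by blast
  fix b :: "real \<times> real"
  have "(\<lambda>v::real \<times> real. (c * fst b, d * snd b)) \<in> trig_pairs" by (intro trig_pairsI trig2.const)
  then show "(\<lambda>v. frechet_derivative \<psi> (at v) b) \<in> insert (\<lambda>v. (c * fst v, d * snd v)) trig_pairs"
    using \<psi> trig_pairs_deriv(2)[of \<psi> b] by (elim insertE) (simp_all add: frechet_eq[OF D])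
qed simp

lemma partials_perturb:
  assumes "smooth \<Phi>" "smooth \<Psi>" "bs \<in> lists Basis"
  shows "partials bs (\<lambda>v. \<Phi> v + c *\<^sub>R \<Psi> v) = (\<lambda>v. partials bs \<Phi> v + c *\<^sub>R partials bs \<Psi> v)"
  using assms(3)
proof (induction bs)
  case (Cons b bs)
  then have IH: "partials bs (\<lambda>v. \<Phi> v + c *\<^sub>R \<Psi> v) = (\<lambda>v. partials bs \<Phi> v + c *\<^sub>R partials bs \<Psi> v)" by simp
  have bs: "bs \<in> lists Basis" using Cons by simp
  show ?case
  proof
    fix v
    have "((\<lambda>v. partials bs \<Phi> v + c *\<^sub>R partials bs \<Psi> v) has_derivative
      (\<lambda>h. frechet_derivative (partials bs \<Phi>) (at v) h + c *\<^sub>R frechet_derivative (partials bs \<Psi>) (at v) h)) (at v)"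
      using assms(1,2) bs unfolding smooth_def
      by (intro has_derivative_add has_derivative_scaleR_right) (auto simp: frechet_derivative_works[symmetric])
    from frechet_eq[OF this] show "partials (b # bs) (\<lambda>v. \<Phi> v + c *\<^sub>R \<Psi> v) v = partials (b # bs) \<Phi> v + c *\<^sub>R partials (b # bs) \<Psi> v"
      by (simp add: IH)
  qed
qed simp

lemma smooth_perturb:
  assumes "smooth \<Phi>" "smooth \<Psi>" shows "smooth (\<lambda>v. \<Phi> v + c *\<^sub>R \<Psi> v)"
  unfolding smooth_def
proof (intro ballI allI)
  fix bs :: "'a list" and v assume "bs \<in> lists Basis"
  then show "partials bs (\<lambda>v. \<Phi> v + c *\<^sub>R \<Psi> v) differentiable (at v)"
    unfolding partials_perturb[OF assms \<open>bs \<in> lists Basis\<close>] using assms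
    by (intro differentiable_add differentiable_scaleR) (auto simp: smooth_def)
qed

lemma trig_pairs_bounded: "\<psi> \<in> trig_pairs \<Longrightarrow> \<exists>B. \<forall>v. norm (\<psi> v) \<le> B"
proof -
  assume "\<psi> \<in> trig_pairs"
  then obtain f g where fg: "\<psi> = (\<lambda>v. (f v, g v))" "f \<in> trig2" "g \<in> trig2" unfolding trig_pairs_def by blast
  obtain B C where "\<And>v. \<bar>f v\<bar> \<le> B" "\<And>v. \<bar>g v\<bar> \<le> C" using trig2_bounded[OF fg(2)] trig2_bounded[OF fg(3)] by blast
  then have "norm (f v, g v) \<le> B + C" for v by (intro order_trans[OF norm_Pair_le add_mono]) simp_all
  then show ?thesis unfolding fg by blast
qed

text \<open>There are only finitely many partial derivatives up to a given order, so a common bound exists; it makes a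
  small multiple of such a map small in the \<open>C\<^sup>r\<close> topology.\<close>

lemma trig_pairs_partials_bounded:
  assumes "\<psi> \<in> trig_pairs"
  shows "\<exists>B. \<forall>bs\<in>lists Basis. length bs \<le> r \<longrightarrow> (\<forall>v. norm (partials bs \<psi> v) \<le> B)"
proof -
  let ?S = "{bs. set bs \<subseteq> (Basis :: (real\<times>real) set) \<and> length bs \<le> r}"
  have fin: "finite ?S" by (rule finite_lists_length_le) simp
  have "\<forall>bs\<in>?S. \<exists>B. \<forall>v. norm (partials bs \<psi> v) \<le> B"
    using trig_pairs_bounded[OF trig_pairs_partials[OF assms]] by (auto simp: in_lists_conv_set)
  then obtain B where B: "\<forall>bs\<in>?S. \<forall>v. norm (partials bs \<psi> v) \<le> B bs"
    by (rule bchoice[THEN exE])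
  show ?thesis
  proof (intro exI[of _ "Max (B ` ?S)"] ballI impI allI)
    fix bs :: "(real\<times>real) list" and v assume "bs \<in> lists Basis" "length bs \<le> r"
    then have S: "bs \<in> ?S" by auto
    then have "norm (partials bs \<psi> v) \<le> B bs" using B by blast
    also have "\<dots> \<le> Max (B ` ?S)" using fin S by (intro Max_ge) auto
    finally show "norm (partials bs \<psi> v) \<le> Max (B ` ?S)" .
  qed
qed

section \<open>The circle and lifts\<close>

lemma to_circle_rep: "to_circle (rep_circle x) = x"
  by (rule Quotient3_abs_rep[OF Quotient3_circle])

lemma to_circle_surj: obtains t where "x = to_circle t"
  using to_circle_rep by metis

lemma to_circle_add_int [simp]: "to_circle (t + of_int n) = to_circle t"
  by (simp add: to_circle_eq_iff)

lemma dist_to_circle: "dist (to_circle s) (to_circle t) = dist_int (s - t)"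
  by (rule dist_circle.abs_eq)

lemma dist_to_circle_le: "dist (to_circle s) (to_circle t) \<le> \<bar>s - t\<bar>"
  using dist_int_le[of "s-t" 0] by (simp add: dist_to_circle)

lemma dist_to_circle_lt:
  assumes "dist (to_circle s) (to_circle t) < r"
  obtains n :: int where "\<bar>s - t - n\<bar> < r"
  using assms unfolding dist_to_circle dist_int_def by blast

lemma to_torus_pair [simp]: "to_torus (Y, X) = (to_circle Y, to_circle X)"
  by (simp add: to_torus_def)

lemma to_torus_surj: obtains Y X where "p = to_torus (Y, X)"
  by (metis to_circle_rep to_torus_pair surj_pair)

lemma dist_pair_le: "dist (a, b) (c, d) \<le> dist a c + dist b d"
  unfolding dist_Pair_Pair by (rule sqrt_sum_squares_le_sum) auto

lemma dist_fst_snd_le: "dist (fst p) (fst q) \<le> dist p q" "dist (snd p) (snd q) \<le> dist p q"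
  by (rule dist_fst_le, rule dist_snd_le)

lemma continuous_to_circle: "continuous_on UNIV to_circle"
  unfolding continuous_on_iff using dist_to_circle_le
  by (metis dist_real_def order_le_less_trans)

lemma continuous_to_torus: "continuous_on UNIV to_torus"
  unfolding to_torus_def map_prod_def case_prod_beta
  by (intro continuous_intros continuous_on_compose2[OF continuous_to_circle]) auto

text \<open>Nearby points of the torus have nearby lifts.\<close>

lemma lift_continuous_torus:
  assumes \<Phi>: "continuous_on UNIV \<Phi>" and lift: "\<And>v. h (to_torus v) = to_torus (\<Phi> v)"
  shows "continuous_on UNIV h"
  unfolding continuous_on_iff
proof (intro ballI allI impI)
  fix p and \<epsilon> :: real assume "0 < \<epsilon>"
  obtain Y X where p: "p = to_torus (Y, X)" by (rule to_torus_surj)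
  have "continuous_on UNIV (\<lambda>v. to_torus (\<Phi> v))"
    by (rule continuous_on_compose2[OF continuous_to_torus \<Phi>]) auto
  then obtain d where d: "d > 0" "\<And>v. dist v (Y, X) < d \<Longrightarrow> dist (to_torus (\<Phi> v)) (to_torus (\<Phi> (Y, X))) < \<epsilon>"
    using \<open>0 < \<epsilon>\<close> unfolding continuous_on_iff by (metis UNIV_I)
  show "\<exists>d>0. \<forall>q\<in>UNIV. dist q p < d \<longrightarrow> dist (h q) (h p) < \<epsilon>"
  proof (intro exI[of _ "d/2"] conjI ballI impI)
    fix q assume q: "dist q p < d/2"
    obtain Y1 X1 where q1: "q = to_torus (Y1, X1)" by (rule to_torus_surj)
    have "dist (to_circle Y1) (to_circle Y) < d/2" "dist (to_circle X1) (to_circle X) < d/2"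
      using q dist_fst_snd_le[of q p] by (auto simp: q1 p)
    then obtain m n :: int where mn: "\<bar>Y1 - Y - m\<bar> < d/2" "\<bar>X1 - X - n\<bar> < d/2" using dist_to_circle_lt by metis
    have q2: "q = to_torus (Y1 - m, X1 - n)"
      using to_circle_add_int[of "Y1 - m" m] to_circle_add_int[of "X1 - n" n] by (simp add: q1)
    have "dist (Y1 - m, X1 - n) (Y, X) < d"
      using mn dist_pair_le[of "Y1 - m" "X1 - n" Y X] by (simp add: dist_real_def algebra_simps)
    then show "dist (h q) (h p) < \<epsilon>" unfolding q2 p lift using d(2) by blast
  qed (use d in auto)
qed

text \<open>A continuous function whose values are near integers stays near one of them; for lifts this
  means that they can be normalised by one integer translation.\<close>

lemma continuous_int_valued_constant:
  fixes D :: "'a::real_normed_vector \<Rightarrow> real"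
  assumes c: "continuous_on UNIV D" and near: "\<And>v. \<exists>n::int. \<bar>D v - n\<bar> < r" and r: "r \<le> 1/4"
  obtains n :: int where "\<And>v. \<bar>D v - n\<bar> < r"
proof -
  obtain n :: int where n: "\<bar>D 0 - n\<bar> < r" using near by blast
  have "\<bar>D v - n\<bar> < r" for v
  proof (rule ccontr)
    assume ne: "\<not> \<bar>D v - n\<bar> < r"
    obtain m :: int where m: "\<bar>D v - m\<bar> < r" using near by blast
    have "m \<noteq> n" using m ne by blast
    then have "of_int m + 1 \<le> real_of_int n \<or> of_int n + 1 \<le> real_of_int m" by linarith
    then have cross: "(D v \<le> n - 1/2 \<and> n - 1/2 \<le> D 0) \<or> (D 0 \<le> n + 1/2 \<and> n + 1/2 \<le> D v)"
      using m n r by linarith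
    have conn: "connected (range D)" using c connected_continuous_image by blast
    have "real_of_int n - 1/2 \<in> range D \<or> real_of_int n + 1/2 \<in> range D"
      using cross connectedD_interval[OF conn, of "D v" "D 0" "n - 1/2"] connectedD_interval[OF conn, of "D 0" "D v" "n + 1/2"] by auto
    then obtain w where "D w = n - 1/2 \<or> D w = n + 1/2" by fastforce
    moreover obtain k :: int where "\<bar>D w - k\<bar> < r" using near by blast
    ultimately have "\<bar>real_of_int n - 1/2 - k\<bar> < 1/4 \<or> \<bar>real_of_int n + 1/2 - k\<bar> < 1/4" using r by auto
    then have "\<bar>real_of_int (2 * (n - k) - 1)\<bar> < 1 \<or> \<bar>real_of_int (2 * (n - k) + 1)\<bar> < 1"
      unfolding of_int_add of_int_diff of_int_mult of_int_numeral of_int_1 by argo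
    then have "\<bar>2 * (n - k) - 1\<bar> < 1 \<or> \<bar>2 * (n - k) + 1\<bar> < 1" by linarith
    then show False by presburger
  qed
  then show ?thesis using that by blast
qed

lemma continuous_int_constant:
  fixes D :: "'a::real_normed_vector \<Rightarrow> real"
  assumes "continuous_on UNIV D" and int: "\<And>v. D v \<in> \<int>"
  obtains n :: int where "\<And>v. D v = n"
proof -
  have "\<exists>n::int. \<bar>D v - n\<bar> < 1/4" for v
  proof -
    obtain k :: int where "D v = k" using int[of v] by (rule Ints_cases)
    then show ?thesis by (intro exI[of _ k]) simp
  qed
  then obtain n :: int where n: "\<And>v. \<bar>D v - n\<bar> < 1/4" using continuous_int_valued_constant[OF assms(1), of "1/4"] by auto
  have "D v = n" for v
  proof -
    obtain k :: int where "D v = k" using int[of v] by (auto elim: Ints_cases)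
    then have "\<bar>real_of_int k - real_of_int n\<bar> < 1" using n[of v] by simp
    then have "k = n" by linarith
    then show ?thesis using \<open>D v = k\<close> by simp
  qed
  then show ?thesis using that by blast
qed

text \<open>Two lifts of a map differ by a constant, so the choices in the definition of the derivative do not matter.\<close>

lemma circle_deriv_eq:
  fixes H :: "real \<Rightarrow> real"
  assumes lift: "smooth_lift to_circle h H" and d: "(H has_real_derivative d) (at t)"
    and cont: "\<And>H :: real \<Rightarrow> real. smooth H \<Longrightarrow> continuous_on UNIV H"
  shows "circle_deriv h (to_circle t) = d"
  unfolding circle_deriv_def
proof (rule the_equality)
  show "\<exists>H s. smooth_lift to_circle h H \<and> to_circle s = to_circle t \<and> (H has_real_derivative d) (at s)"
    using assms by blast
  fix d' assume "\<exists>H s. smooth_lift to_circle h H \<and> to_circle s = to_circle t \<and> (H has_real_derivative d') (at s)"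
  then obtain H' s where H': "smooth_lift to_circle h H'" "to_circle s = to_circle t" "(H' has_real_derivative d') (at s)" by blast
  have "s - t \<in> \<int>" using H'(2) by (simp add: to_circle_eq_iff)
  then obtain n :: int where "s - t = of_int n" by (rule Ints_cases)
  then have n: "s = t + n" by simp
  have c: "continuous_on UNIV H" "continuous_on UNIV H'" using lift H' cont by (auto simp: smooth_lift_def)
  have D1: "H' (u + n) - H u \<in> \<int>" for u :: real
  proof -
    have "to_circle (H' (u + n)) = h (to_circle (u + n))" using H'(1) unfolding smooth_lift_def by metis
    also have "\<dots> = to_circle (H u)" using lift unfolding smooth_lift_def by simp
    finally show ?thesis by (simp add: to_circle_eq_iff)
  qed
  have D2: "continuous_on UNIV (\<lambda>u::real. H' (u + n) - H u)"
    by (intro continuous_intros c continuous_on_compose2[OF c(2)]) auto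
  obtain k :: int where k: "\<And>u::real. H' (u + n) - H u = k" using continuous_int_constant[OF D2 D1] by blast
  have "H' (u + n) = H u + k" for u :: real using k[of u] by simp
  then have eq: "(\<lambda>u::real. H' (u + n)) = (\<lambda>u. H u + k)" by blast
  have 1: "((\<lambda>u::real. H' (u + n)) has_real_derivative d') (at t)"
    using H'(3) unfolding n by (simp add: DERIV_shift)
  have 2: "((\<lambda>u. H u + k) has_real_derivative d) (at t)" using d by (auto intro!: derivative_eq_intros)
  show "d' = d" by (rule DERIV_unique[OF 1[unfolded eq] 2])
qed

section \<open>The family\<close>

text \<open>Normalised to be \<open>0\<close> at the integers and \<open>1\<close> at \<open>\<plusminus>1/(i+1)\<close>.\<close>

definition profile :: "int \<Rightarrow> real \<Rightarrow> real" where
  "profile i Y = (1 - cos (2*pi*Y)) / (1 - cos (2 * pi * (1 / (of_int i + 1))))"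

text \<open>Both a Lipschitz constant and a bound of the profile.\<close>

definition profile_bound :: "int \<Rightarrow> real" where
  "profile_bound i = 8 / (1 - cos (2 * pi * (1 / (of_int i + 1))))"

definition fibre :: "real \<Rightarrow> int \<Rightarrow> real \<Rightarrow> real \<Rightarrow> real" where
  "fibre amp i Y X = X + amp * (sin (2*pi*X) + profile i Y * (1 - sin (2*pi*X)))"

definition circle_fibre :: "real \<Rightarrow> int \<Rightarrow> circle \<Rightarrow> circle \<Rightarrow> circle" where
  "circle_fibre amp i y x = to_circle (fibre amp i (rep_circle y) (rep_circle x))"

lemma cos_2pi_add_int: "cos (2*pi*(x + of_int n)) = cos (2*pi*x)"
  using cos_add[of "2*pi*x" "2*pi * of_int n"] sin_int_2pin[of n] cos_int_2pin[of n]
  by (simp add: algebra_simps)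

lemma profile_periodic: "profile i (Y + of_int n) = profile i Y"
  by (simp add: profile_def cos_2pi_add_int)

lemma profile_denominator:
  assumes "i > 1" shows "0 < 1 - cos (2 * pi * (1 / (real_of_int i + 1)))" "1 - cos (2 * pi * (1 / (real_of_int i + 1))) \<le> 2"
proof -
  have "1 / (real_of_int i + 1) \<le> 1/2" using assms by (intro divide_left_mono) auto
  then have "2 * pi * (1 / (real_of_int i + 1)) \<le> 2 * pi * (1/2)" by (intro mult_left_mono) auto
  moreover have "0 < 2 * pi * (1 / (real_of_int i + 1))" using assms by simp
  ultimately have "cos (2 * pi * (1 / (real_of_int i + 1))) < cos 0" by (intro cos_monotone_0_pi) auto
  then show "0 < 1 - cos (2 * pi * (1 / (real_of_int i + 1)))" by simp
  show "1 - cos (2 * pi * (1 / (real_of_int i + 1))) \<le> 2" using cos_ge_minus_one[of "2 * pi * (1 / (real_of_int i + 1))"] by linarith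
qed

lemma family_skew_lift:
  assumes i: "i > 1" and amp: "0 < amp" "1000 * (amp * profile_bound i) \<le> 1"
    and d: "0 \<le> err" "err \<le> amp" "\<And>Y. \<bar>e Y\<bar> \<le> err" "\<And>Y Y'. \<bar>e Y - e Y'\<bar> \<le> err * \<bar>Y - Y'\<bar>"
    "\<And>Y X. \<bar>E Y X\<bar> \<le> err" "\<And>Y X Y' X'. \<bar>E Y X - E Y' X'\<bar> \<le> err * (\<bar>Y - Y'\<bar> + \<bar>X - X'\<bar>)"
  shows "skew_lift i (profile i) (profile_bound i) amp err e E"
proof
  define c where "c = 1 - cos (2 * pi * (1 / (real_of_int i + 1)))"
  have c: "0 < c" "c \<le> 2" using profile_denominator[OF i] by (auto simp: c_def)
  have p: "profile i Y = (1 - cos (2*pi*Y)) / c" for Y by (simp add: profile_def c_def)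
  have L: "profile_bound i = 8 / c" by (simp add: profile_bound_def c_def)
  show "1 \<le> profile_bound i" unfolding L using c by simp
  show "\<bar>profile i Y - profile i Y'\<bar> \<le> profile_bound i * \<bar>Y - Y'\<bar>" for Y Y'
  proof -
    have cs: "cos (2*pi*Y) = sin (2*pi*(Y + 1/4))" for Y
    proof -
      have "2*pi*(Y + 1/4) = 2*pi*Y + pi/2" by (simp add: field_simps)
      then show ?thesis by (simp only: sin_add sin_pi_half cos_pi_half mult_zero_right mult_1_right add_0_left)
    qed
    have "profile i Y - profile i Y' = - (cos (2*pi*Y) - cos (2*pi*Y')) / c" by (simp add: p diff_divide_distrib[symmetric])
    moreover have "\<bar>cos (2*pi*Y) - cos (2*pi*Y')\<bar> \<le> 8 * \<bar>Y - Y'\<bar>"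
      unfolding cs using sin_2pi_lipschitz[of "Y+1/4" "Y'+1/4"] by simp
    ultimately show ?thesis unfolding L using c by (simp add: abs_divide divide_right_mono)
  qed
  show "\<bar>profile i Y\<bar> \<le> profile_bound i" for Y
  proof -
    have "\<bar>1 - cos (2*pi*Y)\<bar> \<le> 8" using cos_ge_minus_one[of "2*pi*Y"] cos_le_one[of "2*pi*Y"] by linarith
    then show ?thesis unfolding p L abs_divide using c by (simp add: divide_right_mono)
  qed
  show "profile i (of_int n) = 0" for n using cos_2pi_add_int[of 0 n] by (simp add: p)
  show "profile i R = 1" if "rot_point i R" for R
  proof -
    obtain n :: int where "R = 1/(of_int i+1) + n \<or> R = - (1/(of_int i+1)) + n" using \<open>rot_point i R\<close>
      unfolding rot_point_def by (auto simp: add.commute)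
    then have "cos (2*pi*R) = cos (2*pi*(1/(of_int i+1)))"
      using cos_2pi_add_int[of "1/(of_int i+1)" n] cos_2pi_add_int[of "-(1/(of_int i+1))" n] cos_minus[of "2*pi*(1/(of_int i+1))"]
      by (elim disjE) simp_all
    then show ?thesis using c unfolding p c_def by simp
  qed
qed (use assms in auto)

text \<open>The lift of the map is the linear one plus a small multiple of this.\<close>

definition displacement :: "int \<Rightarrow> real \<times> real \<Rightarrow> real \<times> real" where
  "displacement i v = (0, sin (2*pi * snd v) + profile i (fst v) * (1 - sin (2*pi * snd v)))"

lemma displacement_trig: "displacement i \<in> trig_pairs"
proof -
  define c where "c = 1 / (1 - cos (2 * pi * (1 / (real_of_int i + 1))))"
  have "(\<lambda>v. (0, sin (2*pi * snd v) + (c * (1 + (-1) * cos (2*pi * fst v))) * (1 + (-1) * sin (2*pi * snd v)))) \<in> trig_pairs"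
    by (intro trig_pairsI trig2.add trig2.mult trig2.const trig2.sin_snd trig2.cos_fst)
  moreover have "displacement i = (\<lambda>v. (0, sin (2*pi * snd v) + (c * (1 + (-1) * cos (2*pi * fst v))) * (1 + (-1) * sin (2*pi * snd v))))"
    by (intro ext) (simp add: displacement_def profile_def c_def)
  ultimately show ?thesis by simp
qed

locale north_south_family =
  fixes i :: int and amp :: real
  assumes i: "i > 1" and amp: "0 < amp" "1000 * (amp * profile_bound i) \<le> 1"
begin

sublocale lift: skew_lift i "profile i" "profile_bound i" amp 0 "\<lambda>_. 0" "\<lambda>_ _. 0"
  by (rule family_skew_lift) (use i amp in auto)

lemma lift_H: "lift.H = fibre amp i" by (intro ext) (simp add: lift.H_def fibre_def)
lemma lift_G: "lift.G Y = of_int i * Y" by (simp add: lift.G_def)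

lemma fibre_int: "fibre amp i (Y + of_int m) (X + of_int n) = fibre amp i Y X + of_int n"
  unfolding fibre_def sin_2pi_add_int profile_periodic by simp

lemma circle_fibre_to_circle: "circle_fibre amp i (to_circle Y) (to_circle X) = to_circle (fibre amp i Y X)"
proof -
  have "rep_circle (to_circle t) - t \<in> \<int>" for t using to_circle_rep[of "to_circle t"] by (simp add: to_circle_eq_iff)
  then obtain m n :: int where mn: "rep_circle (to_circle Y) - Y = m" "rep_circle (to_circle X) - X = n" by (metis Ints_cases)
  have "rep_circle (to_circle Y) = Y + m" "rep_circle (to_circle X) = X + n" using mn by linarith+
  then show ?thesis unfolding circle_fibre_def by (simp add: fibre_int)
qed

definition family_lift :: "real \<times> real \<Rightarrow> real \<times> real" where
  "family_lift v = (of_int i * fst v, fibre amp i (fst v) (snd v))"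

lemma circle_mult_to_circle: "circle_mult i (to_circle Y) = to_circle (of_int i * Y)"
  by (rule circle_mult.abs_eq)

lemma family_lift_lifts: "skew_map (circle_mult i) (circle_fibre amp i) (to_torus v) = to_torus (family_lift v)"
  by (cases v) (simp add: skew_map_def family_lift_def circle_fibre_to_circle circle_mult_to_circle)

lemma family_lift_eq: "family_lift = (\<lambda>v. (of_int i * fst v, 1 * snd v) + amp *\<^sub>R displacement i v)"
  by (intro ext) (simp add: family_lift_def fibre_def displacement_def)

lemma family_lift_smooth: "smooth family_lift"
  unfolding family_lift_eq by (intro smooth_perturb diagonal_smooth trig_pairs_smooth displacement_trig)

lemma fibre_deriv: "(fibre amp i Y has_real_derivative 1 + amp * ((1 - profile i Y) * (2 * pi * cos (2*pi*X)))) (at X)"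
  unfolding fibre_def by (auto intro!: derivative_eq_intros simp: algebra_simps)

lemma fibre_deriv_bounds: "\<bar>amp * ((1 - profile i Y) * (2 * pi * cos (2*pi*X)))\<bar> \<le> 1/10"
proof -
  have "\<bar>1 - profile i Y\<bar> \<le> 2 * profile_bound i" using lift.b_bd[of Y] lift.L by linarith
  moreover have "\<bar>2 * pi * cos (2*pi*X)\<bar> \<le> 8 * 1" using pi_less_4 unfolding abs_mult by (intro mult_mono) auto
  ultimately have "\<bar>amp * ((1 - profile i Y) * (2 * pi * cos (2*pi*X)))\<bar> \<le> amp * ((2 * profile_bound i) * 8)"
    unfolding abs_mult[of amp] abs_mult[of "1 - profile i Y"] using amp lift.L by (intro mult_mono) auto
  then show ?thesis using amp by simp
qed

lemma fibre_strict_mono: "strict_mono (fibre amp i Y)"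
proof (rule strict_monoI)
  fix a b :: real assume "a < b"
  show "fibre amp i Y a < fibre amp i Y b"
  proof (rule DERIV_pos_imp_increasing[OF \<open>a < b\<close>])
    fix x show "\<exists>y. (fibre amp i Y has_real_derivative y) (at x) \<and> 0 < y"
      using fibre_deriv[of Y x] fibre_deriv_bounds[of Y x] by (intro exI conjI) (assumption, linarith)
  qed
qed

definition fibre_inv :: "real \<Rightarrow> real \<Rightarrow> real" where "fibre_inv Y x = (THE X. fibre amp i Y X = x)"

lemma fibre_inv_right: "fibre amp i Y (fibre_inv Y x) = x" and fibre_inv_left: "fibre_inv Y (fibre amp i Y X) = X"
proof -
  have inj: "X = X'" if "fibre amp i Y X = fibre amp i Y X'" for X X'
    using that strict_mono_eq[OF fibre_strict_mono] by simp
  show "fibre_inv Y (fibre amp i Y X) = X" for X unfolding fibre_inv_def using inj by blast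
  then show "fibre amp i Y (fibre_inv Y x) = x" using lift.H_surj[of Y x] unfolding lift_H by metis
qed

lemma fibre_deriv_trig: "(\<lambda>X. 1 + amp * ((1 - profile i Y) * (2 * pi * cos (2*pi*X)))) \<in> trig_algebra {}"
  by (intro trig_algebra.add trig_algebra.mult trig_algebra.const trig_algebra.cos)

lemma fibre_smooth: "smooth (fibre amp i Y)"
proof -
  have "(\<lambda>X. amp * (sin (2*pi*X) + profile i Y * (1 + (-1) * sin (2*pi*X)))) \<in> trig_algebra {}"
    by (intro trig_algebra.add trig_algebra.mult trig_algebra.const trig_algebra.sin)
  from smooth_linear_plus_trig[OF this, of 1] show ?thesis by (simp add: fibre_def[abs_def])
qed

lemma fibre_inv_smooth: "smooth (fibre_inv Y)"
proof (rule smooth_inverse_of_trig[OF fibre_deriv_trig])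
  show "(fibre amp i Y has_real_derivative 1 + amp * ((1 - profile i Y) * (2 * pi * cos (2*pi*x)))) (at x)" for x by (rule fibre_deriv)
  show "0 < 1 + amp * ((1 - profile i Y) * (2 * pi * cos (2*pi*x)))" for x using fibre_deriv_bounds[of Y x] by linarith
qed (rule fibre_inv_left fibre_inv_right)+

lemma circle_fibre_lift: "smooth_lift to_circle (circle_fibre amp i (to_circle Y)) (fibre amp i Y)"
  unfolding smooth_lift_def using fibre_smooth circle_fibre_to_circle by simp

lemma circle_fibre_diffeo: "circle_diffeo (circle_fibre amp i y)"
proof -
  obtain Y where y: "y = to_circle Y" by (rule to_circle_surj)
  have bij: "bij (circle_fibre amp i y)"
  proof (rule bijI)
    show "inj (circle_fibre amp i y)"
    proof (rule injI)
      fix x x' assume eq: "circle_fibre amp i y x = circle_fibre amp i y x'"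
      obtain X X' where x: "x = to_circle X" "x' = to_circle X'" using to_circle_surj by metis
      have "fibre amp i Y X - fibre amp i Y X' \<in> \<int>" using eq by (simp add: x y circle_fibre_to_circle to_circle_eq_iff)
      then obtain n :: int where "fibre amp i Y X - fibre amp i Y X' = n" by (rule Ints_cases)
      then have "fibre amp i Y X = fibre amp i Y (X' + n)" using fibre_int[of Y 0 X' n] by simp
      then have "X = X' + n" using strict_mono_eq[OF fibre_strict_mono] by blast
      then show "x = x'" by (simp add: x)
    qed
    show "surj (circle_fibre amp i y)"
    proof (rule surjI)
      fix x
      show "circle_fibre amp i y (to_circle (fibre_inv Y (rep_circle x))) = x" by (simp add: y circle_fibre_to_circle fibre_inv_right to_circle_rep)
    qed
  qed
  have "inv (circle_fibre amp i y) (to_circle X) = to_circle (fibre_inv Y X)" for X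
    using bij by (intro inv_f_eq) (auto simp: bij_def y circle_fibre_to_circle fibre_inv_right)
  then have "smooth_circle (inv (circle_fibre amp i y))"
    unfolding smooth_circle_def smooth_lift_def using fibre_inv_smooth by blast
  then show ?thesis unfolding circle_diffeo_def smooth_circle_def using bij circle_fibre_lift y by blast
qed

lemma family_smooth_skew_product: "smooth_skew_product (circle_mult i) (circle_fibre amp i)"
  unfolding smooth_skew_product_def
proof (intro conjI allI)
  have "smooth (\<lambda>x::real. of_int i * x)" using smooth_linear_plus_trig[OF trig_algebra.const[of 0], of "of_int i"] by simp
  then show "smooth_circle (circle_mult i)"
    unfolding smooth_circle_def smooth_lift_def using circle_mult_to_circle by blast
  show "smooth_torus (skew_map (circle_mult i) (circle_fibre amp i))"
    unfolding smooth_torus_def smooth_lift_def using family_lift_smooth family_lift_lifts by blast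
  show "circle_diffeo (circle_fibre amp i y)" for y by (rule circle_fibre_diffeo)
qed

lemma circle_fibre_deriv: "circle_deriv (circle_fibre amp i (to_circle Y)) (to_circle X) = 1 + amp * ((1 - profile i Y) * (2 * pi * cos (2*pi*X)))"
  by (rule circle_deriv_eq[OF circle_fibre_lift fibre_deriv smooth_continuous_on])

lemma circle_fibre_deriv_bounds: "9/10 \<le> circle_deriv (circle_fibre amp i y) x" "circle_deriv (circle_fibre amp i y) x \<le> 11/10"
proof -
  obtain Y X where "y = to_circle Y" "x = to_circle X" using to_circle_surj by metis
  then have eq: "circle_deriv (circle_fibre amp i y) x = 1 + amp * ((1 - profile i Y) * (2 * pi * cos (2*pi*X)))" by (simp only: circle_fibre_deriv)
  show "9/10 \<le> circle_deriv (circle_fibre amp i y) x" "circle_deriv (circle_fibre amp i y) x \<le> 11/10"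
    unfolding eq using fibre_deriv_bounds[of Y X] by linarith+
qed

text \<open>The fibre maps expand less than the base, whose expansion \<open>i\<close> is at least \<open>2\<close>; this puts the leaves constructed
  below into the strong unstable manifolds.\<close>

lemma max_fiber_deriv_bounds: "0 < max_fiber_deriv (circle_fibre amp i)" "max_fiber_deriv (circle_fibre amp i) < 2"
proof -
  let ?D = "\<lambda>(y, x). circle_deriv (circle_fibre amp i y) x"
  have *: "?D p \<le> 11/10" for p by (cases p) (simp only: prod.case circle_fibre_deriv_bounds)
  have "max_fiber_deriv (circle_fibre amp i) \<le> 11/10" unfolding max_fiber_deriv_def
    by (rule cSUP_least[OF _ *]) simp
  then show "max_fiber_deriv (circle_fibre amp i) < 2" by simp
  have "bdd_above (range ?D)" by (rule bdd_aboveI2[OF *])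
  then have "?D undefined \<le> max_fiber_deriv (circle_fibre amp i)" unfolding max_fiber_deriv_def by (rule cSUP_upper[OF UNIV_I])
  moreover have "9/10 \<le> ?D undefined" by (simp only: case_prod_beta circle_fibre_deriv_bounds)
  ultimately show "0 < max_fiber_deriv (circle_fibre amp i)" by linarith
qed

lemma circle_fibre_0_fixpoint: "circle_fibre amp i (to_circle 0) p = p \<longleftrightarrow> p = to_circle 0 \<or> p = to_circle (1/2)"
proof -
  obtain X where p: "p = to_circle X" by (rule to_circle_surj)
  have p0: "profile i 0 = 0" using lift.b_int[of 0] by simp
  have "circle_fibre amp i (to_circle 0) p = p \<longleftrightarrow> amp * sin (2*pi*X) \<in> \<int>"
    by (simp add: p circle_fibre_to_circle to_circle_eq_iff fibre_def p0)
  also have "\<dots> \<longleftrightarrow> sin (2*pi*X) = 0"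
  proof
    assume "amp * sin (2*pi*X) \<in> \<int>"
    then obtain n :: int where n: "amp * sin (2*pi*X) = n" by (rule Ints_cases)
    have "\<bar>amp * sin (2*pi*X)\<bar> \<le> amp * 1" unfolding abs_mult using amp by (intro mult_mono) auto
    then have "\<bar>real_of_int n\<bar> < 1" using n lift.amp_le(2) by simp
    then have "n = 0" by linarith
    then show "sin (2*pi*X) = 0" using n amp by simp
  qed simp
  also have "\<dots> \<longleftrightarrow> (\<exists>n::int. 2*pi*X = n * pi)" by (rule sin_zero_iff_int2)
  also have "\<dots> \<longleftrightarrow> (\<exists>n::int. X = n / 2)" by (simp add: field_simps)
  also have "\<dots> \<longleftrightarrow> p = to_circle 0 \<or> p = to_circle (1/2)"
  proof
    assume "\<exists>n::int. X = n / 2"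
    then obtain n :: int where n: "X = n / 2" by blast
    show "p = to_circle 0 \<or> p = to_circle (1/2)"
    proof (cases "even n")
      case True
      then obtain k where "n = 2 * k" by (rule evenE)
      then show ?thesis using n to_circle_add_int[of 0 k] by (simp add: p)
    next
      case False
      then obtain k where "n = 2 * k + 1" by (rule oddE)
      then have "X = 1/2 + of_int k" using n by (simp add: field_simps)
      then show ?thesis by (simp add: p)
    qed
  next
    assume "p = to_circle 0 \<or> p = to_circle (1/2)"
    then obtain n :: int where "X = n \<or> X - 1/2 = n" unfolding p to_circle_eq_iff by (auto elim!: Ints_cases)
    then have "X = of_int (2 * n) / 2 \<or> X = of_int (2 * n + 1) / 2" by auto
    then show "\<exists>n::int. X = n / 2" by blast
  qed
  finally show ?thesis .
qed

lemma north_south: 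
  "(\<exists>!p. attracting_fixpoint (circle_fibre amp i (to_circle 0)) p) \<and> (\<exists>!p. repelling_fixpoint (circle_fibre amp i (to_circle 0)) p) \<and>
   (\<forall>p. circle_fibre amp i (to_circle 0) p = p \<longrightarrow> attracting_fixpoint (circle_fibre amp i (to_circle 0)) p \<or> repelling_fixpoint (circle_fibre amp i (to_circle 0)) p)"
proof -
  let ?f = "circle_fibre amp i (to_circle 0)"
  have p0: "profile i 0 = 0" using lift.b_int[of 0] by simp
  have d0: "circle_deriv ?f (to_circle 0) = 1 + 2 * pi * amp" unfolding circle_fibre_deriv by (simp add: p0)
  have d1: "circle_deriv ?f (to_circle (1/2)) = 1 - 2 * pi * amp" unfolding circle_fibre_deriv by (simp add: p0)
  have "2 * pi * amp > 0" using amp by simp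
  moreover have "2 * pi * amp < 1" using circle_fibre_deriv_bounds(2)[of "to_circle 0" "to_circle 0"] d0 by simp
  ultimately have a: "\<bar>circle_deriv ?f (to_circle (1/2))\<bar> < 1" "\<bar>circle_deriv ?f (to_circle 0)\<bar> > 1" unfolding d0 d1 by auto
  have "attracting_fixpoint ?f p \<longleftrightarrow> p = to_circle (1/2)" "repelling_fixpoint ?f p \<longleftrightarrow> p = to_circle 0" for p
    using a circle_fibre_0_fixpoint[of p] unfolding attracting_fixpoint_def repelling_fixpoint_def by auto
  then show ?thesis using circle_fibre_0_fixpoint by auto
qed

end

lemma family_close:
  assumes i: "i > 1" and r: "0 < \<rho>"
  obtains amp0 where "amp0 > 0" "\<And>amp. 0 < amp \<Longrightarrow> amp < amp0 \<Longrightarrow> 1000 * (amp * profile_bound i) \<le> 1 \<Longrightarrow>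
    Cr_close r \<rho> (F0 i) (skew_map (circle_mult i) (circle_fibre amp i))"
proof -
  obtain B where B: "\<And>bs v. bs \<in> lists Basis \<Longrightarrow> length bs \<le> r \<Longrightarrow> norm (partials bs (displacement i) v) \<le> B"
    using trig_pairs_partials_bounded[OF displacement_trig, of r] by blast
  define B' where "B' = max B 1"
  have B': "B' > 0" "B \<le> B'" by (auto simp: B'_def)
  show ?thesis
  proof (rule that[of "\<rho> / B'"])
    show "0 < \<rho> / B'" using r B' by simp
    fix amp assume e: "0 < amp" "amp < \<rho> / B'" "1000 * (amp * profile_bound i) \<le> 1"
    interpret north_south_family i amp by unfold_locales (use i e in auto)
    let ?\<Phi>0 = "\<lambda>v::real\<times>real. (of_int i * fst v, 1 * snd v)"
    have "amp * B' < \<rho>" using e B' by (simp add: pos_less_divide_eq)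
    have small: "amp * norm (partials bs (displacement i) v) < \<rho>" if "bs \<in> lists Basis" "length bs \<le> r" for bs v
    proof -
      have "amp * norm (partials bs (displacement i) v) \<le> amp * B'" using B[OF that, of v] B' e by (intro mult_left_mono) auto
      then show ?thesis using \<open>amp * B' < \<rho>\<close> by linarith
    qed
    have l0: "smooth_lift to_torus (F0 i) ?\<Phi>0"
      unfolding smooth_lift_def using diagonal_smooth[of "of_int i" 1]
      by (auto simp: F0_def skew_map_def circle_mult_to_circle)
    have l1: "smooth_lift to_torus (skew_map (circle_mult i) (circle_fibre amp i)) family_lift"
      unfolding smooth_lift_def using family_lift_smooth family_lift_lifts by blast
    show "Cr_close r \<rho> (F0 i) (skew_map (circle_mult i) (circle_fibre amp i))"
      unfolding Cr_close_def
    proof (rule conjI, rule allI, goal_cases)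
      case (1 p)
      obtain Y X where p: "p = to_torus (Y, X)" by (rule to_torus_surj)
      have "dist (F0 i p) (skew_map (circle_mult i) (circle_fibre amp i) p) \<le> 0 + dist (to_circle X) (to_circle (fibre amp i Y X))"
      proof -
        have "F0 i p = (to_circle (of_int i * Y), to_circle X)" by (simp add: p F0_def skew_map_def circle_mult_to_circle)
        moreover have "skew_map (circle_mult i) (circle_fibre amp i) p = (to_circle (of_int i * Y), to_circle (fibre amp i Y X))"
          by (simp add: p skew_map_def circle_mult_to_circle circle_fibre_to_circle)
        ultimately show ?thesis
          using dist_pair_le[of "to_circle (of_int i * Y)" "to_circle X" "to_circle (of_int i * Y)" "to_circle (fibre amp i Y X)"] by simp
      qed
      also have "\<dots> \<le> \<bar>X - fibre amp i Y X\<bar>" using dist_to_circle_le by simp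
      also have "\<dots> = amp * norm (partials [] (displacement i) (Y, X))"
        using e by (simp add: fibre_def displacement_def abs_mult norm_Pair)
      also have "\<dots> < \<rho>" by (rule small) auto
      finally show ?case .
    next
      case 2
      show ?case
      proof (rule exI[of _ ?\<Phi>0], rule exI[of _ family_lift], intro conjI l0 l1 ballI impI allI)
      fix bs v assume bs: "bs \<in> lists (Basis :: (real\<times>real) set)" "1 \<le> length bs \<and> length bs \<le> r"
      have "partials bs family_lift = (\<lambda>v. partials bs ?\<Phi>0 v + amp *\<^sub>R partials bs (displacement i) v)"
        unfolding family_lift_eq by (intro partials_perturb diagonal_smooth trig_pairs_smooth displacement_trig bs(1))
      then have "norm (partials bs ?\<Phi>0 v - partials bs family_lift v) = amp * norm (partials bs (displacement i) v)"
        using e by simp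
      then show "norm (partials bs ?\<Phi>0 v - partials bs family_lift v) < \<rho>" using small[OF bs(1), of v] bs(2) by simp
      qed
    qed
  qed
qed

section \<open>Small perturbations and eventual surjectivity\<close>

lemma Basis_real2: "Basis = {(1::real, 0::real), (0, 1)}"
  by (auto simp: Basis_prod_def)

lemma partial_bounded_lipschitz:
  fixes D :: "real \<times> real \<Rightarrow> real \<times> real"
  assumes diff: "\<And>v. D differentiable (at v)"
    and bd: "\<And>v b. b \<in> Basis \<Longrightarrow> norm (frechet_derivative D (at v) b) \<le> \<delta>"
  shows "norm (D v - D w) \<le> 2 * \<delta> * norm (v - w)"
proof (rule differentiable_bound[of UNIV D "\<lambda>v. frechet_derivative D (at v)"])
  fix v :: "real \<times> real"
  show "(D has_derivative frechet_derivative D (at v)) (at v within UNIV)"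
    using diff[of v] by (simp add: frechet_derivative_works)
  then have lin: "linear (frechet_derivative D (at v))" by (metis has_derivative_linear)
  show "onorm (frechet_derivative D (at v)) \<le> 2 * \<delta>"
  proof (rule onorm_le)
    fix h :: "real \<times> real"
    have "h = fst h *\<^sub>R (1,0) + snd h *\<^sub>R (0,1)" by (cases h) simp
    then have "frechet_derivative D (at v) h = fst h *\<^sub>R frechet_derivative D (at v) (1,0) + snd h *\<^sub>R frechet_derivative D (at v) (0,1)"
      using linear_add[OF lin] linear_scale[OF lin] by metis
    also have "norm \<dots> \<le> \<bar>fst h\<bar> * \<delta> + \<bar>snd h\<bar> * \<delta>"
      using bd[of "(1,0)" v] bd[of "(0,1)" v] by (intro norm_triangle_mono) (auto simp: Basis_real2 mult_left_mono)
    also have "\<dots> \<le> norm h * \<delta> + norm h * \<delta>"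
    proof -
      have "norm (frechet_derivative D (at v) (1,0)) \<le> \<delta>" by (rule bd) (simp add: Basis_real2)
      then have "0 \<le> \<delta>" using norm_ge_zero[of "frechet_derivative D (at v) (1,0)"] by linarith
      then show ?thesis using norm_fst_le[of "fst h" "snd h"] norm_snd_le[of "snd h" "fst h"]
        by (intro add_mono mult_right_mono) simp_all
    qed
    finally show "norm (frechet_derivative D (at v) h) \<le> 2 * \<delta> * norm h" by simp
  qed
qed auto

text \<open>The definition of the topology provides some lifts of the two maps. The lift of \<open>F\<close> differs from \<open>\<Phi>0\<close> by an integer vector,
  and uniform closeness on the torus makes the difference of the lifts uniformly close to an integer vector. Subtracting
  both leaves a small perturbation \<open>D\<close>, and the closeness of the first derivatives makes it Lipschitz.\<close>

lemma perturbed_lift: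
  fixes \<Phi>0 :: "real \<times> real \<Rightarrow> real \<times> real"
  assumes r: "r \<ge> 1" and \<delta>: "\<delta> \<le> 1/4"
    and lift0: "\<And>v. F (to_torus v) = to_torus (\<Phi>0 v)" "continuous_on UNIV \<Phi>0"
      "\<And>Y X X'. fst (\<Phi>0 (Y, X)) = fst (\<Phi>0 (Y, X'))"
    and close: "Cr_close r \<delta> F (skew_map g' f')"
  obtains D where "continuous_on UNIV D" "\<And>v. skew_map g' f' (to_torus v) = to_torus (\<Phi>0 v + D v)"
    "\<And>v. \<bar>fst (D v)\<bar> \<le> \<delta>" "\<And>v. \<bar>snd (D v)\<bar> \<le> \<delta>" "\<And>v w. norm (D v - D w) \<le> 2 * \<delta> * norm (v - w)"
    "\<And>Y X X'. fst (D (Y, X)) = fst (D (Y, X'))"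
proof -
  let ?F' = "skew_map g' f'"
  obtain \<Phi>1 \<Phi>' where l: "smooth_lift to_torus F \<Phi>1" "smooth_lift to_torus ?F' \<Phi>'"
    and part: "\<And>bs v. bs \<in> lists Basis \<Longrightarrow> 1 \<le> length bs \<Longrightarrow> length bs \<le> r \<Longrightarrow> norm (partials bs \<Phi>1 v - partials bs \<Phi>' v) < \<delta>"
    and d0: "\<And>p. dist (F p) (?F' p) < \<delta>"
    using close unfolding Cr_close_def by blast
  have lift': "?F' (to_torus v) = to_torus (\<Phi>' v)" and lift1: "F (to_torus v) = to_torus (\<Phi>1 v)" for v
    using l unfolding smooth_lift_def by blast+
  have diff: "\<Phi>1 differentiable (at v)" "\<Phi>' differentiable (at v)" for v
    using l smooth_differentiable unfolding smooth_lift_def by blast+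
  have cont: "continuous_on UNIV \<Phi>1" "continuous_on UNIV \<Phi>'" using l smooth_continuous_on unfolding smooth_lift_def by blast+
  define A where "A v = \<Phi>' v - \<Phi>1 v" for v
  have A: "continuous_on UNIV A" unfolding A_def by (intro continuous_intros cont)
  have lip: "norm (A v - A w) \<le> 2 * \<delta> * norm (v - w)" for v w
  proof (rule partial_bounded_lipschitz)
    show "A differentiable (at v)" for v unfolding A_def by (intro differentiable_diff diff)
    fix v and b :: "real \<times> real" assume b: "b \<in> Basis"
    have "(A has_derivative (\<lambda>h. frechet_derivative \<Phi>' (at v) h - frechet_derivative \<Phi>1 (at v) h)) (at v)"
      unfolding A_def using diff by (intro has_derivative_diff) (auto simp: frechet_derivative_works[symmetric])
    then have "frechet_derivative A (at v) b = frechet_derivative \<Phi>' (at v) b - frechet_derivative \<Phi>1 (at v) b" by (rule frechet_eq)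
    then show "norm (frechet_derivative A (at v) b) \<le> \<delta>" using part[of "[b]" v] b r by (simp add: norm_minus_commute)
  qed
  have "to_torus (\<Phi>1 v) = to_torus (\<Phi>0 v)" for v using lift0(1) lift1 by simp
  then have int: "fst (\<Phi>1 v) - fst (\<Phi>0 v) \<in> \<int>" "snd (\<Phi>1 v) - snd (\<Phi>0 v) \<in> \<int>" for v
    by (auto simp: to_torus_def map_prod_def case_prod_beta to_circle_eq_iff)
  have c1: "continuous_on UNIV (\<lambda>v. fst (\<Phi>1 v) - fst (\<Phi>0 v))" and c2: "continuous_on UNIV (\<lambda>v. snd (\<Phi>1 v) - snd (\<Phi>0 v))"
    by (intro continuous_intros cont lift0)+
  obtain k1 :: int where k1: "\<And>v. fst (\<Phi>1 v) - fst (\<Phi>0 v) = k1" using continuous_int_constant[OF c1 int(1)] by blast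
  obtain k2 :: int where k2: "\<And>v. snd (\<Phi>1 v) - snd (\<Phi>0 v) = k2" using continuous_int_constant[OF c2 int(2)] by blast
  have near: "\<exists>n::int. \<bar>fst (A v) - n\<bar> < \<delta>" "\<exists>n::int. \<bar>snd (A v) - n\<bar> < \<delta>" for v
  proof -
    have "dist (to_torus (\<Phi>' v)) (to_torus (\<Phi>1 v)) < \<delta>" using d0[of "to_torus v"] lift' lift1 by (simp add: dist_commute)
    then have "dist (to_circle (fst (\<Phi>' v))) (to_circle (fst (\<Phi>1 v))) < \<delta>" "dist (to_circle (snd (\<Phi>' v))) (to_circle (snd (\<Phi>1 v))) < \<delta>"
      using dist_fst_snd_le[of "to_torus (\<Phi>' v)" "to_torus (\<Phi>1 v)"] by (auto simp: to_torus_def map_prod_def case_prod_beta)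
    then show "\<exists>n::int. \<bar>fst (A v) - n\<bar> < \<delta>" "\<exists>n::int. \<bar>snd (A v) - n\<bar> < \<delta>"
      unfolding A_def by (metis dist_to_circle_lt fst_diff, metis dist_to_circle_lt snd_diff)
  qed
  have c3: "continuous_on UNIV (\<lambda>v. fst (A v))" and c4: "continuous_on UNIV (\<lambda>v. snd (A v))" by (intro continuous_intros A)+
  obtain n1 :: int where n1: "\<And>v. \<bar>fst (A v) - n1\<bar> < \<delta>" using continuous_int_valued_constant[OF c3 near(1) \<delta>] by blast
  obtain n2 :: int where n2: "\<And>v. \<bar>snd (A v) - n2\<bar> < \<delta>" using continuous_int_valued_constant[OF c4 near(2) \<delta>] by blast
  define D where "D v = A v - (of_int n1, of_int n2)" for v
  have D': "\<Phi>0 v + D v = \<Phi>' v - (of_int (k1 + n1), of_int (k2 + n2))" for v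
    using k1[of v] k2[of v] by (simp add: D_def A_def prod_eq_iff)
  have tt: "to_torus (w - (of_int m, of_int n)) = to_torus w" for w m n
    using to_circle_add_int[of "fst w - of_int m" m] to_circle_add_int[of "snd w - of_int n" n] 
    by (cases w) simp
  have liftD: "?F' (to_torus v) = to_torus (\<Phi>0 v + D v)" for v unfolding D' tt by (rule lift')
  have D1: "\<bar>fst (D v)\<bar> < \<delta>" "\<bar>snd (D v)\<bar> < \<delta>" for v using n1[of v] n2[of v] by (simp_all add: D_def)
  show ?thesis
  proof (rule that[OF _ liftD])
    show "continuous_on UNIV D" unfolding D_def by (intro continuous_intros A)
    show "\<bar>fst (D v)\<bar> \<le> \<delta>" "\<bar>snd (D v)\<bar> \<le> \<delta>" for v using D1[of v] by simp_all
    show "norm (D v - D w) \<le> 2 * \<delta> * norm (v - w)" for v w using lip[of v w] by (simp add: D_def)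
    fix Y X X'
    have "fst (\<Phi>' (Y, X)) - fst (\<Phi>' (Y, X')) \<in> \<int>"
    proof -
      have "to_circle (fst (\<Phi>' (Y, X))) = g' (to_circle Y)" for X
        using arg_cong[OF lift'[of "(Y, X)"], of fst] by (simp add: skew_map_def to_torus_def map_prod_def case_prod_beta)
      then show ?thesis by (simp flip: to_circle_eq_iff)
    qed
    then obtain m :: int where "fst (\<Phi>' (Y, X)) - fst (\<Phi>' (Y, X')) = m" by (rule Ints_cases)
    moreover have "fst (\<Phi>' w) = fst (\<Phi>0 w) + fst (D w) + of_int (k1 + n1)" for w
      using arg_cong[OF D'[of w], of fst] by simp
    ultimately have m: "fst (D (Y, X)) - fst (D (Y, X')) = m" using lift0(3)[of Y X X'] by simp
    then have "\<bar>real_of_int m\<bar> < 1" using D1(1)[of "(Y, X)"] D1(1)[of "(Y, X')"] \<delta> by linarith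
    then have "m = 0" by linarith
    then show "fst (D (Y, X)) = fst (D (Y, X'))" using m by simp
  qed
qed

text \<open>Also known as local eventual onto-ness or topological exactness.\<close>

definition eventually_onto :: "('a::topological_space \<Rightarrow> 'a) \<Rightarrow> bool" where
  "eventually_onto F \<longleftrightarrow> (\<forall>V. open V \<and> V \<noteq> {} \<longrightarrow> (\<exists>N. (F ^^ N) ` V = UNIV))"

lemma (in mixing_lift) exact_imp_eventually_onto:
  assumes lift: "\<And>Y X. F (to_torus (Y, X)) = to_torus (G Y, H Y X)" and d: "err * (4 * 2^(2 * transit)) \<le> 1/100"
  shows "eventually_onto F"
  unfolding eventually_onto_def
proof (intro allI impI; elim conjE)
  fix V :: "torus set" assume V: "open V" "V \<noteq> {}"
  then obtain p where p: "p \<in> V" by blast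
  then obtain r where r: "r > 0" "\<And>q. dist q p < r \<Longrightarrow> q \<in> V" using V(1) unfolding open_dist by blast
  obtain y x where yx: "p = to_torus (y, x)" by (rule to_torus_surj)
  have "0 < r/3" using r by simp
  then obtain N where N: "\<And>p q :: real. \<exists>(k::int) (l::int) Y X. orbit Y X \<and> \<bar>Y 0 - y\<bar> \<le> r/3 \<and> \<bar>X 0 - x\<bar> \<le> r/3 \<and>
     Y N = p + k \<and> X N = q + l" using exact[OF _ d] by blast
  have "q \<in> (F ^^ N) ` V" for q
  proof -
    obtain a b where q: "q = to_torus (a, b)" by (rule to_torus_surj)
    obtain k l :: int and Y X where o: "orbit Y X" "\<bar>Y 0 - y\<bar> \<le> r/3" "\<bar>X 0 - x\<bar> \<le> r/3" "Y N = a + k" "X N = b + l" using N by blast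
    have "(F ^^ n) (to_torus (Y 0, X 0)) = to_torus (Y n, X n)" for n
    proof (induction n)
      case (Suc n)
      then have "(F ^^ Suc n) (to_torus (Y 0, X 0)) = F (to_torus (Y n, X n))" by simp
      also have "\<dots> = to_torus (Y (Suc n), X (Suc n))" unfolding lift orbitD[OF o(1)] ..
      finally show ?case .
    qed simp
    then have "(F ^^ N) (to_torus (Y 0, X 0)) = q" using o(4,5) by (simp add: q)
    moreover have "dist (to_torus (Y 0, X 0)) p < r"
      using dist_pair_le[of "to_circle (Y 0)" "to_circle (X 0)" "to_circle y" "to_circle x"]
        dist_to_circle_le[of "Y 0" y] dist_to_circle_le[of "X 0" x] o(2,3) r(1) by (simp add: yx)
    ultimately show ?thesis using r(2) by blast
  qed
  then show "\<exists>N. (F ^^ N) ` V = UNIV" by blast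
qed

context north_south_family begin

lemma family_lift_continuous: "continuous_on UNIV family_lift"
  by (rule smooth_continuous_on[OF family_lift_smooth])

text \<open>The constants give the size of the neighbourhood: \<open>Z\<close> dominates all quantities whose product with the size of the
  perturbation has to be small.\<close>

theorem robustly_eventually_onto:
  assumes K: "4000 * profile_bound i \<le> real K" "400 * (amp * profile_bound i) * K \<le> 1" and r: "r \<ge> 1"
  obtains \<delta> where "\<delta> > 0" "\<And>g' f'. Cr_close r \<delta> (skew_map (circle_mult i) (circle_fibre amp i)) (skew_map g' f') \<Longrightarrow>
    continuous_on UNIV (skew_map g' f') \<and> eventually_onto (skew_map g' f')"
proof -
  define Z :: real where "Z = 4 + 1/amp + (3/amp + 3*K + 6)/amp + 100 * (4 * 2^(2 * lift.transit))"
  define \<delta> where "\<delta> = 1 / (2 * Z)"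
  have terms: "0 \<le> 1/amp" "0 \<le> (3/amp + 3*K + 6)/amp" "0 \<le> 100 * (4 * 2^(2 * lift.transit) :: real)" using amp by auto
  then have Z: "Z \<ge> 4" "1/amp \<le> Z" "(3/amp + 3*K + 6)/amp \<le> Z" "100 * (4 * 2^(2 * lift.transit)) \<le> Z" unfolding Z_def by linarith+
  then have pos: "\<delta> > 0" by (simp add: \<delta>_def)
  have d2: "2 * \<delta> * c \<le> t" if "c / t \<le> Z" "t > 0" for c t
  proof -
    have "c \<le> Z * t" using that by (simp add: pos_divide_le_eq)
    then show ?thesis using Z(1) by (simp add: \<delta>_def divide_le_eq mult.commute)
  qed
  have d: "2 * \<delta> \<le> amp" "2 * \<delta> * (3/amp + 3*K + 6) \<le> amp" "2 * \<delta> * (4 * 2^(2 * lift.transit)) \<le> 1/100" "\<delta> \<le> 1/4"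
    using d2[of 1 amp] d2[of "3/amp + 3*K + 6" amp] d2[of "4 * 2^(2 * lift.transit)" "1/100"] d2[of 1 "1/4"] Z amp pos by auto
  show ?thesis
  proof (rule that[OF pos])
    fix g' f' assume close: "Cr_close r \<delta> (skew_map (circle_mult i) (circle_fibre amp i)) (skew_map g' f')"
    have "fst (family_lift (Y, X)) = fst (family_lift (Y, X'))" for Y X X' by (simp add: family_lift_def)
    then obtain D where D: "continuous_on UNIV D" "\<And>v. skew_map g' f' (to_torus v) = to_torus (family_lift v + D v)"
      "\<And>v. \<bar>fst (D v)\<bar> \<le> \<delta>" "\<And>v. \<bar>snd (D v)\<bar> \<le> \<delta>" "\<And>v w. norm (D v - D w) \<le> 2 * \<delta> * norm (v - w)"
      "\<And>Y X X'. fst (D (Y, X)) = fst (D (Y, X'))"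
      using perturbed_lift[OF r d(4) family_lift_lifts family_lift_continuous _ close] by blast
    have "continuous_on UNIV (skew_map g' f')"
    proof (rule lift_continuous_torus)
      show "continuous_on UNIV (\<lambda>v. family_lift v + D v)" by (intro continuous_intros family_lift_continuous D(1))
    qed (rule D(2))
    moreover have "eventually_onto (skew_map g' f')"
    proof -
      define e where "e Y = fst (D (Y, 0))" for Y
      define E where "E Y X = snd (D (Y, X))" for Y X
      have fst_le: "\<bar>fst w\<bar> \<le> norm w" "\<bar>snd w\<bar> \<le> norm w" for w :: "real \<times> real"
        using norm_fst_le[of "fst w" "snd w"] norm_snd_le[of "snd w" "fst w"] by auto
      have norm_le: "norm (v - w) \<le> \<bar>fst v - fst w\<bar> + \<bar>snd v - snd w\<bar>" for v w :: "real \<times> real"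
        using norm_Pair_le[of "fst v - fst w" "snd v - snd w"] by (simp add: minus_prod_def)
      have e_lip: "\<bar>e Y - e Y'\<bar> \<le> 2 * \<delta> * \<bar>Y - Y'\<bar>" for Y Y'
        using fst_le(1)[of "D (Y,0) - D (Y',0)"] D(5)[of "(Y,0)" "(Y',0)"] by (simp add: e_def norm_Pair)
      have E_lip: "\<bar>E Y X - E Y' X'\<bar> \<le> 2 * \<delta> * (\<bar>Y - Y'\<bar> + \<bar>X - X'\<bar>)" for Y Y' X X'
      proof -
        have "\<bar>E Y X - E Y' X'\<bar> \<le> 2 * \<delta> * norm ((Y,X) - (Y',X'))"
          using fst_le(2)[of "D (Y,X) - D (Y',X')"] D(5)[of "(Y,X)" "(Y',X')"] by (simp add: E_def)
        also have "\<dots> \<le> 2 * \<delta> * (\<bar>Y - Y'\<bar> + \<bar>X - X'\<bar>)"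
          using norm_le[of "(Y,X)" "(Y',X')"] pos by (intro mult_left_mono) auto
        finally show ?thesis .
      qed
      have e_bd: "\<bar>e Y\<bar> \<le> 2 * \<delta>" and E_bd: "\<bar>E Y X\<bar> \<le> 2 * \<delta>" for Y X
        using D(3)[of "(Y,0)"] D(4)[of "(Y,X)"] pos unfolding e_def E_def by linarith+
      interpret P: skew_lift i "profile i" "profile_bound i" amp "2 * \<delta>" e E
        by (rule family_skew_lift) (use i amp d e_lip E_lip e_bd E_bd pos in auto)
      interpret P: mixing_lift i "profile i" "profile_bound i" amp "2 * \<delta>" e E K
        by unfold_locales (use K d in auto)
      have "skew_map g' f' (to_torus (Y, X)) = to_torus (P.G Y, P.H Y X)" for Y X
      proof -
        have "family_lift (Y, X) + D (Y, X) = (P.G Y, P.H Y X)"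
          using D(6)[of Y X 0] by (simp add: family_lift_def P.G_def P.H_def fibre_def e_def E_def prod_eq_iff)
        then show ?thesis using D(2)[of "(Y, X)"] by simp
      qed
      moreover have "2 * \<delta> * (4 * 2^(2 * P.transit)) \<le> 1/100" using d(3) by (simp add: P.transit_def lift.transit_def)
      ultimately show ?thesis by (rule P.exact_imp_eventually_onto)
    qed
    ultimately show "continuous_on UNIV (skew_map g' f') \<and> eventually_onto (skew_map g' f')" by blast
  qed
qed

end

section \<open>Mixing and strong stable manifolds\<close>

lemma eventually_onto_later:
  fixes F :: "torus \<Rightarrow> torus"
  assumes "eventually_onto F"
  shows "surj F" "open V \<Longrightarrow> V \<noteq> {} \<Longrightarrow> \<exists>N. \<forall>n\<ge>N. (F ^^ n) ` V = UNIV"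
proof -
  let ?p = "to_torus (0, 0)"
  have ne: "to_circle (1/2) \<noteq> to_circle 0"
  proof
    assume "to_circle (1/2) = to_circle 0"
    then obtain n :: int where "(1/2 :: real) = n" by (auto simp: to_circle_eq_iff elim!: Ints_cases)
    then have "2 * n = 1" by linarith
    then show False by presburger
  qed
  \<comment> \<open>the complement of a point needs at least one step to cover everything, so the map is onto\<close>
  have "open (- {?p})" by (simp add: open_Compl)
  moreover have "- {?p} \<noteq> {}" using ne by (auto intro: exI[of _ "to_torus (1/2, 0)"])
  ultimately obtain N where N: "(F ^^ N) ` (- {?p}) = UNIV" using assms unfolding eventually_onto_def by blast
  have "N \<noteq> 0"
  proof
    assume "N = 0"
    then have "- {?p} = UNIV" using N by simp
    then show False by blast
  qed
  then obtain m where "N = Suc m" by (cases N) auto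
  then have "\<exists>x. F x = y" for y using N by (metis UNIV_I comp_apply funpow.simps(2) imageE)
  then show "surj F" by (metis surjI)
  then have sn: "surj (F ^^ n)" for n by (rule surj_fn)
  assume "open V" "V \<noteq> {}"
  then obtain N where N: "(F ^^ N) ` V = UNIV" using assms unfolding eventually_onto_def by blast
  have "(F ^^ n) ` V = UNIV" if "n \<ge> N" for n
  proof -
    have "F ^^ n = (F ^^ (n - N)) \<circ> (F ^^ N)" using that by (simp flip: funpow_add)
    then have "(F ^^ n) ` V = (F ^^ (n - N)) ` ((F ^^ N) ` V)" by (simp only: image_comp)
    also have "\<dots> = UNIV" unfolding N using sn by simp
    finally show ?thesis .
  qed
  then show "\<exists>N. \<forall>n\<ge>N. (F ^^ n) ` V = UNIV" by blast
qed

lemma eventually_onto_mixing: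
  assumes "eventually_onto (F :: torus \<Rightarrow> torus)" shows "topologically_mixing euclidean F"
  unfolding topologically_mixing_def
proof (intro allI impI; elim conjE)
  fix U V :: "torus set" assume U: "openin euclidean U" "U \<noteq> {}" "openin euclidean V" "V \<noteq> {}"
  then have "open U" by simp
  then obtain N where "\<forall>n\<ge>N. (F ^^ n) ` U = UNIV" using eventually_onto_later(2)[OF assms _ U(2)] by blast
  then show "\<exists>N. \<forall>n\<ge>N. (F ^^ n) ` U \<inter> V \<noteq> {}" using U(4) by (intro exI[of _ N]) auto
qed

text \<open>What is used of a skew product in passing to its solenoidal extension.\<close>

locale invertible_fibres =
  fixes g :: "circle \<Rightarrow> circle" and f :: "circle \<Rightarrow> circle \<Rightarrow> circle"
  assumes surj_g: "surj g" and bij_f: "\<And>y. bij (f y)" and cont: "continuous_on UNIV (skew_map g f)"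
begin

abbreviation "F \<equiv> skew_map g f"
abbreviation "Fe \<equiv> skew_ext g f"
abbreviation "SX \<equiv> solenoid g \<times> (UNIV :: circle set)"

text \<open>The inverse of the extension on the solenoid, in explicit form.\<close>

definition pullback :: "(nat \<Rightarrow> circle) \<times> circle \<Rightarrow> (nat \<Rightarrow> circle) \<times> circle" where
  "pullback = (\<lambda>(ys, x). (\<lambda>j. ys (Suc j), inv (f (ys 1)) x))"

lemma solenoidD: "ys \<in> solenoid g \<Longrightarrow> g (ys (Suc j)) = ys j"
  unfolding solenoid_def mem_Collect_eq by (rule sym) (erule spec)

lemma solenoidI:
  assumes "\<And>j. g (ys (Suc j)) = ys j" shows "ys \<in> solenoid g"
  unfolding solenoid_def by (rule CollectI, rule allI, rule assms[symmetric])

lemma ext_in: "q \<in> SX \<Longrightarrow> Fe q \<in> SX"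
proof -
  assume q: "q \<in> SX"
  have "solenoid_shift g (fst q) \<in> solenoid g"
  proof (rule solenoidI)
    fix j
    have "fst q \<in> solenoid g" using q by auto
    then show "g (solenoid_shift g (fst q) (Suc j)) = solenoid_shift g (fst q) j"
      by (cases j) (simp_all add: solenoid_shift_def solenoidD)
  qed
  then show ?thesis by (simp add: skew_ext_def case_prod_beta)
qed

lemma pullback_in: "q \<in> SX \<Longrightarrow> pullback q \<in> SX"
  by (auto simp: pullback_def intro!: solenoidI dest: solenoidD)

lemma ext_pullback: "q \<in> SX \<Longrightarrow> Fe (pullback q) = q"
proof -
  assume q: "q \<in> SX"
  obtain ys x where yx: "q = (ys, x)" by (cases q)
  have "ys \<in> solenoid g" using q yx by simp
  then have "g (ys (Suc 0)) = ys 0" by (rule solenoidD)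
  then have "solenoid_shift g (\<lambda>j. ys (Suc j)) = ys"
    by (intro ext) (simp add: solenoid_shift_def split: nat.splits)
  moreover have "f (ys 1) (inv (f (ys 1)) x) = x" using bij_f[of "ys 1"] by (simp add: bij_is_surj surj_f_inv_f)
  ultimately show ?thesis by (simp add: yx pullback_def skew_ext_def)
qed

lemma pullback_ext: "pullback (Fe q) = q"
  using bij_f by (cases q) (simp add: pullback_def skew_ext_def solenoid_shift_def bij_is_inj)

lemma inv_eq_pullback: "q \<in> SX \<Longrightarrow> skew_ext_inv g f q = pullback q"
  unfolding skew_ext_inv_def
  by (rule inv_into_f_eq) (auto intro: inj_on_inverseI[of _ pullback] pullback_ext pullback_in ext_pullback)

lemma ext_pow_in: "q \<in> SX \<Longrightarrow> (Fe ^^ n) q \<in> SX"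
  by (induction n) (auto intro: ext_in simp del: mem_Times_iff)

lemma pullback_pow_in: "q \<in> SX \<Longrightarrow> (pullback ^^ n) q \<in> SX"
  by (induction n) (auto intro: pullback_in simp del: mem_Times_iff)

lemma inv_pow_eq_pullback: "q \<in> SX \<Longrightarrow> (skew_ext_inv g f ^^ n) q = (pullback ^^ n) q"
  by (induction n) (simp_all add: inv_eq_pullback pullback_pow_in del: mem_Times_iff)

lemma ext_pullback_pow: "q \<in> SX \<Longrightarrow> (Fe ^^ n) ((pullback ^^ n) q) = q"
proof (induction n)
  case (Suc n)
  have "(Fe ^^ Suc n) ((pullback ^^ Suc n) q) = (Fe ^^ n) (Fe (pullback ((pullback ^^ n) q)))" by (simp add: funpow_swap1)
  also have "\<dots> = q" using Suc ext_pullback[OF pullback_pow_in[OF Suc.prems]] by simp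
  finally show ?case .
qed simp

lemma proj_ext: "solenoid_proj (Fe q) = F (solenoid_proj q)"
  by (cases q) (simp add: solenoid_proj_def skew_ext_def skew_map_def solenoid_shift_def)

lemma proj_ext_pow: "solenoid_proj ((Fe ^^ n) q) = (F ^^ n) (solenoid_proj q)"
  by (induction n) (simp_all add: proj_ext)

lemma proj_onto: obtains q where "q \<in> SX" "solenoid_proj q = p"
proof -
  obtain y x where p: "p = (y, x)" by (cases p)
  define ys where "ys n = ((inv g) ^^ n) y" for n
  have "ys \<in> solenoid g" by (rule solenoidI) (simp add: ys_def surj_f_inv_f[OF surj_g])
  moreover have "solenoid_proj (ys, x) = p" by (simp add: solenoid_proj_def ys_def p)
  ultimately show ?thesis using that[of "(ys, x)"] by simp
qed

lemma ext_pow_fst: "j \<le> k \<Longrightarrow> fst ((Fe ^^ k) q) j = fst ((F ^^ (k - j)) (solenoid_proj q))"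
proof (induction k arbitrary: j)
  case (Suc k)
  show ?case
  proof (cases j)
    case 0
    have "fst ((Fe ^^ Suc k) q) 0 = fst (solenoid_proj ((Fe ^^ Suc k) q))" by (simp add: solenoid_proj_def case_prod_beta)
    then show ?thesis by (simp only: 0 proj_ext_pow diff_zero)
  next
    case (Suc m)
    have "fst ((Fe ^^ Suc k) q) j = fst ((Fe ^^ k) q) m" 
      by (simp add: Suc skew_ext_def case_prod_beta solenoid_shift_def)
    also have "\<dots> = fst ((F ^^ (Suc k - j)) (solenoid_proj q))" using Suc.IH[of m] Suc.prems \<open>j = Suc m\<close> by simp
    finally show ?thesis .
  qed
qed (simp add: solenoid_proj_def case_prod_beta)

lemma cont_pow: "continuous_on UNIV (F ^^ n)"
proof (induction n)
  case (Suc n)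
  have "continuous_on UNIV (\<lambda>p. F ((F ^^ n) p))" by (rule continuous_on_compose2[OF cont Suc]) auto
  then show ?case by (simp add: comp_def)
qed (simp add: continuous_on_id)

text \<open>A basic open set restricts finitely many coordinates, say with index at most \<open>k\<close>. All of them, and the fibre
  coordinate, are continuous functions of the projection of the point \<open>k\<close> steps before. Statements about the extension thus
  reduce to the torus.\<close>

lemma open_contains_image:
  assumes W: "openin (solenoid_space g) W" "q \<in> W"
  obtains k V q0 where "open V" "q0 \<in> SX" "(Fe ^^ k) q0 = q" "solenoid_proj q0 \<in> V"
    "\<And>q'. q' \<in> SX \<Longrightarrow> solenoid_proj q' \<in> V \<Longrightarrow> (Fe ^^ k) q' \<in> W"
proof -
  obtain O' where O': "open O'" "W = SX \<inter> O'" using W(1) unfolding solenoid_space_def by (auto simp: openin_open)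
  have q: "q \<in> SX" "q \<in> O'" using W(2) O'(2) by auto
  obtain zs w where zw: "q = (zs, w)" by (cases q)
  obtain A B where AB': "open A" "open B" "(zs, w) \<in> A \<times> B" "A \<times> B \<subseteq> O'"
    by (rule open_prod_elim[OF O'(1) q(2)[unfolded zw]])
  then have AB: "open A" "open B" "zs \<in> A" "w \<in> B" "A \<times> B \<subseteq> O'" by auto
  have "openin (product_topology (\<lambda>_::nat. euclidean :: circle topology) UNIV) A" using AB(1) by (simp add: open_fun_def)
  from product_topology_open_contains_basis[OF this AB(3)]
  have "\<exists>X. zs \<in> (\<Pi>\<^sub>E i\<in>UNIV. X i) \<and> (\<forall>i. open (X i)) \<and> finite {i. X i \<noteq> (UNIV :: circle set)} \<and> (\<Pi>\<^sub>E i\<in>UNIV. X i) \<subseteq> A"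
    by simp
  then obtain X where X: "zs \<in> (\<Pi>\<^sub>E i\<in>UNIV. X i)" "\<And>i. open (X i)" "finite {i. X i \<noteq> (UNIV :: circle set)}" "(\<Pi>\<^sub>E i\<in>UNIV. X i) \<subseteq> A"
    by blast
  obtain k where "\<forall>j\<in>{i. X i \<noteq> UNIV}. j \<le> k" using X(3) unfolding finite_nat_set_iff_bounded_le by blast
  then have k: "\<And>j. X j \<noteq> UNIV \<Longrightarrow> j \<le> k" by blast
  define V where "V = (\<Inter>j\<in>{..k}. (\<lambda>p. fst ((F ^^ (k - j)) p)) -` X j) \<inter> (\<lambda>p. snd ((F ^^ k) p)) -` B"
  have "open V" unfolding V_def
    by (intro open_Int open_INT ballI open_vimage X AB finite_atMost continuous_on_fst continuous_on_snd cont_pow)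
  have img: "(Fe ^^ k) q' \<in> W" if q': "q' \<in> SX" "solenoid_proj q' \<in> V" for q'
  proof -
    have "fst ((Fe ^^ k) q') j \<in> X j" for j
    proof (cases "j \<le> k")
      case True
      then show ?thesis using q'(2) ext_pow_fst[OF True, of q'] by (auto simp: V_def)
    next
      case False
      then show ?thesis using k by blast
    qed
    then have "fst ((Fe ^^ k) q') \<in> A" using X(4) by (auto simp: PiE_def Pi_def)
    moreover have "snd ((Fe ^^ k) q') = snd (solenoid_proj ((Fe ^^ k) q'))" by (simp add: solenoid_proj_def case_prod_beta)
    then have "snd ((Fe ^^ k) q') \<in> B" using q'(2) unfolding proj_ext_pow V_def by simp
    ultimately have "(fst ((Fe ^^ k) q'), snd ((Fe ^^ k) q')) \<in> O'" using AB(5) by blast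
    then show ?thesis using O'(2) ext_pow_in[OF q'(1)] by simp
  qed
  define q0 where "q0 = (pullback ^^ k) q"
  have q0: "q0 \<in> SX" "(Fe ^^ k) q0 = q" unfolding q0_def using pullback_pow_in[OF q(1)] ext_pullback_pow[OF q(1)] by auto
  have "solenoid_proj q0 \<in> V"
  proof -
    have "fst ((F ^^ (k - j)) (solenoid_proj q0)) \<in> X j" if "j \<le> k" for j
    proof -
      have "zs j = fst ((F ^^ (k - j)) (solenoid_proj q0))" using ext_pow_fst[OF that, of q0] unfolding q0(2) zw by simp
      moreover have "zs j \<in> X j" using X(1) by (auto simp: PiE_def Pi_def)
      ultimately show ?thesis by simp
    qed
    moreover have "snd ((F ^^ k) (solenoid_proj q0)) \<in> B"
      unfolding proj_ext_pow[symmetric] q0(2) zw using AB(4) by (simp add: solenoid_proj_def)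
    ultimately show ?thesis by (simp add: V_def)
  qed
  with \<open>open V\<close> q0 img show ?thesis using that by blast
qed

text \<open>Both open sets contain images of full preimages of open sets of the torus; a point of the torus that is mapped from
  one to the other lifts to the solenoid.\<close>

lemma eventually_onto_mixing_solenoid:
  assumes "eventually_onto F"
  shows "topologically_mixing (solenoid_space g) Fe"
  unfolding topologically_mixing_def
proof (intro allI impI; elim conjE)
  fix U W assume U: "openin (solenoid_space g) U" "U \<noteq> {}" and W: "openin (solenoid_space g) W" "W \<noteq> {}"
  obtain u w where uw: "u \<in> U" "w \<in> W" using U W by blast
  obtain k U0 u0 where U0: "open U0" "solenoid_proj u0 \<in> U0"
    "\<And>q'. q' \<in> SX \<Longrightarrow> solenoid_proj q' \<in> U0 \<Longrightarrow> (Fe ^^ k) q' \<in> U"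
    using open_contains_image[OF U(1) uw(1)] by metis
  obtain l W0 w0 where W0: "w0 \<in> SX" "solenoid_proj w0 \<in> W0"
    "\<And>q'. q' \<in> SX \<Longrightarrow> solenoid_proj q' \<in> W0 \<Longrightarrow> (Fe ^^ l) q' \<in> W"
    using open_contains_image[OF W(1) uw(2)] by metis
  obtain N where N: "\<And>n. n \<ge> N \<Longrightarrow> (F ^^ n) ` U0 = UNIV" using eventually_onto_later(2)[OF assms U0(1)] U0(2) by blast
  have "(Fe ^^ n) ` U \<inter> W \<noteq> {}" if n: "n \<ge> N + l" for n
  proof -
    define m where "m = n + k - l"
    have m: "m \<ge> N" "n + k = l + m" using n by (auto simp: m_def)
    have "solenoid_proj w0 \<in> (F ^^ m) ` U0" using N[OF m(1)] by simp
    then obtain p where p: "p \<in> U0" "(F ^^ m) p = solenoid_proj w0" by auto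
    obtain q where q: "q \<in> SX" "solenoid_proj q = p" by (rule proj_onto)
    have "(Fe ^^ l) ((Fe ^^ m) q) \<in> W" using W0 p q by (intro W0(3) ext_pow_in) (auto simp: proj_ext_pow)
    moreover have "(Fe ^^ l) ((Fe ^^ m) q) = (Fe ^^ n) ((Fe ^^ k) q)"
      using m(2) by (metis comp_apply funpow_add)
    moreover have "(Fe ^^ k) q \<in> U" using U0 p q by blast
    ultimately show ?thesis by auto
  qed
  then show "\<exists>N. \<forall>n\<ge>N. (Fe ^^ n) ` U \<inter> W \<noteq> {}" by blast
qed

text \<open>Write \<open>p\<close> as the \<open>k\<close>-th image of \<open>p'\<close>. Since \<open>V\<close> is eventually mapped onto the torus, it contains a point that
  is eventually mapped to the same point as the projection of \<open>p'\<close>.\<close>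

lemma Wss_dense:
  assumes "eventually_onto F" and p: "p \<in> SX"
  shows "solenoid_space g closure_of Wss g f p = topspace (solenoid_space g)"
  unfolding dense_intersects_open
proof (intro allI impI; elim conjE)
  fix W assume W: "openin (solenoid_space g) W" "W \<noteq> {}"
  then obtain w where w: "w \<in> W" by blast
  obtain k V w0 where V: "open V" "solenoid_proj w0 \<in> V"
    "\<And>q'. q' \<in> SX \<Longrightarrow> solenoid_proj q' \<in> V \<Longrightarrow> (Fe ^^ k) q' \<in> W"
    using open_contains_image[OF W(1) w] by metis
  obtain N where N: "\<And>n. n \<ge> N \<Longrightarrow> (F ^^ n) ` V = UNIV" using eventually_onto_later(2)[OF assms(1) V(1)] V(2) by blast
  define p' where "p' = (pullback ^^ k) p"
  have p': "(Fe ^^ k) p' = p" unfolding p'_def using ext_pullback_pow[OF p] .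
  have "(F ^^ (N + k)) (solenoid_proj p') \<in> (F ^^ (N + k)) ` V" using N[of "N + k"] by simp
  then obtain v where v: "v \<in> V" "(F ^^ (N + k)) v = (F ^^ (N + k)) (solenoid_proj p')" by auto
  obtain q where q: "q \<in> SX" "solenoid_proj q = v" by (rule proj_onto)
  have "solenoid_proj ((Fe ^^ N) ((Fe ^^ k) q)) = solenoid_proj ((Fe ^^ N) p)"
    using v(2) unfolding p'[symmetric] by (simp add: proj_ext_pow q(2) funpow_add)
  then have "(Fe ^^ k) q \<in> Wss g f p" unfolding Wss_def using ext_pow_in[OF q(1)] by blast
  moreover have "(Fe ^^ k) q \<in> W" using V(3) q v(1) by blast
  ultimately show "Wss g f p \<inter> W \<noteq> {}" by blast
qed

end

lemma invertible_fibresI: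
  assumes "smooth_skew_product g f" "eventually_onto (skew_map g f)" "continuous_on UNIV (skew_map g f)"
  shows "invertible_fibres g f"
proof
  show "surj g"
  proof (rule surjI)
    fix y
    have "\<exists>p. skew_map g f p = (y, undefined)" using eventually_onto_later(1)[OF assms(2)] by (metis surjD)
    then have "\<exists>z. g z = y" by (auto simp: skew_map_def)
    then show "g (SOME z. g z = y) = y" by (rule someI_ex)
  qed
  show "bij (f y)" for y using assms(1) by (auto simp: smooth_skew_product_def circle_diffeo_def)
qed (rule assms)

section \<open>Strong unstable manifolds\<close>

lemma limsup_exponential_rate:
  fixes d :: "nat \<Rightarrow> real" and B c m :: real
  assumes d: "\<And>n. 0 \<le> d n" "\<And>n. d n \<le> B / c^n" and m: "0 < m" "m < c"
  shows "limsup (\<lambda>n. elog (d n) / ereal (real n)) < ereal (- ln m)"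
proof -
  define C where "C = \<bar>B\<bar> + 1"
  have C: "C > 0" "B \<le> C" by (auto simp: C_def)
  have "\<forall>\<^sub>F n in sequentially. elog (d n) / ereal (real n) \<le> ereal (ln C / n - ln c)"
  proof (rule eventually_sequentiallyI[of 1])
    fix n :: nat assume n: "n \<ge> 1"
    show "elog (d n) / ereal (real n) \<le> ereal (ln C / n - ln c)"
    proof (cases "d n = 0")
      case True
      then show ?thesis using n by (simp add: elog_def)
    next
      case False
      then have "0 < d n" using d(1)[of n] by simp
      moreover have "d n \<le> C / c^n"
        using d(2)[of n] C m divide_right_mono[of B C "c^n"] by fastforce
      ultimately have "ln (d n) \<le> ln (C / c^n)" by simp
      also have "\<dots> = ln C - n * ln c" using C m by (simp add: ln_div ln_realpow)
      finally have "ln (d n) / n \<le> (ln C - n * ln c) / n" using n by (intro divide_right_mono) auto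
      also have "\<dots> = ln C / n - ln c" using n by (simp add: diff_divide_distrib)
      finally show ?thesis using False n by (simp add: elog_def)
    qed
  qed
  then have "limsup (\<lambda>n. elog (d n) / ereal (real n)) \<le> limsup (\<lambda>n. ereal (ln C / n - ln c))"
    by (rule Limsup_mono)
  also have "\<dots> = ereal (0 - ln c)"
  proof (rule lim_imp_Limsup)
    have "(\<lambda>n. ln C / real n) \<longlonglongrightarrow> 0" by (rule lim_const_over_n)
    then show "(\<lambda>n. ereal (ln C / n - ln c)) \<longlonglongrightarrow> ereal (0 - ln c)"
      by (intro tendsto_intros)
  qed simp
  also have "\<dots> < ereal (- ln m)" using m by simp
  finally show ?thesis .
qed

text \<open>The strong unstable manifold of \<open>p\<close> is constructed from a lift of its backward orbit.\<close>

locale solenoid_family = north_south_family + IF: invertible_fibres "circle_mult i" "circle_fibre amp i"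
begin

text \<open>The points \<open>A j\<close> need only be lifts of the coordinates of \<open>p\<close>, one by one: consecutive ones need not be related by
  multiplication by \<open>i\<close>, as the fibre maps depend only on the base point modulo \<open>1\<close>.\<close>

definition lifted_orbit :: "(nat \<Rightarrow> circle) \<times> circle \<Rightarrow> (nat \<Rightarrow> real) \<Rightarrow> (nat \<Rightarrow> real) \<Rightarrow> bool" where
  "lifted_orbit p A \<xi> \<longleftrightarrow> (\<forall>j. fst p j = to_circle (A j)) \<and> snd p = to_circle (\<xi> 0) \<and> (\<forall>j. fibre amp i (A (Suc j)) (\<xi> (Suc j)) = \<xi> j)"

lemma lifted_orbit_exists: "\<exists>A \<xi>. lifted_orbit p A \<xi>"
proof -
  define A where "A j = rep_circle (fst p j)" for j
  define \<xi> where "\<xi> = rec_nat (rep_circle (snd p)) (\<lambda>j x. fibre_inv (A (Suc j)) x)"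
  have "lifted_orbit p A \<xi>"
    by (simp add: lifted_orbit_def A_def \<xi>_def to_circle_rep fibre_inv_right)
  then show ?thesis by blast
qed

text \<open>Start at height \<open>\<xi>\<close> at time \<open>N + n\<close> in the past and go forward \<open>n\<close> steps along the displaced base orbit
  \<open>A (N + k) + t / i^k\<close>. As \<open>n\<close> grows this converges to the strong unstable leaf through the \<open>N\<close>-th point of the backward
  orbit.\<close>

fun approx_leaf :: "(nat \<Rightarrow> real) \<Rightarrow> (nat \<Rightarrow> real) \<Rightarrow> nat \<Rightarrow> nat \<Rightarrow> real \<Rightarrow> real" where
  "approx_leaf A \<xi> 0 N t = \<xi> N"
| "approx_leaf A \<xi> (Suc n) N t = fibre amp i (A (Suc N) + t / i) (approx_leaf A \<xi> n (Suc N) (t / i))"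

definition leaf :: "(nat \<Rightarrow> real) \<Rightarrow> (nat \<Rightarrow> real) \<Rightarrow> nat \<Rightarrow> real \<Rightarrow> real" where
  "leaf A \<xi> N t = lim (\<lambda>n. approx_leaf A \<xi> n N t)"

lemma approx_leaf_flat: "lift.flat (approx_leaf A \<xi> n N)"
proof (induction n arbitrary: N)
  case 0
  show ?case using lift.amp_le by (simp add: lift.flat_def)
next
  case (Suc n)
  show ?case unfolding lift.flat_def
  proof (intro allI)
    fix t t' :: real
    have "\<bar>approx_leaf A \<xi> n (Suc N) (t / i) - approx_leaf A \<xi> n (Suc N) (t' / i)\<bar> \<le>
      12 * (amp * profile_bound i) * \<bar>(A (Suc N) + t / i) - (A (Suc N) + t' / i)\<bar>"
      using Suc.IH[of "Suc N"] unfolding lift.flat_def by simp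
    from lift.cone_invariant[OF this] show "\<bar>approx_leaf A \<xi> (Suc n) N t - approx_leaf A \<xi> (Suc n) N t'\<bar> \<le> 12 * (amp * profile_bound i) * \<bar>t - t'\<bar>"
      using i by (simp add: lift_H lift_G distrib_left)
  qed
qed

context
  fixes p A \<xi> assumes p: "lifted_orbit p A \<xi>"
begin

lemma approx_leaf_0: "approx_leaf A \<xi> n N 0 = \<xi> N"
  using p by (induction n arbitrary: N) (simp_all add: lifted_orbit_def)

text \<open>Displacements shrink by \<open>i \<ge> 2\<close> in each backward step while fibre distances grow by at most \<open>5/4\<close> forward.\<close>

lemma approx_leaf_cauchy: "\<bar>approx_leaf A \<xi> (Suc n) N t - approx_leaf A \<xi> n N t\<bar> \<le> (5/8)^n * \<bar>t\<bar>"
proof (induction n arbitrary: N t)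
  case 0
  have "\<bar>approx_leaf A \<xi> 1 N t - approx_leaf A \<xi> 1 N 0\<bar> \<le> 12 * (amp * profile_bound i) * \<bar>t\<bar>"
    using approx_leaf_flat[of A \<xi> 1 N] unfolding lift.flat_def by (metis diff_zero)
  also have "\<dots> \<le> 1 * \<bar>t\<bar>" using amp by (intro mult_right_mono) auto
  finally show ?case using approx_leaf_0[of 1 N] by simp
next
  case (Suc n)
  have "\<bar>approx_leaf A \<xi> (Suc (Suc n)) N t - approx_leaf A \<xi> (Suc n) N t\<bar> \<le>
     5/4 * \<bar>approx_leaf A \<xi> (Suc n) (Suc N) (t / i) - approx_leaf A \<xi> n (Suc N) (t / i)\<bar>"
    using lift.vertical_lipschitz by (simp add: lift_H)
  also have "\<dots> \<le> 5/4 * ((5/8)^n * \<bar>t / i\<bar>)" by (intro mult_left_mono Suc.IH) auto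
  also have "\<bar>t / i\<bar> \<le> \<bar>t\<bar> / 2"
  proof -
    have "\<bar>t\<bar> / of_int i \<le> \<bar>t\<bar> / 2" using i by (intro divide_left_mono) auto
    then show ?thesis using i by (simp add: abs_divide)
  qed
  finally show ?case by (simp add: mult_left_mono)
qed

lemma approx_leaf_tendsto: "(\<lambda>n. approx_leaf A \<xi> n N t) \<longlonglongrightarrow> leaf A \<xi> N t"
proof -
  let ?u = "\<lambda>n. approx_leaf A \<xi> n N t"
  have "summable (\<lambda>n. ?u (Suc n) - ?u n)"
  proof (rule summable_comparison_test')
    show "summable (\<lambda>n. (5/8)^n * \<bar>t\<bar>)" by (intro summable_mult2 summable_geometric) simp
    show "norm (?u (Suc n) - ?u n) \<le> (5/8)^n * \<bar>t\<bar>" if "n \<ge> 0" for n using approx_leaf_cauchy by simp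
  qed
  then have "convergent (\<lambda>n. \<Sum>k<n. ?u (Suc k) - ?u k)" by (simp add: summable_iff_convergent)
  moreover have eq: "(\<lambda>n. \<Sum>k<n. ?u (Suc k) - ?u k) = (\<lambda>n. ?u n - ?u 0)" by (intro ext sum_lessThan_telescope)
  ultimately have "convergent (\<lambda>n. ?u n - ?u 0)" unfolding eq by simp
  then have "convergent ?u" using convergent_add[OF _ convergent_const[of "?u 0"], of "\<lambda>n. ?u n - ?u 0"] by simp
  then show ?thesis unfolding leaf_def by (simp add: convergent_LIMSEQ_iff)
qed

lemma leaf_flat: "lift.flat (leaf A \<xi> N)"
  unfolding lift.flat_def
proof (intro allI)
  fix t t'
  show "\<bar>leaf A \<xi> N t - leaf A \<xi> N t'\<bar> \<le> 12 * (amp * profile_bound i) * \<bar>t - t'\<bar>"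
  proof (rule LIMSEQ_le_const2)
    show "(\<lambda>n. \<bar>approx_leaf A \<xi> n N t - approx_leaf A \<xi> n N t'\<bar>) \<longlonglongrightarrow> \<bar>leaf A \<xi> N t - leaf A \<xi> N t'\<bar>"
      by (intro tendsto_intros approx_leaf_tendsto)
    show "\<exists>M. \<forall>n\<ge>M. \<bar>approx_leaf A \<xi> n N t - approx_leaf A \<xi> n N t'\<bar> \<le> 12 * (amp * profile_bound i) * \<bar>t - t'\<bar>"
      using approx_leaf_flat unfolding lift.flat_def by blast
  qed
qed

lemma leaf_0: "leaf A \<xi> N 0 = \<xi> N"
  unfolding leaf_def approx_leaf_0 by simp

lemma leaf_step: "leaf A \<xi> N t = fibre amp i (A (Suc N) + t / i) (leaf A \<xi> (Suc N) (t / i))"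
proof (rule LIMSEQ_unique)
  show "(\<lambda>n. approx_leaf A \<xi> (Suc n) N t) \<longlonglongrightarrow> leaf A \<xi> N t"
    by (rule LIMSEQ_Suc[OF approx_leaf_tendsto])
  have "isCont (fibre amp i Y) X" for Y X by (rule DERIV_isCont[OF fibre_deriv])
  then show "(\<lambda>n. approx_leaf A \<xi> (Suc n) N t) \<longlonglongrightarrow> fibre amp i (A (Suc N) + t / i) (leaf A \<xi> (Suc N) (t / i))"
    unfolding approx_leaf.simps by (intro isCont_tendsto_compose[OF _ approx_leaf_tendsto])
qed

text \<open>The point of the solenoid over the displacement \<open>s\<close> on the leaf through the \<open>n\<close>-th point of the backward orbit.\<close>

definition leaf_point :: "nat \<Rightarrow> real \<Rightarrow> (nat \<Rightarrow> circle) \<times> circle" where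
  "leaf_point n s = (\<lambda>j. to_circle (A (n + j) + s / of_int i ^ j), to_circle (leaf A \<xi> n s))"

context assumes pS: "p \<in> IF.SX"
begin

lemma A_step: "to_circle (of_int i * A (Suc j)) = to_circle (A j)"
proof -
  have "fst p \<in> solenoid (circle_mult i)" using pS by auto
  from IF.solenoidD[OF this, of j] show ?thesis using p by (simp add: lifted_orbit_def circle_mult_to_circle)
qed

lemma A_step_add: "to_circle (of_int i * (A (Suc j) + s)) = to_circle (A j + of_int i * s)"
  using A_step[of j] by (simp add: to_circle_eq_iff distrib_left)

lemma leaf_point_in: "leaf_point n s \<in> IF.SX"
proof -
  have "(\<lambda>j. to_circle (A (n + j) + s / of_int i ^ j)) \<in> solenoid (circle_mult i)"
  proof (rule IF.solenoidI)
    fix j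
    show "circle_mult i (to_circle (A (n + Suc j) + s / of_int i ^ Suc j)) = to_circle (A (n + j) + s / of_int i ^ j)"
      using A_step_add[of "n + j" "s / of_int i ^ Suc j"] i by (simp add: circle_mult_to_circle)
  qed
  then show ?thesis by (simp add: leaf_point_def)
qed

lemma ext_leaf_point: "IF.Fe (leaf_point (Suc n) (s / i)) = leaf_point n s"
proof -
  have "solenoid_shift (circle_mult i) (\<lambda>j. to_circle (A (Suc n + j) + s / i / of_int i ^ j)) = (\<lambda>j. to_circle (A (n + j) + s / of_int i ^ j))"
  proof
    fix j
    show "solenoid_shift (circle_mult i) (\<lambda>j. to_circle (A (Suc n + j) + s / i / of_int i ^ j)) j = to_circle (A (n + j) + s / of_int i ^ j)"
    proof (cases j)
      case 0
      then show ?thesis using A_step_add[of n "s / i"] i by (simp add: solenoid_shift_def circle_mult_to_circle)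
    qed (simp add: solenoid_shift_def)
  qed
  then show ?thesis using leaf_step[of n s] by (simp add: skew_ext_def leaf_point_def circle_fibre_to_circle)
qed

lemma ext_pow_leaf_point: "(IF.Fe ^^ N) (leaf_point (n + N) s) = leaf_point n (of_int i ^ N * s)"
proof (induction N arbitrary: n s)
  case (Suc N)
  have "(IF.Fe ^^ Suc N) (leaf_point (n + Suc N) s) = IF.Fe (leaf_point (Suc n) (of_int i ^ N * s))"
    using Suc.IH[of "Suc n" s] by simp
  also have "\<dots> = leaf_point n (of_int i ^ Suc N * s)"
    using ext_leaf_point[of n "of_int i ^ Suc N * s"] i by (simp add: mult.assoc)
  finally show ?case .
qed simp

lemma pullback_leaf_point: "(IF.pullback ^^ n) (leaf_point 0 s) = leaf_point n (s / of_int i ^ n)"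
proof (induction n)
  case (Suc n)
  have "(IF.pullback ^^ Suc n) (leaf_point 0 s) = IF.pullback (leaf_point n (s / of_int i ^ n))" using Suc by simp
  also have "\<dots> = IF.pullback (IF.Fe (leaf_point (Suc n) (s / of_int i ^ n / i)))" by (simp only: ext_leaf_point)
  also have "\<dots> = leaf_point (Suc n) (s / of_int i ^ Suc n)" by (simp add: IF.pullback_ext field_simps)
  finally show ?case .
qed simp

lemma leaf_point_0: "leaf_point 0 0 = p"
  using p by (intro prod_eqI ext) (simp_all add: leaf_point_def leaf_0 lifted_orbit_def)

text \<open>The distance of the backward orbits after \<open>n\<close> steps is at most \<open>2 |t| / i^n\<close>, and \<open>i\<close> exceeds the maximal fibre derivative.\<close>

lemma leaf_point_in_Wuu: "leaf_point 0 t \<in> Wuu (circle_mult i) (circle_fibre amp i) p"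
proof -
  let ?d = "\<lambda>n. dist (solenoid_proj ((skew_ext_inv (circle_mult i) (circle_fibre amp i) ^^ n) (leaf_point 0 t)))
                            (solenoid_proj ((skew_ext_inv (circle_mult i) (circle_fibre amp i) ^^ n) p))"
  have "?d n \<le> 2 * \<bar>t\<bar> / of_int i ^ n" for n
  proof -
    define s where "s = t / of_int i ^ n"
    have "\<bar>leaf A \<xi> n s - leaf A \<xi> n 0\<bar> \<le> 12 * (amp * profile_bound i) * \<bar>s\<bar>"
      using leaf_flat[of n] unfolding lift.flat_def by (metis diff_zero)
    also have "\<dots> \<le> 1 * \<bar>s\<bar>" using amp by (intro mult_right_mono) auto
    finally have l: "\<bar>leaf A \<xi> n s - leaf A \<xi> n 0\<bar> \<le> \<bar>s\<bar>" by simp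
    have "?d n = dist (solenoid_proj (leaf_point n s)) (solenoid_proj (leaf_point n 0))"
      using pullback_leaf_point[of n t] pullback_leaf_point[of n 0] leaf_point_0
        IF.inv_pow_eq_pullback[OF leaf_point_in, of n 0 t] IF.inv_pow_eq_pullback[OF pS, of n] by (simp add: s_def)
    also have "\<dots> \<le> dist (to_circle (A n + s)) (to_circle (A n)) + dist (to_circle (leaf A \<xi> n s)) (to_circle (leaf A \<xi> n 0))"
      unfolding solenoid_proj_def leaf_point_def using dist_pair_le by simp
    also have "\<dots> \<le> \<bar>s\<bar> + \<bar>s\<bar>"
      using dist_to_circle_le[of "A n + s" "A n"] dist_to_circle_le[of "leaf A \<xi> n s" "leaf A \<xi> n 0"] l by simp
    also have "\<dots> = 2 * \<bar>t\<bar> / of_int i ^ n" using i by (simp add: s_def abs_divide power_abs)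
    finally show ?thesis .
  qed
  moreover have "max_fiber_deriv (circle_fibre amp i) < of_int i" using max_fiber_deriv_bounds(2) i by linarith
  ultimately have "limsup (\<lambda>n. elog (?d n) / ereal (real n)) < ereal (- ln (max_fiber_deriv (circle_fibre amp i)))"
    using max_fiber_deriv_bounds(1) by (intro limsup_exponential_rate[where B = "2 * \<bar>t\<bar>" and c = "of_int i"]) auto
  then show ?thesis unfolding Wuu_def using leaf_point_in by blast
qed

text \<open>The leaf through the point \<open>k + N\<close> steps before \<open>p\<close> is a nearly horizontal curve, so after \<open>N\<close> steps it comes close to the
  given point of the torus; \<open>k\<close> more steps lead into \<open>W\<close>.\<close>

lemma Wuu_dense_of_lifted_orbit:
  assumes irr: "amp \<notin> \<rat>"
  shows "solenoid_space (circle_mult i) closure_of Wuu (circle_mult i) (circle_fibre amp i) p = topspace (solenoid_space (circle_mult i))"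
  unfolding dense_intersects_open
proof (intro allI impI; elim conjE)
  fix W assume W: "openin (solenoid_space (circle_mult i)) W" "W \<noteq> {}"
  then obtain w where w: "w \<in> W" by blast
  obtain k V w0 where V: "open V" "solenoid_proj w0 \<in> V"
    "\<And>q'. q' \<in> IF.SX \<Longrightarrow> solenoid_proj q' \<in> V \<Longrightarrow> (IF.Fe ^^ k) q' \<in> W"
    using IF.open_contains_image[OF W(1) w] by metis
  obtain y x where yx: "solenoid_proj w0 = to_torus (y, x)" by (rule to_torus_surj)
  obtain r where r: "r > 0" "\<And>q. dist q (to_torus (y, x)) < r \<Longrightarrow> q \<in> V" using V(1,2) unfolding open_dist yx by blast
  have "0 < r/2" using r by simp
  then obtain N where N: "\<And>l. lift.flat l \<Longrightarrow> lift.meets l N y x (r/2)"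
    using lift.curves_hit[OF refl profile_periodic irr] by blast
  define l where "l Y = leaf A \<xi> (k + N) (Y - A (k + N))" for Y
  have "lift.flat l" using leaf_flat[of "k + N"] unfolding lift.flat_def l_def by (metis diff_diff_eq2 diff_add_cancel)
  then obtain Y X and m n :: int where o: "lift.orbit Y X" "X 0 = l (Y 0)" "Y N = y + m" "\<bar>X N - n - x\<bar> \<le> r/2"
    using N unfolding lift.meets_def by blast
  define s where "s = Y 0 - A (k + N)"
  have start: "solenoid_proj (leaf_point (k + N) s) = to_torus (Y 0, X 0)"
    by (simp add: solenoid_proj_def leaf_point_def s_def o(2) l_def)
  have "(IF.F ^^ j) (to_torus (Y 0, X 0)) = to_torus (Y j, X j)" for j
  proof (induction j)
    case (Suc j)
    then have "(IF.F ^^ Suc j) (to_torus (Y 0, X 0)) = IF.F (to_torus (Y j, X j))" by simp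
    also have "\<dots> = to_torus (Y (Suc j), X (Suc j))"
      unfolding family_lift_lifts using lift.orbitD[OF o(1), of j] by (simp add: family_lift_def lift_H lift_G)
    finally show ?case .
  qed simp
  then have "solenoid_proj ((IF.Fe ^^ N) (leaf_point (k + N) s)) = to_torus (Y N, X N)"
    by (simp add: IF.proj_ext_pow start)
  also have "\<dots> = to_torus (y, X N - n)" using o(3) to_circle_add_int[of "X N - n" n] by simp
  finally have pr: "solenoid_proj (leaf_point k (of_int i ^ N * s)) = to_torus (y, X N - n)" by (simp only: ext_pow_leaf_point)
  have "dist (to_torus (y, X N - n)) (to_torus (y, x)) < r"
    using dist_pair_le[of "to_circle y" "to_circle (X N - n)" "to_circle y" "to_circle x"] dist_to_circle_le[of "X N - n" x] o(4) r(1) by simp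
  then have "(IF.Fe ^^ k) (leaf_point k (of_int i ^ N * s)) \<in> W" using pr r(2) by (intro V(3) leaf_point_in) simp
  moreover have "(IF.Fe ^^ k) (leaf_point k (of_int i ^ N * s)) \<in> Wuu (circle_mult i) (circle_fibre amp i) p"
    using ext_pow_leaf_point[of k 0] leaf_point_in_Wuu by simp
  ultimately show "Wuu (circle_mult i) (circle_fibre amp i) p \<inter> W \<noteq> {}" by blast
qed

end
end

lemma Wuu_dense:
  assumes "amp \<notin> \<rat>" "p \<in> IF.SX"
  shows "solenoid_space (circle_mult i) closure_of Wuu (circle_mult i) (circle_fibre amp i) p = topspace (solenoid_space (circle_mult i))"
  using lifted_orbit_exists Wuu_dense_of_lifted_orbit assms by blast

end

section \<open>Conclusion\<close>

lemma Cr_close_refl: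
  assumes "smooth_lift to_torus F \<Phi>" "0 < \<delta>" shows "Cr_close r \<delta> F F"
  unfolding Cr_close_def using assms by (intro conjI exI[of _ \<Phi>]) auto

lemma irrational_between:
  assumes "0 < (a::real)" obtains x where "0 < x" "x < a" "x \<notin> \<rat>"
proof -
  have "uncountable {0<..<a}" using assms by (rule uncountable_open_interval[THEN iffD2])
  then have "\<not> {0<..<a} \<subseteq> \<rat>" using countable_rat countable_subset by blast
  then obtain x where "x \<in> {0<..<a}" "x \<notin> \<rat>" by blast
  then show ?thesis using that[of x] by simp
qed

theorem theorem4p1:
  fixes i :: int and r :: nat and \<epsilon> :: real
  assumes "i > 1" and "r \<ge> 2" and "\<epsilon> > 0"
  shows "\<exists>g f.
    smooth_skew_product g f \<and>
    Cr_close r \<epsilon> (F0 i) (skew_map g f) \<and>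
    robustly_mixing_torus r g f \<and>
    robustly_mixing_solenoid r g f \<and>
    (\<exists>k y. k \<ge> 1 \<and> (g ^^ k) y = y \<and>
       (\<exists>!p. attracting_fixpoint (fiber_iter g f k y) p) \<and>
       (\<exists>!p. repelling_fixpoint (fiber_iter g f k y) p) \<and>
       (\<forall>p. fiber_iter g f k y p = p \<longrightarrow>
          attracting_fixpoint (fiber_iter g f k y) p \<or>
          repelling_fixpoint (fiber_iter g f k y) p)) \<and>
    (\<forall>p \<in> solenoid g \<times> UNIV.
       solenoid_space g closure_of Wss g f p = topspace (solenoid_space g) \<and>
       solenoid_space g closure_of Wuu g f p = topspace (solenoid_space g))"
proof -
  obtain \<eta> where \<eta>: "\<eta> > 0" "\<And>s. 0 < s \<Longrightarrow> s < \<eta> \<Longrightarrow> 1000 * (s * profile_bound i) \<le> 1 \<Longrightarrow>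
    Cr_close r \<epsilon> (F0 i) (skew_map (circle_mult i) (circle_fibre s i))"
    using family_close[OF assms(1,3)] by blast
  define L where "L = profile_bound i"
  have L: "L > 0" using profile_denominator[OF assms(1)] by (simp add: L_def profile_bound_def)
  define K where "K = nat \<lceil>4000 * L\<rceil> + 3"
  have K: "4000 * L \<le> real K" "K \<ge> 3" by (simp_all add: K_def of_nat_ceiling add_increasing2)
  define a where "a = min \<eta> (1 / (1000 * (L * K)))"
  have "a > 0" using \<eta>(1) L K(2) by (simp add: a_def)
  then obtain s where s: "0 < s" "s < a" "s \<notin> \<rat>" by (rule irrational_between)
  have "s * (1000 * (L * K)) < 1" using s(2) L K(2) by (simp add: a_def pos_less_divide_eq)
  moreover have "s * L * 3 \<le> s * L * K" using s L K(2) by (intro mult_left_mono) auto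
  moreover have "0 < s * L" using s L by simp
  ultimately have small: "1000 * (s * L) \<le> 1" "400 * (s * L) * K \<le> 1" by (simp_all add: algebra_simps)
  interpret north_south_family i s by unfold_locales (use assms s small in \<open>auto simp: L_def\<close>)
  let ?g = "circle_mult i" and ?f = "circle_fibre s i"
  have lift: "smooth_lift to_torus (skew_map ?g ?f) family_lift" unfolding smooth_lift_def using family_lift_smooth family_lift_lifts by blast
  have "1 \<le> r" using assms(2) by simp
  then obtain \<delta> where \<delta>: "\<delta> > 0" "\<And>g' f'. Cr_close r \<delta> (skew_map ?g ?f) (skew_map g' f') \<Longrightarrow>
    continuous_on UNIV (skew_map g' f') \<and> eventually_onto (skew_map g' f')"
    using robustly_eventually_onto[OF K(1)[unfolded L_def] small(2)[unfolded L_def]] by blast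
  have base: "continuous_on UNIV (skew_map ?g ?f)" "eventually_onto (skew_map ?g ?f)"
    using \<delta>(2)[OF Cr_close_refl[OF lift \<delta>(1)]] by auto
  interpret solenoid_family i s
    by (intro solenoid_family.intro north_south_family_axioms invertible_fibresI family_smooth_skew_product base)
  have g0: "?g (to_circle 0) = to_circle 0" by (simp add: circle_mult_to_circle)
  show ?thesis
  proof (intro exI[of _ ?g] exI[of _ ?f] conjI ballI)
    show "smooth_skew_product ?g ?f" by (rule family_smooth_skew_product)
    show "Cr_close r \<epsilon> (F0 i) (skew_map ?g ?f)" using s small by (intro \<eta>(2)) (auto simp: a_def L_def)
    show "robustly_mixing_torus r ?g ?f" unfolding robustly_mixing_torus_def
      using \<delta> eventually_onto_mixing by blast
    show "robustly_mixing_solenoid r ?g ?f" unfolding robustly_mixing_solenoid_def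
    proof (intro exI[of _ \<delta>] conjI allI impI \<delta>(1); elim conjE)
      fix g' f' assume F': "smooth_skew_product g' f'" "Cr_close r \<delta> (skew_map ?g ?f) (skew_map g' f')"
      then have F'2: "continuous_on UNIV (skew_map g' f')" "eventually_onto (skew_map g' f')" using \<delta>(2) by auto
      interpret invertible_fibres g' f' by (rule invertible_fibresI[OF F'(1) F'2(2,1)])
      show "topologically_mixing (solenoid_space g') (skew_ext g' f')" by (rule eventually_onto_mixing_solenoid[OF F'2(2)])
    qed
    show "\<exists>k y. k \<ge> 1 \<and> (?g ^^ k) y = y \<and>
       (\<exists>!p. attracting_fixpoint (fiber_iter ?g ?f k y) p) \<and>
       (\<exists>!p. repelling_fixpoint (fiber_iter ?g ?f k y) p) \<and>
       (\<forall>p. fiber_iter ?g ?f k y p = p \<longrightarrow>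
          attracting_fixpoint (fiber_iter ?g ?f k y) p \<or> repelling_fixpoint (fiber_iter ?g ?f k y) p)"
    proof (rule exI[of _ 1], rule exI[of _ "to_circle 0"], intro conjI)
      have "fiber_iter ?g ?f 1 (to_circle 0) = ?f (to_circle 0)" by simp
      then show "\<exists>!p. attracting_fixpoint (fiber_iter ?g ?f 1 (to_circle 0)) p"
        "\<exists>!p. repelling_fixpoint (fiber_iter ?g ?f 1 (to_circle 0)) p"
        "\<forall>p. fiber_iter ?g ?f 1 (to_circle 0) p = p \<longrightarrow>
          attracting_fixpoint (fiber_iter ?g ?f 1 (to_circle 0)) p \<or> repelling_fixpoint (fiber_iter ?g ?f 1 (to_circle 0)) p"
        using north_south by metis+
    qed (use g0 in simp_all)
    fix p assume p: "p \<in> solenoid ?g \<times> (UNIV :: circle set)"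
    show "solenoid_space ?g closure_of Wss ?g ?f p = topspace (solenoid_space ?g)" by (rule IF.Wss_dense[OF base(2) p])
    show "solenoid_space ?g closure_of Wuu ?g ?f p = topspace (solenoid_space ?g)" by (rule Wuu_dense[OF s(3) p])
  qed
qed

end
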